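(* Let $R$ be a commutative ring, $H$ an $R$-bialgebra (respectively a Hopf $R$-algebra) and $\mathfrak{F}\subset\mathcal{K}_H$ a quasi-admissible filter of $R$-cofinite $H$-ideals. \begin{enumerate} \item If $R$ is Noetherian and $\mathfrak{F}$ is an $\alpha$-filter, then $H_{\mathfrak{F}}^{\circ}$ is an $R$-bialgebra (respectively a Hopf $R$-algebra) and $(H,H_{\mathfrak{F}}^{\circ})$ is a bialgebra $\alpha$-pairing (respectively a Hopf $\alpha$-pairing). \item If $\mathfrak{F}$ is moreover cofinitary, then $H_{\mathfrak{F}}^{\circ}$ is an infinitesimal flat $R$-bialgebra (respectively Hopf $R$-algebra) and $(H,H_{\mathfrak{F}}^{\circ})$ is a bialgebra $\alpha$-pairing (respectively a Hopf $\alpha$-pairing). \end{enumerate} (In (2), "moreover" means in addition to being quasi-admissible.)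
   Context: An ideal $I$ of an $R$-algebra $A$ is $R$-cofinite if $A/I$ is a finitely generated $R$-module; $\mathcal{K}_A$ is the class of all $R$-cofinite two-sided ideals. For a filter $\mathfrak{F}$ of $R$-cofinite ideals of $A$, $A_{\mathfrak{F}}^{\circ}=\{f\in A^*: f(I)=0\text{ for some }I\in\mathfrak{F}\}$, where $A^*=\mathrm{Hom}_R(A,R)$. An $R$-pairing $(V,W)$ (with form $\langle v,w\rangle$) satisfies the $\alpha$-condition if for every $R$-module $M$ the map $M\otimes_RW\to\mathrm{Hom}_R(V,M)$, $\sum m_i\otimes w_i\mapsto[v\mapsto\sum m_i\langle v,w_i\rangle]$ is injective. $\mathfrak{F}$ is an $\alpha$-filter if $(A,A_{\mathfrak{F}}^{\circ})$ (with the evaluation form) satisfies the $\alpha$-condition; $\mathfrak{F}$ is cofinitary if every $I\in\mathfrak{F}$ contains some $J\in\mathfrak{F}$ with $A/J$ finitely generated and projective over $R$. For an $R$-bialgebra $H$ (that is not a Hopf algebra), $\mathfrak{F}\subset\mathcal{K}_H$ is quasi-admissible if (A1) for all $I,J\in\mathfrak{F}$ there is $L\in\mathfrak{F}$ with $\Delta_H(L)\subseteq\mathrm{Im}(I\otimes_RH)+\mathrm{Im}(H\otimes_RJ)$ (images in $H\otimes_RH$), and (A2) there is $I\in\mathfrak{F}$ with $I\subset\mathrm{Ker}(\varepsilon_H)$. If $H$ is a Hopf $R$-algebra, quasi-admissible requires (A1), (A2) and (A3): for every $I\in\mathfrak{F}$ there is $J\in\mathfrak{F}$ with $S_H(J)\subseteq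 I$. The (co)algebra structure on $H_{\mathfrak{F}}^{\circ}$ is the one dual to that of $H$: convolution product $(f\star g)(h)=\sum f(h_1)g(h_2)$, unity $\varepsilon_H$, comultiplication determined by $f(hh')=\sum f_1(h)f_2(h')$, counit $f\mapsto f(1_H)$, antipode (Hopf case) $f\mapsto f\circ S_H$. A bialgebra (Hopf) $\alpha$-pairing $(H,K)$ is a pair of $R$-bialgebras (Hopf $R$-algebras) with an $R$-bilinear form such that the induced maps $H\to K^*$ and $K\to H^*$ are $R$-algebra morphisms (duals with convolution product), satisfying the $\alpha$-condition as an $R$-pairing. An $R$-coalgebra $C$ (or bialgebra, Hopf algebra, as a coalgebra) is infinitesimal flat if $C=\varinjlim C_\lambda$ for a directed system of subcoalgebras $C_\lambda$ that are finitely generated projective $R$-modules. *)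

theory Defs
  imports "HOL-Algebra.Module" "HOL-Algebra.QuotRing" "HOL-Algebra.Ring_Divisibility"
begin

section \<open>Modules over a commutative ring\<close>

text \<open>Structure maps and module homomorphisms are only constrained on carriers. Sets of
  homomorphisms that become carriers themselves (duals) are cut down to extensional functions.\<close>

definition linear_maps ::
    "'r ring \<Rightarrow> ('r, 'm, 'x) module_scheme \<Rightarrow> ('r, 'n, 'y) module_scheme \<Rightarrow> ('m \<Rightarrow> 'n) set" where
  "linear_maps R M N = {f \<in> carrier M \<rightarrow> carrier N.
     (\<forall>x\<in>carrier M. \<forall>y\<in>carrier M. f (x \<oplus>\<^bsub>M\<^esub> y) = f x \<oplus>\<^bsub>N\<^esub> f y) \<and>
     (\<forall>r\<in>carrier R. \<forall>x\<in>carrier M. f (r \<odot>\<^bsub>M\<^esub> x) = r \<odot>\<^bsub>N\<^esub> f x)}"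

definition self_module :: "'r ring \<Rightarrow> ('r, 'r) module" where
  "self_module R = ring.extend R (module.fields (\<lambda>r x. r \<otimes>\<^bsub>R\<^esub> x))"

definition module_span :: "'r ring \<Rightarrow> ('r, 'm, 'x) module_scheme \<Rightarrow> 'm set \<Rightarrow> 'm set" where
  "module_span R M S = \<Inter> {N. submodule N R M \<and> S \<subseteq> N}"

definition fin_gen :: "'r ring \<Rightarrow> ('r, 'm, 'x) module_scheme \<Rightarrow> bool" where
  "fin_gen R M \<longleftrightarrow> (\<exists>S. finite S \<and> S \<subseteq> carrier M \<and> module_span R M S = carrier M)"

text \<open>Free modules and quotient modules are only modules: their ring multiplication and unit
  fields carry no information.\<close>

definition free_module :: "'r ring \<Rightarrow> 'x set \<Rightarrow> ('r, 'x \<Rightarrow> 'r) module" where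
  "free_module R X =
    \<lparr>carrier = {\<phi>. range \<phi> \<subseteq> carrier R \<and> finite {x. \<phi> x \<noteq> \<zero>\<^bsub>R\<^esub>} \<and> {x. \<phi> x \<noteq> \<zero>\<^bsub>R\<^esub>} \<subseteq> X},
     monoid.mult = undefined, one = undefined,
     zero = (\<lambda>_. \<zero>\<^bsub>R\<^esub>), add = (\<lambda>\<phi> \<psi> x. \<phi> x \<oplus>\<^bsub>R\<^esub> \<psi> x),
     smult = (\<lambda>r \<phi> x. r \<otimes>\<^bsub>R\<^esub> \<phi> x)\<rparr>"

definition free_basis :: "'r ring \<Rightarrow> 'x \<Rightarrow> ('x \<Rightarrow> 'r)" where
  "free_basis R x = (\<lambda>y. if y = x then \<one>\<^bsub>R\<^esub> else \<zero>\<^bsub>R\<^esub>)"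

definition quotient_module ::
    "'r ring \<Rightarrow> ('r, 'm, 'x) module_scheme \<Rightarrow> 'm set \<Rightarrow> ('r, 'm set) module" where
  "quotient_module R M N =
    \<lparr>carrier = a_rcosets\<^bsub>M\<^esub> N, monoid.mult = undefined, one = undefined,
     zero = N, add = set_add M,
     smult = (\<lambda>r X. \<Union>x\<in>X. N +>\<^bsub>M\<^esub> (r \<odot>\<^bsub>M\<^esub> x))\<rparr>"

text \<open>Projective means: direct summand of a free module. Unlike the lifting property this does
  not quantify over modules of arbitrary type. Basis sets inside the type of the elements
  of \<open>M\<close> suffice, because \<open>M\<close> is a quotient of the free module on its own carrier.\<close>

definition projective :: "'r ring \<Rightarrow> ('r, 'm, 'x) module_scheme \<Rightarrow> bool" where
  "projective R M \<longleftrightarrow>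
    (\<exists>(X :: 'm set). \<exists>i \<in> linear_maps R M (free_module R X).
       \<exists>p \<in> linear_maps R (free_module R X) M. \<forall>x\<in>carrier M. p (i x) = x)"


section \<open>Tensor products\<close>

text \<open>The tensor product is the free module on pairs modulo the bilinearity relations,
  so its elements are cosets of finitely supported coefficient functions.\<close>

definition tensor_relations ::
    "'r ring \<Rightarrow> ('r, 'm, 'x) module_scheme \<Rightarrow> ('r, 'n, 'y) module_scheme \<Rightarrow> ('m \<times> 'n \<Rightarrow> 'r) set"
  where
  "tensor_relations R M N =
    (let F = free_module R (carrier M \<times> carrier N); e = (\<lambda>m n. free_basis R (m, n)) in
      {e (m \<oplus>\<^bsub>M\<^esub> m') n \<ominus>\<^bsub>F\<^esub> (e m n \<oplus>\<^bsub>F\<^esub> e m' n) | m m' n.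
          m \<in> carrier M \<and> m' \<in> carrier M \<and> n \<in> carrier N} \<union>
      {e m (n \<oplus>\<^bsub>N\<^esub> n') \<ominus>\<^bsub>F\<^esub> (e m n \<oplus>\<^bsub>F\<^esub> e m n') | m n n'.
          m \<in> carrier M \<and> n \<in> carrier N \<and> n' \<in> carrier N} \<union>
      {e (r \<odot>\<^bsub>M\<^esub> m) n \<ominus>\<^bsub>F\<^esub> (r \<odot>\<^bsub>F\<^esub> e m n) | r m n.
          r \<in> carrier R \<and> m \<in> carrier M \<and> n \<in> carrier N} \<union>
      {e m (r \<odot>\<^bsub>N\<^esub> n) \<ominus>\<^bsub>F\<^esub> (r \<odot>\<^bsub>F\<^esub> e m n) | r m n.
          r \<in> carrier R \<and> m \<in> carrier M \<and> n \<in> carrier N})"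

definition tensor_null ::
    "'r ring \<Rightarrow> ('r, 'm, 'x) module_scheme \<Rightarrow> ('r, 'n, 'y) module_scheme \<Rightarrow> ('m \<times> 'n \<Rightarrow> 'r) set"
  where
  "tensor_null R M N =
     module_span R (free_module R (carrier M \<times> carrier N)) (tensor_relations R M N)"

definition tensor_elem ::
    "'r ring \<Rightarrow> ('r, 'm, 'x) module_scheme \<Rightarrow> ('r, 'n, 'y) module_scheme \<Rightarrow>
     'm \<Rightarrow> 'n \<Rightarrow> ('m \<times> 'n \<Rightarrow> 'r) set" where
  "tensor_elem R M N m n =
     tensor_null R M N +>\<^bsub>free_module R (carrier M \<times> carrier N)\<^esub> free_basis R (m, n)"

text \<open>The linear map into \<open>P\<close> on a tensor product that sends \<open>m \<otimes> n\<close> to \<open>b m n\<close>.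
  The choice of a representative of the coset is irrelevant whenever \<open>b\<close> is bilinear.
  For \<open>X = \<Sum> m\<^sub>i \<otimes> n\<^sub>i\<close> the value is the sum \<open>\<Sum> b m\<^sub>i n\<^sub>i\<close>, so this also expresses
  Sweedler notation.\<close>

definition tensor_lift ::
    "'r ring \<Rightarrow> ('r, 'p, 'z) module_scheme \<Rightarrow> ('m \<Rightarrow> 'n \<Rightarrow> 'p) \<Rightarrow> ('m \<times> 'n \<Rightarrow> 'r) set \<Rightarrow> 'p" where
  "tensor_lift R P b X =
    (let \<phi> = (SOME \<phi>. \<phi> \<in> X) in
       \<Oplus>\<^bsub>P\<^esub> q \<in> {q. \<phi> q \<noteq> \<zero>\<^bsub>R\<^esub>}. \<phi> q \<odot>\<^bsub>P\<^esub> b (fst q) (snd q))"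

text \<open>Multiplication and unit are the componentwise ones; they are only meaningful if both
  factors are algebras.\<close>

definition tensor ::
    "'r ring \<Rightarrow> ('r, 'm, 'x) module_scheme \<Rightarrow> ('r, 'n, 'y) module_scheme \<Rightarrow>
     ('r, ('m \<times> 'n \<Rightarrow> 'r) set) module" where
  "tensor R M N =
    (let Q = quotient_module R (free_module R (carrier M \<times> carrier N)) (tensor_null R M N) in
      Q\<lparr>monoid.mult := (\<lambda>X Y. tensor_lift R Q (\<lambda>a b. tensor_lift R Q
                  (\<lambda>c d. tensor_elem R M N (a \<otimes>\<^bsub>M\<^esub> c) (b \<otimes>\<^bsub>N\<^esub> d)) Y) X),
        one := tensor_elem R M N \<one>\<^bsub>M\<^esub> \<one>\<^bsub>N\<^esub>\<rparr>)"

definition tensor_map ::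
    "'r ring \<Rightarrow> ('r, 'm, 'x) module_scheme \<Rightarrow> ('r, 'n, 'y) module_scheme \<Rightarrow>
     ('a \<Rightarrow> 'm) \<Rightarrow> ('b \<Rightarrow> 'n) \<Rightarrow> ('a \<times> 'b \<Rightarrow> 'r) set \<Rightarrow> ('m \<times> 'n \<Rightarrow> 'r) set" where
  "tensor_map R M N f g = tensor_lift R (tensor R M N) (\<lambda>a b. tensor_elem R M N (f a) (g b))"

definition tensor_assoc ::
    "'r ring \<Rightarrow> ('r, 'l, 'w) module_scheme \<Rightarrow> ('r, 'm, 'x) module_scheme \<Rightarrow>
     ('r, 'n, 'y) module_scheme \<Rightarrow> (('l \<times> 'm \<Rightarrow> 'r) set \<times> 'n \<Rightarrow> 'r) set \<Rightarrow>
     ('l \<times> ('m \<times> 'n \<Rightarrow> 'r) set \<Rightarrow> 'r) set" where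
  "tensor_assoc R L M N =
    (let T = tensor R L (tensor R M N) in
      tensor_lift R T (\<lambda>X n. tensor_lift R T
        (\<lambda>l m. tensor_elem R L (tensor R M N) l (tensor_elem R M N m n)) X))"


section \<open>Algebras, coalgebras, bialgebras and Hopf algebras\<close>

text \<open>The library locale \<open>algebra\<close> requires commutativity.\<close>

locale assoc_algebra = module R A + ring A
  for R :: "'r ring" and A :: "('r, 'a, 'x) module_scheme" (structure) +
  assumes smult_mult_left:
      "\<lbrakk>r \<in> carrier R; x \<in> carrier A; y \<in> carrier A\<rbrakk> \<Longrightarrow>
        (r \<odot>\<^bsub>A\<^esub> x) \<otimes>\<^bsub>A\<^esub> y = r \<odot>\<^bsub>A\<^esub> (x \<otimes>\<^bsub>A\<^esub> y)"
    and smult_mult_right: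
      "\<lbrakk>r \<in> carrier R; x \<in> carrier A; y \<in> carrier A\<rbrakk> \<Longrightarrow>
        x \<otimes>\<^bsub>A\<^esub> (r \<odot>\<^bsub>A\<^esub> y) = r \<odot>\<^bsub>A\<^esub> (x \<otimes>\<^bsub>A\<^esub> y)"

definition algebra_homs ::
    "'r ring \<Rightarrow> ('r, 'a, 'x) module_scheme \<Rightarrow> ('r, 'b, 'y) module_scheme \<Rightarrow> ('a \<Rightarrow> 'b) set" where
  "algebra_homs R A B = linear_maps R A B \<inter> ring_hom A B"

text \<open>One record serves coalgebras and bialgebras; a coalgebra simply ignores the
  multiplication and the unit.\<close>

record ('r, 'c) coalgebra = "('r, 'c) module" +
  comult :: "'c \<Rightarrow> ('c \<times> 'c \<Rightarrow> 'r) set"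
  counit :: "'c \<Rightarrow> 'r"

record ('r, 'c) hopf_algebra = "('r, 'c) coalgebra" +
  antipode :: "'c \<Rightarrow> 'c"

locale coalgebra = module R C
  for R :: "'r ring" and C :: "('r, 'c, 'x) coalgebra_scheme" (structure) +
  assumes comult_linear: "comult C \<in> linear_maps R C (tensor R C C)"
    and counit_linear: "counit C \<in> linear_maps R C (self_module R)"
    and coassoc: "c \<in> carrier C \<Longrightarrow>
      tensor_assoc R C C C (tensor_map R (tensor R C C) C (comult C) (\<lambda>x. x) (comult C c)) =
      tensor_map R C (tensor R C C) (\<lambda>x. x) (comult C) (comult C c)"
    and counit_left: "c \<in> carrier C \<Longrightarrow>
      tensor_lift R C (\<lambda>x y. counit C x \<odot>\<^bsub>C\<^esub> y) (comult C c) = c"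
    and counit_right: "c \<in> carrier C \<Longrightarrow>
      tensor_lift R C (\<lambda>x y. counit C y \<odot>\<^bsub>C\<^esub> x) (comult C c) = c"

locale bialgebra = assoc_algebra R H + coalgebra R H
  for R :: "'r ring" and H :: "('r, 'h, 'x) coalgebra_scheme" (structure) +
  assumes comult_algebra_hom: "comult H \<in> algebra_homs R H (tensor R H H)"
    and counit_algebra_hom: "counit H \<in> algebra_homs R H (self_module R)"

locale hopf_algebra = bialgebra R H
  for R :: "'r ring" and H :: "('r, 'h, 'x) hopf_algebra_scheme" (structure) +
  assumes antipode_linear: "antipode H \<in> linear_maps R H H"
    and antipode_left: "h \<in> carrier H \<Longrightarrow>
      tensor_lift R H (\<lambda>x y. antipode H x \<otimes>\<^bsub>H\<^esub> y) (comult H h) = counit H h \<odot>\<^bsub>H\<^esub> \<one>\<^bsub>H\<^esub>"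
    and antipode_right: "h \<in> carrier H \<Longrightarrow>
      tensor_lift R H (\<lambda>x y. x \<otimes>\<^bsub>H\<^esub> antipode H y) (comult H h) = counit H h \<odot>\<^bsub>H\<^esub> \<one>\<^bsub>H\<^esub>"

definition coalgebra_homs ::
    "'r ring \<Rightarrow> ('r, 'c, 'x) coalgebra_scheme \<Rightarrow> ('r, 'd, 'y) coalgebra_scheme \<Rightarrow> ('c \<Rightarrow> 'd) set"
  where
  "coalgebra_homs R C D = {f \<in> linear_maps R C D.
     (\<forall>c\<in>carrier C. comult D (f c) = tensor_map R D D f f (comult C c)) \<and>
     (\<forall>c\<in>carrier C. counit D (f c) = counit C c)}"

text \<open>Over a ring the canonical map \<open>D \<otimes> D \<rightarrow> C \<otimes> C\<close> need not be injective. A subcoalgebra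
  is therefore a submodule which carries some coalgebra structure making the inclusion
  a coalgebra morphism.\<close>

definition subcoalgebra :: "'r ring \<Rightarrow> 'c set \<Rightarrow> ('r, 'c, 'x) coalgebra_scheme \<Rightarrow> bool" where
  "subcoalgebra R D C \<longleftrightarrow> submodule D R C \<and>
    (\<exists>\<delta> \<epsilon>. let C' = C\<lparr>carrier := D, comult := \<delta>, counit := \<epsilon>\<rparr> in
       coalgebra R C' \<and> (\<lambda>x. x) \<in> coalgebra_homs R C' C)"

text \<open>The direct limit of a directed system of subcoalgebras is a directed union.\<close>

definition infinitesimal_flat :: "'r ring \<Rightarrow> ('r, 'c, 'x) coalgebra_scheme \<Rightarrow> bool" where
  "infinitesimal_flat R C \<longleftrightarrow>
    (\<exists>\<D>. \<D> \<noteq> {} \<and> (\<forall>D\<in>\<D>. \<forall>E\<in>\<D>. \<exists>G\<in>\<D>. D \<subseteq> G \<and> E \<subseteq> G) \<and> \<Union>\<D> = carrier C \<and>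
      (\<forall>D\<in>\<D>. subcoalgebra R D C \<and>
         fin_gen R (C\<lparr>carrier := D\<rparr>) \<and> projective R (C\<lparr>carrier := D\<rparr>)))"


section \<open>Dual algebras and pairings\<close>

definition dual_carrier :: "'r ring \<Rightarrow> ('r, 'm, 'x) module_scheme \<Rightarrow> ('m \<Rightarrow> 'r) set" where
  "dual_carrier R M = linear_maps R M (self_module R) \<inter> extensional (carrier M)"

definition convolution ::
    "'r ring \<Rightarrow> ('r, 'c, 'x) coalgebra_scheme \<Rightarrow> ('c \<Rightarrow> 'r) \<Rightarrow> ('c \<Rightarrow> 'r) \<Rightarrow> 'c \<Rightarrow> 'r" where
  "convolution R C f g = (\<lambda>c\<in>carrier C.
     tensor_lift R (self_module R) (\<lambda>x y. f x \<otimes>\<^bsub>R\<^esub> g y) (comult C c))"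

definition dual_algebra ::
    "'r ring \<Rightarrow> ('r, 'c, 'x) coalgebra_scheme \<Rightarrow> ('r, 'c \<Rightarrow> 'r) module" where
  "dual_algebra R C =
    \<lparr>carrier = dual_carrier R C, monoid.mult = convolution R C, one = (\<lambda>c\<in>carrier C. counit C c),
     zero = (\<lambda>c\<in>carrier C. \<zero>\<^bsub>R\<^esub>), add = (\<lambda>f g. \<lambda>c\<in>carrier C. f c \<oplus>\<^bsub>R\<^esub> g c),
     smult = (\<lambda>r f. \<lambda>c\<in>carrier C. r \<otimes>\<^bsub>R\<^esub> f c)\<rparr>"

definition pairing ::
    "'r ring \<Rightarrow> ('r, 'v, 'x) module_scheme \<Rightarrow> ('r, 'w, 'y) module_scheme \<Rightarrow>
     ('v \<Rightarrow> 'w \<Rightarrow> 'r) \<Rightarrow> bool" where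
  "pairing R V W \<beta> \<longleftrightarrow> module R V \<and> module R W \<and>
     (\<forall>v\<in>carrier V. \<beta> v \<in> linear_maps R W (self_module R)) \<and>
     (\<forall>w\<in>carrier W. (\<lambda>v. \<beta> v w) \<in> linear_maps R V (self_module R))"

text \<open>The type argument is the type of the elements of the test modules \<open>M\<close>. It can only be
  varied from the outside, by stating a result for an arbitrary type. The type
  \<open>(nat \<Rightarrow> 'r) set\<close> contains the carriers of all quotients of the modules \<open>R\<^sup>n\<close>, i.e. up to
  isomorphism all finitely generated modules, and finitely generated test modules determine the
  condition: if \<open>\<Sum> m\<^sub>i \<otimes> w\<^sub>i\<close> is in the kernel for \<open>M\<close>, it is already in the kernel for the
  submodule generated by the finitely many \<open>m\<^sub>i\<close>, hence zero.\<close>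

definition alpha_condition ::
    "'m itself \<Rightarrow> 'r ring \<Rightarrow> ('r, 'v, 'x) module_scheme \<Rightarrow> ('r, 'w, 'y) module_scheme \<Rightarrow>
     ('v \<Rightarrow> 'w \<Rightarrow> 'r) \<Rightarrow> bool" where
  "alpha_condition _ R V W \<beta> \<longleftrightarrow> pairing R V W \<beta> \<and>
    (\<forall>M :: ('r, 'm) module. module R M \<longrightarrow>
       inj_on (\<lambda>X. \<lambda>v\<in>carrier V. tensor_lift R M (\<lambda>m w. \<beta> v w \<odot>\<^bsub>M\<^esub> m) X)
         (carrier (tensor R M W)))"

definition bialgebra_alpha_pairing ::
    "'m itself \<Rightarrow> 'r ring \<Rightarrow> ('r, 'h, 'x) coalgebra_scheme \<Rightarrow> ('r, 'k, 'y) coalgebra_scheme \<Rightarrow>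
     ('h \<Rightarrow> 'k \<Rightarrow> 'r) \<Rightarrow> bool" where
  "bialgebra_alpha_pairing T R H K \<beta> \<longleftrightarrow> bialgebra R H \<and> bialgebra R K \<and>
     (\<lambda>h. \<lambda>k\<in>carrier K. \<beta> h k) \<in> algebra_homs R H (dual_algebra R K) \<and>
     (\<lambda>k. \<lambda>h\<in>carrier H. \<beta> h k) \<in> algebra_homs R K (dual_algebra R H) \<and>
     alpha_condition T R H K \<beta>"

definition hopf_alpha_pairing ::
    "'m itself \<Rightarrow> 'r ring \<Rightarrow> ('r, 'h, 'x) hopf_algebra_scheme \<Rightarrow>
     ('r, 'k, 'y) hopf_algebra_scheme \<Rightarrow> ('h \<Rightarrow> 'k \<Rightarrow> 'r) \<Rightarrow> bool" where
  "hopf_alpha_pairing T R H K \<beta> \<longleftrightarrow>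
     hopf_algebra R H \<and> hopf_algebra R K \<and> bialgebra_alpha_pairing T R H K \<beta>"


section \<open>Filters of cofinite ideals\<close>

definition cofinite_ideals :: "'r ring \<Rightarrow> ('r, 'a, 'x) module_scheme \<Rightarrow> 'a set set" where
  "cofinite_ideals R A = {I. ideal I A \<and> fin_gen R (quotient_module R A I)}"

definition cofinite_filter :: "'r ring \<Rightarrow> ('r, 'a, 'x) module_scheme \<Rightarrow> 'a set set \<Rightarrow> bool" where
  "cofinite_filter R A \<FF> \<longleftrightarrow> \<FF> \<subseteq> cofinite_ideals R A \<and> \<FF> \<noteq> {} \<and>
     (\<forall>I\<in>\<FF>. \<forall>J\<in>\<FF>. I \<inter> J \<in> \<FF>) \<and>
     (\<forall>I\<in>\<FF>. \<forall>J\<in>cofinite_ideals R A. I \<subseteq> J \<longrightarrow> J \<in> \<FF>)"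

definition finite_dual_carrier ::
    "'r ring \<Rightarrow> ('r, 'a, 'x) module_scheme \<Rightarrow> 'a set set \<Rightarrow> ('a \<Rightarrow> 'r) set" where
  "finite_dual_carrier R A \<FF> = {f \<in> dual_carrier R A. \<exists>I\<in>\<FF>. \<forall>x\<in>I. f x = \<zero>\<^bsub>R\<^esub>}"

definition finite_dual_algebra ::
    "'r ring \<Rightarrow> ('r, 'h, 'x) coalgebra_scheme \<Rightarrow> 'h set set \<Rightarrow> ('r, 'h \<Rightarrow> 'r) module" where
  "finite_dual_algebra R H \<FF> = (dual_algebra R H)\<lparr>carrier := finite_dual_carrier R H \<FF>\<rparr>"

text \<open>The relation \<open>f (h h') = \<Sum> f\<^sub>1 h f\<^sub>2 h'\<close> between \<open>f\<close> and \<open>X = \<Sum> f\<^sub>1 \<otimes> f\<^sub>2\<close>.\<close>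

definition is_dual_comult ::
    "'r ring \<Rightarrow> ('r, 'h, 'x) coalgebra_scheme \<Rightarrow> 'h set set \<Rightarrow>
     ('h \<Rightarrow> 'r) \<Rightarrow> (('h \<Rightarrow> 'r) \<times> ('h \<Rightarrow> 'r) \<Rightarrow> 'r) set \<Rightarrow> bool" where
  "is_dual_comult R H \<FF> f X \<longleftrightarrow>
     X \<in> carrier (tensor R (finite_dual_algebra R H \<FF>) (finite_dual_algebra R H \<FF>)) \<and>
     (\<forall>h\<in>carrier H. \<forall>h'\<in>carrier H.
        f (h \<otimes>\<^bsub>H\<^esub> h') = tensor_lift R (self_module R) (\<lambda>f\<^sub>1 f\<^sub>2. f\<^sub>1 h \<otimes>\<^bsub>R\<^esub> f\<^sub>2 h') X)"

text \<open>The definite description in \<open>finite_dual_bialgebra\<close> is meaningful only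
  if the dual comultiplication is well defined in this sense.\<close>

definition dual_comult_determined ::
    "'r ring \<Rightarrow> ('r, 'h, 'x) coalgebra_scheme \<Rightarrow> 'h set set \<Rightarrow> bool" where
  "dual_comult_determined R H \<FF> \<longleftrightarrow>
     (\<forall>f\<in>finite_dual_carrier R H \<FF>. \<exists>!X. is_dual_comult R H \<FF> f X)"

definition finite_dual_bialgebra ::
    "'r ring \<Rightarrow> ('r, 'h, 'x) coalgebra_scheme \<Rightarrow> 'h set set \<Rightarrow> ('r, 'h \<Rightarrow> 'r) coalgebra" where
  "finite_dual_bialgebra R H \<FF> =
     module.extend (finite_dual_algebra R H \<FF>)
       (coalgebra.fields (\<lambda>f. THE X. is_dual_comult R H \<FF> f X) (\<lambda>f. f \<one>\<^bsub>H\<^esub>))"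

definition finite_dual_hopf ::
    "'r ring \<Rightarrow> ('r, 'h, 'x) hopf_algebra_scheme \<Rightarrow> 'h set set \<Rightarrow> ('r, 'h \<Rightarrow> 'r) hopf_algebra" where
  "finite_dual_hopf R H \<FF> =
     coalgebra.extend (finite_dual_bialgebra R H \<FF>)
       (hopf_algebra.fields (\<lambda>f. \<lambda>h\<in>carrier H. f (antipode H h)))"

definition alpha_filter ::
    "'m itself \<Rightarrow> 'r ring \<Rightarrow> ('r, 'h, 'x) coalgebra_scheme \<Rightarrow> 'h set set \<Rightarrow> bool" where
  "alpha_filter T R H \<FF> \<longleftrightarrow> alpha_condition T R H (finite_dual_algebra R H \<FF>) (\<lambda>h f. f h)"

definition cofinitary :: "'r ring \<Rightarrow> ('r, 'a, 'x) module_scheme \<Rightarrow> 'a set set \<Rightarrow> bool" where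
  "cofinitary R A \<FF> \<longleftrightarrow>
     (\<forall>I\<in>\<FF>. \<exists>J\<in>\<FF>. J \<subseteq> I \<and> fin_gen R (quotient_module R A J) \<and>
        projective R (quotient_module R A J))"

text \<open>The image of the canonical map \<open>M \<otimes> N \<rightarrow> A \<otimes> A\<close> for submodules \<open>M\<close> and \<open>N\<close> of \<open>A\<close>.\<close>

definition tensor_image ::
    "'r ring \<Rightarrow> ('r, 'a, 'x) module_scheme \<Rightarrow> 'a set \<Rightarrow> 'a set \<Rightarrow> ('a \<times> 'a \<Rightarrow> 'r) set set" where
  "tensor_image R A M N =
     tensor_map R A A (\<lambda>x. x) (\<lambda>x. x) `
       carrier (tensor R (A\<lparr>carrier := M\<rparr>) (A\<lparr>carrier := N\<rparr>))"

definition quasi_admissible ::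
    "'r ring \<Rightarrow> ('r, 'h, 'x) coalgebra_scheme \<Rightarrow> 'h set set \<Rightarrow> bool" where
  "quasi_admissible R H \<FF> \<longleftrightarrow>
     (\<forall>I\<in>\<FF>. \<forall>J\<in>\<FF>. \<exists>L\<in>\<FF>. comult H ` L \<subseteq>
        tensor_image R H I (carrier H) <+>\<^bsub>tensor R H H\<^esub> tensor_image R H (carrier H) J) \<and>
     (\<exists>I\<in>\<FF>. I \<subseteq> {h \<in> carrier H. counit H h = \<zero>\<^bsub>R\<^esub>})"

definition hopf_quasi_admissible ::
    "'r ring \<Rightarrow> ('r, 'h, 'x) hopf_algebra_scheme \<Rightarrow> 'h set set \<Rightarrow> bool" where
  "hopf_quasi_admissible R H \<FF> \<longleftrightarrow> quasi_admissible R H \<FF> \<and>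
     (\<forall>I\<in>\<FF>. \<exists>J\<in>\<FF>. antipode H ` J \<subseteq> I)"

end

theory Submission
  imports Defs
begin

text \<open>Let \<open>W\<close> be the finite dual of \<open>A\<close> with respect to the filter. The \<open>\<alpha>\<close>-condition makes the maps
  from \<open>W \<otimes> W\<close> and \<open>W \<otimes> (W \<otimes> W)\<close> to functions on \<open>A \<times> A\<close> and \<open>A \<times> A \<times> A\<close> injective
  (\<open>eval2_eqI\<close>, \<open>eval3_eqI\<close>). So every identity between tensors over \<open>W\<close> can be checked after
  evaluation at elements of \<open>A\<close>, and there each axiom for \<open>W\<close> turns into the dual axiom for \<open>A\<close>:
  coassociativity of \<open>W\<close> into associativity of \<open>A\<close>, multiplicativity of the comultiplication of \<open>W\<close>
  into multiplicativity of that of \<open>A\<close>, and so on. Quasi-admissibility says that convolution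
  products, the counit and the composites with the antipode stay in \<open>W\<close>.

  What has to be constructed is the comultiplication, a tensor \<open>Y\<close> over \<open>W\<close> with
  \<open>f (x y) = Y(x, y)\<close>, for every \<open>f \<in> W\<close>. If \<open>f\<close> vanishes on the ideal \<open>I\<close> and \<open>a\<^sub>1, \<dots>, a\<^sub>n\<close> generate
  \<open>A\<close> modulo \<open>I\<close>, then \<open>\<Sum> e\<^sub>i \<otimes> f(- a\<^sub>i)\<close> is a tensor in \<open>R\<^sup>n \<otimes> W\<close> whose values at elements of \<open>A\<close>
  lie in the submodule \<open>K\<close> of the coordinate vectors \<open>(g a\<^sub>i)\<^sub>i\<close> of functionals \<open>g\<close> on \<open>A/I\<close>. The
  \<open>\<alpha>\<close>-condition for \<open>R\<^sup>n / K\<close> shows that the tensor comes from \<open>K \<otimes> W\<close>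
  (\<open>alpha_condition_submodule\<close>), and replacing the vectors by functionals gives \<open>Y\<close>
  (\<open>dual_comult_exists\<close>). The same lemma reduces the \<open>\<alpha>\<close>-condition for all modules to the condition
  for quotients of the modules \<open>R\<^sup>n\<close> (\<open>alpha_condition_any_type\<close>).

  If the filter is cofinitary, the functionals that vanish on an ideal \<open>J\<close> with finitely generated
  projective quotient have a dual basis: finitely many \<open>y \<in> (A/J)\<^sup>*\<close> and \<open>b\<^sub>y \<in> A\<close> with
  \<open>f = \<Sum> f(b\<^sub>y) y\<close> (\<open>dual_basis_exists\<close>). Every tensor over \<open>W\<close> uses only functionals on one such
  \<open>A/J\<close>, hence is determined by its values at the \<open>b\<^sub>y\<close>; this is the \<open>\<alpha>\<close>-condition
  (\<open>cofinitary_alpha_condition\<close>), and the above applies. Moreover \<open>W\<close> is the directed union of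
  the modules \<open>(A/J)\<^sup>*\<close>. Each of them is the finite dual for the one-element family \<open>{J}\<close>, so it is a
  coalgebra for the same reason as \<open>W\<close>, and the dual basis shows that it is finitely generated
  and projective (\<open>cofinitary_infinitesimal_flat\<close>). For this reason finite duals are treated for
  directed families of ideals instead of filters.\<close>



section \<open>Linear and bilinear maps\<close>

lemma self_module_simps [simp]:
  "carrier (self_module R) = carrier R"
  "monoid.mult (self_module R) = monoid.mult R"
  "one (self_module R) = one R"
  "zero (self_module R) = zero R"
  "add (self_module R) = add R"
  "smult (self_module R) = monoid.mult R"
  by (simp_all add: self_module_def ring.defs module.defs)

lemma module_cong:
  fixes M :: "('r, 'm, 'x) module_scheme" and M' :: "('r, 'm, 'y) module_scheme"
  assumes "module R M" and c: "carrier M' = carrier M" "zero M' = zero M" "add M' = add M"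
    "\<And>r x. r \<in> carrier R \<Longrightarrow> x \<in> carrier M \<Longrightarrow> smult M' r x = smult M r x"
  shows "module R M'"
proof -
  interpret M: module R M by fact
  have "abelian_group M'"
    using abelian_groupE[OF M.M.abelian_group_axioms] by (intro abelian_groupI) (simp_all add: c)
  then show ?thesis
    by (intro moduleI M.R.cring_axioms)
      (simp_all add: c M.smult_l_distr M.smult_r_distr M.smult_assoc1)
qed

lemma self_module: assumes "cring R" shows "module R (self_module R)"
proof -
  interpret cring R by fact
  have "abelian_group (self_module R)"
    using abelian_groupE[OF abelian_group_axioms] by (intro abelian_groupI) simp_all
  then show ?thesis
    by (intro moduleI assms) (simp_all add: l_distr r_distr m_assoc)
qed

lemma module_cring: "module R M \<Longrightarrow> cring R"
  by (simp add: module_def)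

lemma module_abelian_group: "module R M \<Longrightarrow> abelian_group M"
  by (simp add: module_def)

lemma module_carrier_simps:
  assumes "module R M"
  shows "\<zero>\<^bsub>M\<^esub> \<in> carrier M"
    "\<And>x y. x \<in> carrier M \<Longrightarrow> y \<in> carrier M \<Longrightarrow> x \<oplus>\<^bsub>M\<^esub> y \<in> carrier M"
    "\<And>r x. r \<in> carrier R \<Longrightarrow> x \<in> carrier M \<Longrightarrow> r \<odot>\<^bsub>M\<^esub> x \<in> carrier M"
  using module.smult_closed[OF assms] abelian_groupE[OF module_abelian_group[OF assms]] by auto

lemma linear_mapsI:
  assumes "\<And>x. x \<in> carrier M \<Longrightarrow> f x \<in> carrier N"
    "\<And>x y. x \<in> carrier M \<Longrightarrow> y \<in> carrier M \<Longrightarrow> f (x \<oplus>\<^bsub>M\<^esub> y) = f x \<oplus>\<^bsub>N\<^esub> f y"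
    "\<And>r x. r \<in> carrier R \<Longrightarrow> x \<in> carrier M \<Longrightarrow> f (r \<odot>\<^bsub>M\<^esub> x) = r \<odot>\<^bsub>N\<^esub> f x"
  shows "f \<in> linear_maps R M N"
  using assms by (auto simp: linear_maps_def)

lemma
  assumes "f \<in> linear_maps R M N"
  shows linear_maps_closed: "x \<in> carrier M \<Longrightarrow> f x \<in> carrier N"
    and linear_maps_add: "x \<in> carrier M \<Longrightarrow> y \<in> carrier M \<Longrightarrow> f (x \<oplus>\<^bsub>M\<^esub> y) = f x \<oplus>\<^bsub>N\<^esub> f y"
    and linear_maps_smult: "r \<in> carrier R \<Longrightarrow> x \<in> carrier M \<Longrightarrow> f (r \<odot>\<^bsub>M\<^esub> x) = r \<odot>\<^bsub>N\<^esub> f x"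
  using assms by (auto simp: linear_maps_def)

lemma linear_maps_cong_scheme:
  assumes "carrier M' = carrier M" "add M' = add M" "smult M' = smult M"
    "carrier N' = carrier N" "add N' = add N" "smult N' = smult N"
  shows "linear_maps R M' N' = linear_maps R M N"
  using assms by (simp add: linear_maps_def)

lemma linear_maps_cong_fun:
  assumes "f \<in> linear_maps R M N" "module R M" "\<And>x. x \<in> carrier M \<Longrightarrow> f x = g x"
  shows "g \<in> linear_maps R M N"
  using assms module_carrier_simps[OF assms(2)]
  by (auto simp: linear_maps_def Pi_def)

lemma linear_maps_hom:
  assumes "f \<in> linear_maps R M N" "module R M" "module R N"
  shows "f \<in> hom (add_monoid M) (add_monoid N)"
  using assms by (auto simp: linear_maps_def hom_def)

lemma linear_maps_zero:
  assumes "f \<in> linear_maps R M N" "module R M" "module R N"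
  shows "f \<zero>\<^bsub>M\<^esub> = \<zero>\<^bsub>N\<^esub>"
proof -
  interpret M: module R M by fact
  interpret N: module R N by fact
  show ?thesis
    using hom_one[OF linear_maps_hom[OF assms] M.M.a_group N.M.a_group] by simp
qed

lemma linear_maps_diff:
  assumes "f \<in> linear_maps R M N" "module R M" "module R N" "x \<in> carrier M" "y \<in> carrier M"
  shows "f (x \<ominus>\<^bsub>M\<^esub> y) = f x \<ominus>\<^bsub>N\<^esub> f y"
proof -
  interpret M: module R M by fact
  interpret N: module R N by fact
  interpret group_hom "add_monoid M" "add_monoid N" f
    using linear_maps_hom[OF assms(1-3)] M.M.a_group N.M.a_group
    by (simp add: group_hom_def group_hom_axioms_def)
  show ?thesis
    using hom_inv[of y] assms linear_maps_add[OF assms(1)]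
    by (simp add: a_minus_def a_inv_def[symmetric])
qed

lemma linear_maps_finsum:
  assumes f: "f \<in> linear_maps R M N" and "module R M" "module R N" "finite A"
    "g \<in> A \<rightarrow> carrier M"
  shows "f (\<Oplus>\<^bsub>M\<^esub>i\<in>A. g i) = (\<Oplus>\<^bsub>N\<^esub>i\<in>A. f (g i))"
proof -
  interpret M: module R M by fact
  interpret N: module R N by fact
  show ?thesis
    using \<open>finite A\<close> \<open>g \<in> A \<rightarrow> carrier M\<close>
  proof (induct A rule: finite_induct)
    case empty then show ?case by (simp add: linear_maps_zero[OF f] assms)
  next
    case (insert a A)
    then show ?case
      by (simp add: linear_maps_add[OF f] Pi_def linear_maps_closed[OF f])
  qed
qed

lemma linear_maps_id: "(\<lambda>x. x) \<in> linear_maps R M M"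
  by (auto simp: linear_maps_def)

lemma linear_maps_comp:
  assumes "g \<in> linear_maps R N P" "f \<in> linear_maps R M N"
  shows "(\<lambda>x. g (f x)) \<in> linear_maps R M P"
  using assms by (auto simp: linear_maps_def Pi_def)

lemma linear_maps_const_zero:
  assumes "module R M" "module R N" shows "(\<lambda>x. \<zero>\<^bsub>N\<^esub>) \<in> linear_maps R M N"
proof -
  interpret N: module R N by fact
  show ?thesis by (auto simp: linear_maps_def)
qed

lemma linear_maps_sum:
  assumes "module R M" "module R N" "f \<in> linear_maps R M N" "g \<in> linear_maps R M N"
  shows "(\<lambda>x. f x \<oplus>\<^bsub>N\<^esub> g x) \<in> linear_maps R M N"
proof -
  interpret M: module R M by fact
  interpret N: module R N by fact
  show ?thesis
    using linear_maps_closed[OF assms(3)] linear_maps_closed[OF assms(4)]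
    by (intro linear_mapsI)
      (simp_all add: linear_maps_add[OF assms(3)] linear_maps_add[OF assms(4)] N.M.a_ac
        linear_maps_smult[OF assms(3)] linear_maps_smult[OF assms(4)] N.smult_r_distr)
qed

lemma linear_maps_smult_left:
  assumes "module R M" "module R N" "r \<in> carrier R" "f \<in> linear_maps R M N"
  shows "(\<lambda>x. r \<odot>\<^bsub>N\<^esub> f x) \<in> linear_maps R M N"
proof -
  interpret N: module R N by fact
  show ?thesis
    using assms linear_maps_closed[OF assms(4)]
    by (intro linear_mapsI)
      (auto simp: linear_maps_add[OF assms(4)] linear_maps_smult[OF assms(4)]
        N.smult_r_distr N.smult_assoc1[symmetric] N.R.m_comm)
qed

lemma linear_maps_smult_right:
  assumes "module R M" "module R N" "f \<in> linear_maps R M (self_module R)" "n \<in> carrier N"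
  shows "(\<lambda>x. f x \<odot>\<^bsub>N\<^esub> n) \<in> linear_maps R M N"
proof -
  interpret N: module R N by fact
  show ?thesis
    using assms linear_maps_closed[OF assms(3)]
    by (intro linear_mapsI)
      (auto simp: linear_maps_add[OF assms(3)] linear_maps_smult[OF assms(3)]
        N.smult_l_distr N.smult_assoc1)
qed

lemma linear_maps_mult_left:
  assumes "module R M" "r \<in> carrier R" "f \<in> linear_maps R M (self_module R)"
  shows "(\<lambda>x. r \<otimes>\<^bsub>R\<^esub> f x) \<in> linear_maps R M (self_module R)"
  using linear_maps_smult_left[OF assms(1) self_module assms(2,3)] module_cring[OF assms(1)] by simp

lemma linear_maps_mult_right:
  assumes "module R M" "f \<in> linear_maps R M (self_module R)" "r \<in> carrier R"
  shows "(\<lambda>x. f x \<otimes>\<^bsub>R\<^esub> r) \<in> linear_maps R M (self_module R)"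
  using linear_maps_smult_right[OF assms(1) self_module assms(2)] assms(3) module_cring[OF assms(1)]
  by simp

abbreviation functionals :: "'r ring \<Rightarrow> ('r, 'm, 'x) module_scheme \<Rightarrow> ('m \<Rightarrow> 'r) set" where
  "functionals R M \<equiv> linear_maps R M (self_module R)"

definition bilinear_maps ::
    "'r ring \<Rightarrow> ('r, 'm, 'x) module_scheme \<Rightarrow> ('r, 'n, 'y) module_scheme \<Rightarrow>
     ('r, 'p, 'z) module_scheme \<Rightarrow> ('m \<Rightarrow> 'n \<Rightarrow> 'p) set" where
  "bilinear_maps R M N P = {b. (\<forall>m\<in>carrier M. b m \<in> linear_maps R N P) \<and>
     (\<forall>n\<in>carrier N. (\<lambda>m. b m n) \<in> linear_maps R M P)}"

lemma bilinear_mapsI: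
  assumes "\<And>m. m \<in> carrier M \<Longrightarrow> b m \<in> linear_maps R N P"
    "\<And>n. n \<in> carrier N \<Longrightarrow> (\<lambda>m. b m n) \<in> linear_maps R M P"
  shows "b \<in> bilinear_maps R M N P"
  using assms by (simp add: bilinear_maps_def)

lemma
  assumes "b \<in> bilinear_maps R M N P"
  shows bilinear_maps_right: "m \<in> carrier M \<Longrightarrow> b m \<in> linear_maps R N P"
    and bilinear_maps_left: "n \<in> carrier N \<Longrightarrow> (\<lambda>m. b m n) \<in> linear_maps R M P"
    and bilinear_maps_closed: "m \<in> carrier M \<Longrightarrow> n \<in> carrier N \<Longrightarrow> b m n \<in> carrier P"
  using assms by (auto simp: bilinear_maps_def linear_maps_def)


lemma linear_maps_finsum_pointwise:
  assumes M: "module R M" and N: "module R N" and "finite Y"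
    and "\<And>y. y \<in> Y \<Longrightarrow> g y \<in> linear_maps R M N"
  shows "(\<lambda>x. \<Oplus>\<^bsub>N\<^esub>y\<in>Y. g y x) \<in> linear_maps R M N"
proof -
  interpret N: module R N by (rule N)
  show ?thesis
    using assms(3,4)
  proof (induct Y rule: finite_induct)
    case empty
    show ?case using linear_maps_const_zero[OF M N] by simp
  next
    case (insert y Y)
    have gc: "g z x \<in> carrier N" if "z \<in> insert y Y" "x \<in> carrier M" for z x
      using linear_maps_closed[OF insert(4)[OF that(1)] that(2)] .
    have "(\<lambda>x. g y x \<oplus>\<^bsub>N\<^esub> (\<Oplus>\<^bsub>N\<^esub>y\<in>Y. g y x)) \<in> linear_maps R M N"
      using insert by (intro linear_maps_sum[OF M N]) auto
    then show ?case
      by (rule linear_maps_cong_fun[OF _ M])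
        (use insert(1,2) gc in \<open>simp add: Pi_def\<close>)
  qed
qed

lemma separating_family_eq:
  assumes "module R T" "module R P" and \<phi>: "\<And>i. i \<in> I \<Longrightarrow> \<phi> i \<in> linear_maps R T P"
    and sep: "\<And>X. X \<in> carrier T \<Longrightarrow> (\<And>i. i \<in> I \<Longrightarrow> \<phi> i X = \<zero>\<^bsub>P\<^esub>) \<Longrightarrow> X = \<zero>\<^bsub>T\<^esub>"
    and X: "X \<in> carrier T" and Y: "Y \<in> carrier T" and eq: "\<And>i. i \<in> I \<Longrightarrow> \<phi> i X = \<phi> i Y"
  shows "X = Y"
proof -
  interpret T: module R T by fact
  interpret P: module R P by fact
  have "\<phi> i (X \<ominus>\<^bsub>T\<^esub> Y) = \<zero>\<^bsub>P\<^esub>" if "i \<in> I" for i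
    using linear_maps_diff[OF \<phi>[OF that] assms(1,2) X Y] eq[OF that] linear_maps_closed[OF \<phi>[OF that] Y]
    by (simp add: a_minus_def P.M.r_neg)
  then have "X \<ominus>\<^bsub>T\<^esub> Y = \<zero>\<^bsub>T\<^esub>" using X Y by (intro sep) auto
  then show ?thesis
    using X Y T.M.minus_equality[of X "\<ominus>\<^bsub>T\<^esub> Y"] by (simp add: a_minus_def)
qed


section \<open>Submodules, spans and quotients\<close>

lemma
  assumes "module R M" "submodule N R M"
  shows submodule_subset: "N \<subseteq> carrier M"
    and submodule_zero: "\<zero>\<^bsub>M\<^esub> \<in> N"
    and submodule_add: "x \<in> N \<Longrightarrow> y \<in> N \<Longrightarrow> x \<oplus>\<^bsub>M\<^esub> y \<in> N"
    and submodule_smult: "r \<in> carrier R \<Longrightarrow> x \<in> N \<Longrightarrow> r \<odot>\<^bsub>M\<^esub> x \<in> N"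
  using module.submoduleE[OF assms] subgroup.one_closed[OF submodule.axioms(1)[OF assms(2)]]
  by auto

lemma submoduleI':
  assumes "module R M" "N \<subseteq> carrier M" "\<zero>\<^bsub>M\<^esub> \<in> N"
    "\<And>x y. x \<in> N \<Longrightarrow> y \<in> N \<Longrightarrow> x \<oplus>\<^bsub>M\<^esub> y \<in> N"
    "\<And>r x. r \<in> carrier R \<Longrightarrow> x \<in> N \<Longrightarrow> r \<odot>\<^bsub>M\<^esub> x \<in> N"
  shows "submodule N R M"
proof -
  interpret module R M by fact
  have "\<ominus>\<^bsub>M\<^esub> x \<in> N" if "x \<in> N" for x
    using assms(5)[of "\<ominus>\<^bsub>R\<^esub> \<one>\<^bsub>R\<^esub>" x] that assms(2) smult_l_minus[of "\<one>\<^bsub>R\<^esub>" x] by auto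
  then show ?thesis using assms by (intro submoduleI) auto
qed

lemma submodule_finsum:
  assumes "module R M" "submodule N R M" "finite A" "g \<in> A \<rightarrow> N"
  shows "(\<Oplus>\<^bsub>M\<^esub>i\<in>A. g i) \<in> N"
proof -
  interpret module R M by fact
  show ?thesis
    using assms(3,4)
  proof (induct A rule: finite_induct)
    case empty then show ?case using submodule_zero[OF assms(1,2)] by simp
  next
    case (insert a A)
    then show ?case
      using submodule_subset[OF assms(1,2)]
      by (simp add: Pi_def subset_iff submodule_add[OF assms(1,2)])
  qed
qed

lemma module_span_least:
  "submodule N R M \<Longrightarrow> S \<subseteq> N \<Longrightarrow> module_span R M S \<subseteq> N"
  by (auto simp: module_span_def)

lemma module_span_superset: "S \<subseteq> module_span R M S"
  by (auto simp: module_span_def)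

lemma module_span_submodule:
  assumes "module R M" "S \<subseteq> carrier M"
  shows "submodule (module_span R M S) R M"
proof (rule submoduleI'[OF assms(1)])
  interpret module R M by fact
  show "module_span R M S \<subseteq> carrier M"
    by (rule module_span_least[OF carrier_is_submodule assms(2)])
qed (auto simp: module_span_def intro: submodule_zero[OF assms(1)] submodule_add[OF assms(1)]
      submodule_smult[OF assms(1)])

text \<open>To show that the tensors in the span of some set take the same values as suitable tensors over
  another module, it suffices, by this lemma, to look at the generators.\<close>

lemma linear_relation_submodule:
  assumes T: "module R T" and U: "module R U" and P: "module R P"
    and \<phi>: "\<And>i. i \<in> I \<Longrightarrow> \<phi> i \<in> linear_maps R T P" and \<psi>: "\<And>i. i \<in> I \<Longrightarrow> \<psi> i \<in> linear_maps R U P"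
  shows "submodule {x \<in> carrier T. \<exists>y\<in>carrier U. \<forall>i\<in>I. \<phi> i x = \<psi> i y} R T"
proof (rule submoduleI'[OF T])
  show "\<zero>\<^bsub>T\<^esub> \<in> {x \<in> carrier T. \<exists>y\<in>carrier U. \<forall>i\<in>I. \<phi> i x = \<psi> i y}"
    using module_carrier_simps(1)[OF T] module_carrier_simps(1)[OF U] by (auto simp: linear_maps_zero[OF \<phi> T P] linear_maps_zero[OF \<psi> U P] intro!: bexI)
next
  fix x x' assume "x \<in> {x \<in> carrier T. \<exists>y\<in>carrier U. \<forall>i\<in>I. \<phi> i x = \<psi> i y}"
    "x' \<in> {x \<in> carrier T. \<exists>y\<in>carrier U. \<forall>i\<in>I. \<phi> i x = \<psi> i y}"
  then obtain y y' where x: "x \<in> carrier T" "x' \<in> carrier T" and y: "y \<in> carrier U" "y' \<in> carrier U"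
    and eq: "\<And>i. i \<in> I \<Longrightarrow> \<phi> i x = \<psi> i y" "\<And>i. i \<in> I \<Longrightarrow> \<phi> i x' = \<psi> i y'" by auto
  have "\<forall>i\<in>I. \<phi> i (x \<oplus>\<^bsub>T\<^esub> x') = \<psi> i (y \<oplus>\<^bsub>U\<^esub> y')"
    using x y eq by (simp add: linear_maps_add[OF \<phi>] linear_maps_add[OF \<psi>])
  then show "x \<oplus>\<^bsub>T\<^esub> x' \<in> {x \<in> carrier T. \<exists>y\<in>carrier U. \<forall>i\<in>I. \<phi> i x = \<psi> i y}"
    using module_carrier_simps(2)[OF T x] module_carrier_simps(2)[OF U y] by blast
next
  fix r x assume r: "r \<in> carrier R" and "x \<in> {x \<in> carrier T. \<exists>y\<in>carrier U. \<forall>i\<in>I. \<phi> i x = \<psi> i y}"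
  then obtain y where x: "x \<in> carrier T" and y: "y \<in> carrier U" and eq: "\<And>i. i \<in> I \<Longrightarrow> \<phi> i x = \<psi> i y"
    by auto
  have "\<forall>i\<in>I. \<phi> i (r \<odot>\<^bsub>T\<^esub> x) = \<psi> i (r \<odot>\<^bsub>U\<^esub> y)"
    using r x y eq by (simp add: linear_maps_smult[OF \<phi>] linear_maps_smult[OF \<psi>])
  then show "r \<odot>\<^bsub>T\<^esub> x \<in> {x \<in> carrier T. \<exists>y\<in>carrier U. \<forall>i\<in>I. \<phi> i x = \<psi> i y}"
    using module_carrier_simps(3)[OF T r x] module_carrier_simps(3)[OF U r y] by blast
qed auto

text \<open>With \<open>module_span_least\<close>, this reduces the equality of two linear maps to a generating set.\<close>

lemma linear_maps_equalizer_submodule: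
  assumes f: "f \<in> linear_maps R M N" and g: "g \<in> linear_maps R M N" and M: "module R M" and N: "module R N"
  shows "submodule {x \<in> carrier M. f x = g x} R M"
  by (rule submoduleI'[OF M])
    (auto simp: module_carrier_simps[OF M] linear_maps_zero[OF f M N] linear_maps_zero[OF g M N]
      linear_maps_add[OF f] linear_maps_add[OF g] linear_maps_smult[OF f] linear_maps_smult[OF g])

lemma linear_maps_kernel_submodule:
  assumes "f \<in> linear_maps R M N" "module R M" "module R N"
  shows "submodule {x \<in> carrier M. f x = \<zero>\<^bsub>N\<^esub>} R M"
  by (rule linear_maps_equalizer_submodule[OF assms(1) linear_maps_const_zero[OF assms(2,3)] assms(2,3)])

context
  fixes R :: "'r ring" and M :: "('r, 'm, 'x) module_scheme" and N :: "'m set"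
  assumes mod: "module R M" and sub: "submodule N R M"
begin

interpretation module R M by (rule mod)

interpretation N: abelian_subgroup N M
  using submodule.axioms(1)[OF sub] M.abelian_group_axioms
  by (intro abelian_subgroupI3 additive_subgroupI)

lemma quotient_coset_eq_iff:
  assumes "x \<in> carrier M" "y \<in> carrier M"
  shows "N +>\<^bsub>M\<^esub> x = N +>\<^bsub>M\<^esub> y \<longleftrightarrow> x \<ominus>\<^bsub>M\<^esub> y \<in> N"
  using N.a_rcos_module[OF assms(2,1)] N.a_repr_independence'[of x y] N.a_repr_independenceD[of x y]
    assms by (auto simp: a_minus_def)

lemma quotient_coset_self: "x \<in> carrier M \<Longrightarrow> x \<in> N +>\<^bsub>M\<^esub> x"
  by (rule N.a_rcos_self)

lemma quotient_carrier: "carrier (quotient_module R M N) = (\<lambda>x. N +>\<^bsub>M\<^esub> x) ` carrier M"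
  by (auto simp: quotient_module_def A_RCOSETS_def' a_r_coset_def')

lemma quotient_coset_mem:
  assumes "X \<in> carrier (quotient_module R M N)" "x \<in> X"
  shows "x \<in> carrier M" "X = N +>\<^bsub>M\<^esub> x"
proof -
  obtain y where "y \<in> carrier M" "X = N +>\<^bsub>M\<^esub> y" using assms by (auto simp: quotient_carrier)
  then show "x \<in> carrier M" "X = N +>\<^bsub>M\<^esub> x"
    using assms N.a_elemrcos_carrier N.a_repr_independence' by auto
qed

lemma quotient_coset_zero_iff:
  assumes "x \<in> carrier M"
  shows "N +>\<^bsub>M\<^esub> x = \<zero>\<^bsub>quotient_module R M N\<^esub> \<longleftrightarrow> x \<in> N"
  using quotient_coset_eq_iff[OF assms, of "\<zero>\<^bsub>M\<^esub>"] assms N.a_rcos_const[of "\<zero>\<^bsub>M\<^esub>"]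
  by (simp add: quotient_module_def a_minus_def M.minus_equality[of "\<zero>\<^bsub>M\<^esub>" "\<zero>\<^bsub>M\<^esub>"])

lemma quotient_add:
  assumes "x \<in> carrier M" "y \<in> carrier M"
  shows "(N +>\<^bsub>M\<^esub> x) \<oplus>\<^bsub>quotient_module R M N\<^esub> (N +>\<^bsub>M\<^esub> y) = N +>\<^bsub>M\<^esub> (x \<oplus>\<^bsub>M\<^esub> y)"
  using N.a_rcos_sum[OF assms] by (simp add: quotient_module_def)

lemma quotient_smult:
  assumes "r \<in> carrier R" "x \<in> carrier M"
  shows "r \<odot>\<^bsub>quotient_module R M N\<^esub> (N +>\<^bsub>M\<^esub> x) = N +>\<^bsub>M\<^esub> (r \<odot>\<^bsub>M\<^esub> x)"
proof -
  have "N +>\<^bsub>M\<^esub> (r \<odot>\<^bsub>M\<^esub> y) = N +>\<^bsub>M\<^esub> (r \<odot>\<^bsub>M\<^esub> x)" if y: "y \<in> N +>\<^bsub>M\<^esub> x" for y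
  proof -
    have yc: "y \<in> carrier M" using N.a_elemrcos_carrier[OF assms(2) y] .
    have "y \<ominus>\<^bsub>M\<^esub> x \<in> N" using y assms yc N.a_rcos_module[of x y] by (simp add: a_minus_def)
    then have "r \<odot>\<^bsub>M\<^esub> (y \<ominus>\<^bsub>M\<^esub> x) \<in> N" using assms submodule_smult[OF mod sub] by blast
    moreover have "r \<odot>\<^bsub>M\<^esub> (y \<ominus>\<^bsub>M\<^esub> x) = r \<odot>\<^bsub>M\<^esub> y \<ominus>\<^bsub>M\<^esub> r \<odot>\<^bsub>M\<^esub> x"
      using assms yc by (simp add: a_minus_def smult_r_distr smult_r_minus)
    ultimately show ?thesis using assms yc by (simp add: quotient_coset_eq_iff)
  qed
  moreover have "N +>\<^bsub>M\<^esub> x \<noteq> {}" using N.a_rcos_self[OF assms(2)] by blast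
  ultimately have "(\<Union>y\<in>N +>\<^bsub>M\<^esub> x. N +>\<^bsub>M\<^esub> (r \<odot>\<^bsub>M\<^esub> y)) = N +>\<^bsub>M\<^esub> (r \<odot>\<^bsub>M\<^esub> x)"
    by (intro SUP_eq_const)
  then show ?thesis by (simp add: quotient_module_def)
qed

lemma quotient_is_module: "module R (quotient_module R M N)"
proof (rule moduleI)
  let ?Q = "quotient_module R M N"
  note Q = quotient_carrier quotient_add quotient_smult
  have z: "\<zero>\<^bsub>?Q\<^esub> = N +>\<^bsub>M\<^esub> \<zero>\<^bsub>M\<^esub>" using quotient_coset_zero_iff[of "\<zero>\<^bsub>M\<^esub>"] by simp
  show "abelian_group ?Q"
  proof (rule abelian_groupI)
    fix X assume "X \<in> carrier ?Q"
    then obtain x where "x \<in> carrier M" "X = N +>\<^bsub>M\<^esub> x" by (auto simp: Q)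
    then show "\<exists>Y\<in>carrier ?Q. Y \<oplus>\<^bsub>?Q\<^esub> X = \<zero>\<^bsub>?Q\<^esub>"
      by (intro bexI[of _ "N +>\<^bsub>M\<^esub> (\<ominus>\<^bsub>M\<^esub> x)"]) (auto simp: Q z M.l_neg)
  qed (auto simp: Q z M.a_ac)
qed (auto simp: quotient_carrier quotient_add quotient_smult R.cring_axioms
      smult_l_distr smult_r_distr smult_assoc1)

lemma quotient_projection_linear:
  "(\<lambda>x. N +>\<^bsub>M\<^esub> x) \<in> linear_maps R M (quotient_module R M N)"
  by (rule linear_mapsI) (auto simp: quotient_carrier quotient_add quotient_smult)

text \<open>The universal property of the quotient. A linear map that vanishes on \<open>N\<close> is constant on each
  coset, so it does not matter which representative \<open>SOME\<close> picks.\<close>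

lemma quotient_lift_linear:
  assumes f: "f \<in> linear_maps R M P" and P: "module R P"
    and ker: "\<And>x. x \<in> N \<Longrightarrow> f x = \<zero>\<^bsub>P\<^esub>"
  shows "(\<lambda>X. f (SOME x. x \<in> X)) \<in> linear_maps R (quotient_module R M N) P"
    and "x \<in> carrier M \<Longrightarrow> f (SOME y. y \<in> N +>\<^bsub>M\<^esub> x) = f x"
proof -
  interpret P: module R P by fact
  show *: "f (SOME y. y \<in> N +>\<^bsub>M\<^esub> x) = f x" if x: "x \<in> carrier M" for x
  proof -
    let ?y = "SOME y. y \<in> N +>\<^bsub>M\<^esub> x"
    have y: "?y \<in> N +>\<^bsub>M\<^esub> x" using N.a_rcos_self[OF x] by (rule someI)
    have yc: "?y \<in> carrier M" using N.a_elemrcos_carrier[OF x y] .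
    have "?y \<ominus>\<^bsub>M\<^esub> x \<in> N" using y x yc N.a_rcos_module[of x ?y] by (simp add: a_minus_def)
    then have "f ?y \<ominus>\<^bsub>P\<^esub> f x = \<zero>\<^bsub>P\<^esub>"
      using ker linear_maps_diff[OF f mod P yc x] by simp
    then show ?thesis
      using linear_maps_closed[OF f x] linear_maps_closed[OF f yc]
        P.M.minus_equality[of "f ?y" "\<ominus>\<^bsub>P\<^esub> f x"] by (simp add: a_minus_def)
  qed
  show "(\<lambda>X. f (SOME x. x \<in> X)) \<in> linear_maps R (quotient_module R M N) P"
    by (rule linear_mapsI) (auto simp: quotient_carrier quotient_add quotient_smult *
        linear_maps_closed[OF f] linear_maps_add[OF f] linear_maps_smult[OF f])
qed

end


section \<open>Free modules\<close>

lemma free_module_simps [simp]: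
  "\<phi> \<in> carrier (free_module R X) \<longleftrightarrow>
     (\<forall>x. \<phi> x \<in> carrier R) \<and> finite {x. \<phi> x \<noteq> \<zero>\<^bsub>R\<^esub>} \<and> {x. \<phi> x \<noteq> \<zero>\<^bsub>R\<^esub>} \<subseteq> X"
  "zero (free_module R X) = (\<lambda>_. \<zero>\<^bsub>R\<^esub>)"
  "add (free_module R X) = (\<lambda>\<phi> \<psi> x. \<phi> x \<oplus>\<^bsub>R\<^esub> \<psi> x)"
  "smult (free_module R X) = (\<lambda>r \<phi> x. r \<otimes>\<^bsub>R\<^esub> \<phi> x)"
  by (auto simp: free_module_def)

lemma free_module_is_module:
  fixes R :: "'r ring" and X :: "'q set"
  assumes "cring R" shows "module R (free_module R X)"
proof -
  interpret cring R by fact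
  let ?F = "free_module R X"
  have sum: "{x. \<phi> x \<oplus>\<^bsub>R\<^esub> \<psi> x \<noteq> \<zero>\<^bsub>R\<^esub>} \<subseteq> {x. \<phi> x \<noteq> \<zero>\<^bsub>R\<^esub>} \<union> {x. \<psi> x \<noteq> \<zero>\<^bsub>R\<^esub>}" for \<phi> \<psi> :: "'q \<Rightarrow> 'r"
    by auto
  have add: "(\<lambda>x. \<phi> x \<oplus>\<^bsub>R\<^esub> \<psi> x) \<in> carrier ?F" if "\<phi> \<in> carrier ?F" "\<psi> \<in> carrier ?F" for \<phi> \<psi>
  proof -
    have "finite ({x. \<phi> x \<noteq> \<zero>\<^bsub>R\<^esub>} \<union> {x. \<psi> x \<noteq> \<zero>\<^bsub>R\<^esub>})"
      "{x. \<phi> x \<noteq> \<zero>\<^bsub>R\<^esub>} \<union> {x. \<psi> x \<noteq> \<zero>\<^bsub>R\<^esub>} \<subseteq> X" using that by simp_all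
    with sum[of \<phi> \<psi>] have "finite {x. \<phi> x \<oplus>\<^bsub>R\<^esub> \<psi> x \<noteq> \<zero>\<^bsub>R\<^esub>}"
      "{x. \<phi> x \<oplus>\<^bsub>R\<^esub> \<psi> x \<noteq> \<zero>\<^bsub>R\<^esub>} \<subseteq> X"
      by (meson finite_subset, meson order_trans)
    then show ?thesis using that by simp
  qed
  have smult: "(\<lambda>x. r \<otimes>\<^bsub>R\<^esub> \<phi> x) \<in> carrier ?F" if "\<phi> \<in> carrier ?F" "r \<in> carrier R" for r \<phi>
  proof -
    have "{x. r \<otimes>\<^bsub>R\<^esub> \<phi> x \<noteq> \<zero>\<^bsub>R\<^esub>} \<subseteq> {x. \<phi> x \<noteq> \<zero>\<^bsub>R\<^esub>}" using that by auto
    moreover have "finite {x. \<phi> x \<noteq> \<zero>\<^bsub>R\<^esub>}" "{x. \<phi> x \<noteq> \<zero>\<^bsub>R\<^esub>} \<subseteq> X" using that by simp_all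
    ultimately have "finite {x. r \<otimes>\<^bsub>R\<^esub> \<phi> x \<noteq> \<zero>\<^bsub>R\<^esub>}" "{x. r \<otimes>\<^bsub>R\<^esub> \<phi> x \<noteq> \<zero>\<^bsub>R\<^esub>} \<subseteq> X"
      by (meson finite_subset, meson order_trans)
    then show ?thesis using that by simp
  qed
  have "abelian_group ?F"
  proof (rule abelian_groupI)
    fix \<phi> assume \<phi>: "\<phi> \<in> carrier ?F"
    have "\<ominus>\<^bsub>R\<^esub> \<one>\<^bsub>R\<^esub> \<otimes>\<^bsub>R\<^esub> \<phi> x \<oplus>\<^bsub>R\<^esub> \<phi> x = \<zero>\<^bsub>R\<^esub>" for x
      using \<phi> by (simp add: l_minus l_neg)
    then show "\<exists>\<psi>\<in>carrier ?F. \<psi> \<oplus>\<^bsub>?F\<^esub> \<phi> = \<zero>\<^bsub>?F\<^esub>"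
      using smult[OF \<phi>, of "\<ominus>\<^bsub>R\<^esub> \<one>\<^bsub>R\<^esub>"] by (intro bexI) auto
  next
    fix \<phi> \<psi> assume "\<phi> \<in> carrier ?F" "\<psi> \<in> carrier ?F"
    then show "\<phi> \<oplus>\<^bsub>?F\<^esub> \<psi> \<in> carrier ?F" using add by (simp del: free_module_simps(1) add: free_module_simps)
  qed (auto simp: a_ac)
  then show ?thesis
  proof (rule moduleI[OF \<open>cring R\<close>])
    fix r \<phi> assume "r \<in> carrier R" "\<phi> \<in> carrier ?F"
    then show "r \<odot>\<^bsub>?F\<^esub> \<phi> \<in> carrier ?F" using smult by (simp del: free_module_simps(1) add: free_module_simps)
  qed (auto simp: l_distr r_distr m_assoc)
qed

lemma free_basis_closed:
  assumes "cring R" "x \<in> X" shows "free_basis R x \<in> carrier (free_module R X)"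
proof -
  interpret cring R by fact
  have "{y. (if y = x then \<one>\<^bsub>R\<^esub> else \<zero>\<^bsub>R\<^esub>) \<noteq> \<zero>\<^bsub>R\<^esub>} \<subseteq> {x}" by auto
  then show ?thesis
    using assms(2) finite_subset[of _ "{x}"] by (auto simp: free_basis_def)
qed

lemma free_module_induct [consumes 2, case_names zero add basis]:
  assumes "cring R" and \<phi>: "\<phi> \<in> carrier (free_module R X)"
    and zero: "P (\<lambda>_. \<zero>\<^bsub>R\<^esub>)"
    and add: "\<And>\<phi> \<psi>. \<phi> \<in> carrier (free_module R X) \<Longrightarrow> \<psi> \<in> carrier (free_module R X) \<Longrightarrow>
      P \<phi> \<Longrightarrow> P \<psi> \<Longrightarrow> P (\<phi> \<oplus>\<^bsub>free_module R X\<^esub> \<psi>)"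
    and basis: "\<And>r x. r \<in> carrier R \<Longrightarrow> x \<in> X \<Longrightarrow> P (r \<odot>\<^bsub>free_module R X\<^esub> free_basis R x)"
  shows "P \<phi>"
proof -
  interpret cring R by fact
  interpret F: module R "free_module R X" by (rule free_module_is_module) fact
  have "P \<phi>" if "finite S" "\<phi> \<in> carrier (free_module R X)" "{x. \<phi> x \<noteq> \<zero>\<^bsub>R\<^esub>} \<subseteq> S" for S \<phi>
    using that
  proof (induct S arbitrary: \<phi> rule: finite_induct)
    case empty
    then have "\<phi> = (\<lambda>_. \<zero>\<^bsub>R\<^esub>)" by auto
    then show ?case using zero by simp
  next
    case (insert a S)
    show ?case
    proof (cases "a \<in> X")
      case False
      then have "{x. \<phi> x \<noteq> \<zero>\<^bsub>R\<^esub>} \<subseteq> S" using insert.prems by auto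
      then show ?thesis using insert by blast
    next
      case True
      define \<psi> where "\<psi> = \<phi>(a := \<zero>\<^bsub>R\<^esub>)"
      have sub: "{x. \<psi> x \<noteq> \<zero>\<^bsub>R\<^esub>} \<subseteq> {x. \<phi> x \<noteq> \<zero>\<^bsub>R\<^esub>}" by (auto simp: \<psi>_def)
      have \<psi>: "\<psi> \<in> carrier (free_module R X)"
        using insert.prems(1) finite_subset[OF sub] sub by (auto simp: \<psi>_def)
      have "{x. \<psi> x \<noteq> \<zero>\<^bsub>R\<^esub>} \<subseteq> S" using insert.prems(2) by (auto simp: \<psi>_def)
      then have "P \<psi>" using insert.hyps(3) \<psi> by blast
      have r: "\<phi> a \<in> carrier R" using insert.prems by auto
      have "P (\<phi> a \<odot>\<^bsub>free_module R X\<^esub> free_basis R a)" using basis r True by blast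
      moreover have "\<phi> a \<odot>\<^bsub>free_module R X\<^esub> free_basis R a \<in> carrier (free_module R X)"
        by (rule F.smult_closed[OF r free_basis_closed[OF \<open>cring R\<close> True]])
      ultimately have "P (\<psi> \<oplus>\<^bsub>free_module R X\<^esub> (\<phi> a \<odot>\<^bsub>free_module R X\<^esub> free_basis R a))"
        using add \<psi> \<open>P \<psi>\<close> by blast
      moreover have "\<psi> \<oplus>\<^bsub>free_module R X\<^esub> (\<phi> a \<odot>\<^bsub>free_module R X\<^esub> free_basis R a) = \<phi>"
        using insert.prems(1) by (auto simp: \<psi>_def free_basis_def)
      ultimately show ?thesis by simp
    qed
  qed
  then show ?thesis using \<phi> by auto
qed

definition free_lift ::
    "'r ring \<Rightarrow> ('r, 'p, 'z) module_scheme \<Rightarrow> ('q \<Rightarrow> 'p) \<Rightarrow> ('q \<Rightarrow> 'r) \<Rightarrow> 'p" where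
  "free_lift R P g \<phi> = (\<Oplus>\<^bsub>P\<^esub>q\<in>{q. \<phi> q \<noteq> \<zero>\<^bsub>R\<^esub>}. \<phi> q \<odot>\<^bsub>P\<^esub> g q)"

lemma free_lift_superset:
  assumes "module R P" "\<phi> \<in> carrier (free_module R X)" "g \<in> X \<rightarrow> carrier P"
    "finite S" "{q. \<phi> q \<noteq> \<zero>\<^bsub>R\<^esub>} \<subseteq> S" "S \<subseteq> X"
  shows "free_lift R P g \<phi> = (\<Oplus>\<^bsub>P\<^esub>q\<in>S. \<phi> q \<odot>\<^bsub>P\<^esub> g q)"
proof -
  interpret module R P by fact
  show ?thesis
    unfolding free_lift_def
    by (rule M.add.finprod_mono_neutral_cong_left) (use assms in \<open>auto simp: Pi_def subset_iff\<close>)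
qed

lemma free_lift_linear:
  assumes P: "module R P" and g: "g \<in> X \<rightarrow> carrier P"
  shows "free_lift R P g \<in> linear_maps R (free_module R X) P"
proof (rule linear_mapsI)
  interpret module R P by fact
  interpret F: module R "free_module R X" by (rule free_module_is_module) (rule R.cring_axioms)
  let ?F = "free_module R X"
  let ?S = "\<lambda>\<phi>. {q. \<phi> q \<noteq> \<zero>\<^bsub>R\<^esub>}"
  fix \<phi> assume \<phi>: "\<phi> \<in> carrier ?F"
  then have cl: "(\<lambda>q. \<phi> q \<odot>\<^bsub>P\<^esub> g q) \<in> A \<rightarrow> carrier P" if "A \<subseteq> X" for A
    using g that by (auto simp: Pi_def)
  show "free_lift R P g \<phi> \<in> carrier P"
    using \<phi> cl[of "?S \<phi>"] unfolding free_lift_def by (intro M.finsum_closed) auto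
  fix r assume r: "r \<in> carrier R"
  have "?S (\<lambda>x. r \<otimes>\<^bsub>R\<^esub> \<phi> x) \<subseteq> ?S \<phi>" using r \<phi> by auto
  then have "free_lift R P g (r \<odot>\<^bsub>?F\<^esub> \<phi>) = (\<Oplus>\<^bsub>P\<^esub>q\<in>?S \<phi>. (r \<otimes>\<^bsub>R\<^esub> \<phi> q) \<odot>\<^bsub>P\<^esub> g q)"
    using free_lift_superset[OF P F.smult_closed[OF r \<phi>] g, of "?S \<phi>"] \<phi> by auto
  also have "\<dots> = (\<Oplus>\<^bsub>P\<^esub>q\<in>?S \<phi>. r \<odot>\<^bsub>P\<^esub> (\<phi> q \<odot>\<^bsub>P\<^esub> g q))"
    by (rule M.finsum_cong') (use r \<phi> g in \<open>auto simp: smult_assoc1 Pi_def subset_iff\<close>)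
  also have "\<dots> = r \<odot>\<^bsub>P\<^esub> free_lift R P g \<phi>"
    using \<phi> r cl[of "?S \<phi>"] unfolding free_lift_def by (intro finsum_smult_ldistr[symmetric]) auto
  finally show "free_lift R P g (r \<odot>\<^bsub>?F\<^esub> \<phi>) = r \<odot>\<^bsub>P\<^esub> free_lift R P g \<phi>" .
next
  interpret module R P by fact
  interpret F: module R "free_module R X" by (rule free_module_is_module) (rule R.cring_axioms)
  let ?F = "free_module R X"
  let ?S = "\<lambda>\<phi>. {q. \<phi> q \<noteq> \<zero>\<^bsub>R\<^esub>}"
  fix \<phi> \<psi> assume \<phi>: "\<phi> \<in> carrier ?F" and \<psi>: "\<psi> \<in> carrier ?F"
  let ?T = "?S \<phi> \<union> ?S \<psi>"
  have T: "finite ?T" "?S \<phi> \<subseteq> ?T" "?S \<psi> \<subseteq> ?T" "?T \<subseteq> X" using \<phi> \<psi> by auto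
  have cl: "(\<lambda>q. \<phi> q \<odot>\<^bsub>P\<^esub> g q) \<in> ?T \<rightarrow> carrier P" "(\<lambda>q. \<psi> q \<odot>\<^bsub>P\<^esub> g q) \<in> ?T \<rightarrow> carrier P"
    using g \<phi> \<psi> by (auto simp: Pi_def)
  have "?S (\<lambda>x. \<phi> x \<oplus>\<^bsub>R\<^esub> \<psi> x) \<subseteq> ?T" by auto
  then have "free_lift R P g (\<phi> \<oplus>\<^bsub>?F\<^esub> \<psi>) = (\<Oplus>\<^bsub>P\<^esub>q\<in>?T. (\<phi> q \<oplus>\<^bsub>R\<^esub> \<psi> q) \<odot>\<^bsub>P\<^esub> g q)"
    using free_lift_superset[OF P F.M.a_closed[OF \<phi> \<psi>] g T(1)] T(4) by auto
  also have "\<dots> = (\<Oplus>\<^bsub>P\<^esub>q\<in>?T. \<phi> q \<odot>\<^bsub>P\<^esub> g q \<oplus>\<^bsub>P\<^esub> \<psi> q \<odot>\<^bsub>P\<^esub> g q)"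
    by (rule M.finsum_cong') (use \<psi> \<phi> g in \<open>auto simp: smult_l_distr Pi_def subset_iff\<close>)
  also have "\<dots> = free_lift R P g \<phi> \<oplus>\<^bsub>P\<^esub> free_lift R P g \<psi>"
    using M.finsum_addf[OF cl] free_lift_superset[OF P \<phi> g T(1,2,4)] free_lift_superset[OF P \<psi> g T(1,3,4)]
    by simp
  finally show "free_lift R P g (\<phi> \<oplus>\<^bsub>?F\<^esub> \<psi>) = free_lift R P g \<phi> \<oplus>\<^bsub>P\<^esub> free_lift R P g \<psi>" .
qed

lemma free_lift_basis:
  assumes P: "module R P" and g: "g \<in> X \<rightarrow> carrier P" and x: "x \<in> X"
  shows "free_lift R P g (free_basis R x) = g x"
proof -
  interpret module R P by fact
  have "free_lift R P g (free_basis R x) = (\<Oplus>\<^bsub>P\<^esub>q\<in>{x}. free_basis R x q \<odot>\<^bsub>P\<^esub> g q)"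
    using x by (intro free_lift_superset[OF P free_basis_closed g]) (auto simp: R.cring_axioms free_basis_def)
  also have "\<dots> = g x"
    using x g by (auto simp: free_basis_def Pi_def)
  finally show ?thesis .
qed


section \<open>The universal property of the tensor product\<close>

lemma tensor_simps:
  fixes R :: "'r ring" and M :: "('r, 'm, 'x) module_scheme" and N :: "('r, 'n, 'y) module_scheme"
  defines "Q \<equiv> quotient_module R (free_module R (carrier M \<times> carrier N)) (tensor_null R M N)"
  shows "carrier (tensor R M N) = carrier Q" "zero (tensor R M N) = zero Q"
    "add (tensor R M N) = add Q" "smult (tensor R M N) = smult Q"
    "one (tensor R M N) = tensor_elem R M N \<one>\<^bsub>M\<^esub> \<one>\<^bsub>N\<^esub>"
  by (simp_all add: tensor_def Let_def Q_def)

lemma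
  fixes R :: "'r ring" and M :: "('r, 'm, 'x) module_scheme" and M' :: "('r, 'm, 'x1) module_scheme"
    and N :: "('r, 'n, 'y) module_scheme" and N' :: "('r, 'n, 'y1) module_scheme"
  assumes "carrier M' = carrier M" "add M' = add M" "smult M' = smult M"
    "carrier N' = carrier N" "add N' = add N" "smult N' = smult N"
  shows tensor_elem_cong: "tensor_elem R M' N' = tensor_elem R M N"
    and tensor_carrier_cong: "carrier (tensor R M' N') = carrier (tensor R M N)"
    and tensor_zero_cong: "zero (tensor R M' N') = zero (tensor R M N)"
    and tensor_add_cong: "add (tensor R M' N') = add (tensor R M N)"
    and tensor_smult_cong: "smult (tensor R M' N') = smult (tensor R M N)"
proof -
  have n: "tensor_null R M' N' = tensor_null R M N"
    using assms by (simp add: tensor_null_def tensor_relations_def)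
  show "tensor_elem R M' N' = tensor_elem R M N"
    using assms n by (intro ext) (simp add: tensor_elem_def)
  show "carrier (tensor R M' N') = carrier (tensor R M N)"
    "zero (tensor R M' N') = zero (tensor R M N)" "add (tensor R M' N') = add (tensor R M N)"
    "smult (tensor R M' N') = smult (tensor R M N)"
    using assms n by (simp_all add: tensor_simps)
qed

abbreviation pair_module ::
    "'r ring \<Rightarrow> ('r, 'm, 'x) module_scheme \<Rightarrow> ('r, 'n, 'y) module_scheme \<Rightarrow> ('r, 'm \<times> 'n \<Rightarrow> 'r) module"
  where "pair_module R M N \<equiv> free_module R (carrier M \<times> carrier N)"

abbreviation pair_lift ::
    "'r ring \<Rightarrow> ('r, 'p, 'z) module_scheme \<Rightarrow> ('m \<Rightarrow> 'n \<Rightarrow> 'p) \<Rightarrow> ('m \<times> 'n \<Rightarrow> 'r) \<Rightarrow> 'p" where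
  "pair_lift R P b \<equiv> free_lift R P (\<lambda>q. b (fst q) (snd q))"

lemma tensor_lift_pair_lift:
  "tensor_lift R P b X = pair_lift R P b (SOME \<phi>. \<phi> \<in> X)"
  by (simp add: tensor_lift_def free_lift_def Let_def)

context
  fixes R :: "'r ring"
    and M :: "('r, 'm, 'x) module_scheme" and N :: "('r, 'n, 'y) module_scheme"
  assumes M: "module R M" and N: "module R N"
begin

interpretation M: module R M by (rule M)
interpretation N: module R N by (rule N)

interpretation F: module R "pair_module R M N"
  by (rule free_module_is_module) (rule M.R.cring_axioms)

lemma free_pair_closed:
  "m \<in> carrier M \<Longrightarrow> n \<in> carrier N \<Longrightarrow> free_basis R (m, n) \<in> carrier (pair_module R M N)"
  by (rule free_basis_closed) (auto simp: M.R.cring_axioms)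

lemma tensor_relations_subset: "tensor_relations R M N \<subseteq> carrier (pair_module R M N)"
  unfolding tensor_relations_def Let_def
  by (auto simp del: free_module_simps
      intro!: F.M.minus_closed F.M.a_closed F.smult_closed free_pair_closed)

lemma tensor_null_submodule: "submodule (tensor_null R M N) R (pair_module R M N)"
  unfolding tensor_null_def by (rule module_span_submodule[OF F.module_axioms tensor_relations_subset])

lemma tensor_is_module: "module R (tensor R M N)"
  by (rule module_cong[OF quotient_is_module[OF F.module_axioms tensor_null_submodule]])
    (simp_all add: tensor_simps)

lemma tensor_elem_closed:
  "m \<in> carrier M \<Longrightarrow> n \<in> carrier N \<Longrightarrow> tensor_elem R M N m n \<in> carrier (tensor R M N)"
  using quotient_carrier[OF F.module_axioms tensor_null_submodule]
  by (simp add: tensor_simps tensor_elem_def free_pair_closed del: free_module_simps)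

text \<open>Each of the four laws is one of the four families of relations.\<close>

lemma tensor_elem_bilinear: "tensor_elem R M N \<in> bilinear_maps R M N (tensor R M N)"
proof -
  note Q = quotient_add[OF F.module_axioms tensor_null_submodule]
    quotient_smult[OF F.module_axioms tensor_null_submodule]
  note eq = quotient_coset_eq_iff[OF F.module_axioms tensor_null_submodule, THEN iffD2]
  note rel = subsetD[OF module_span_superset[of "tensor_relations R M N" R "pair_module R M N", folded tensor_null_def]]
  note cl = F.M.minus_closed F.M.a_closed F.smult_closed free_pair_closed
  show ?thesis
  proof (intro bilinear_mapsI linear_mapsI tensor_elem_closed)
    fix m n n' assume *: "m \<in> carrier M" "n \<in> carrier N" "n' \<in> carrier N"
    then have "free_basis R (m, n \<oplus>\<^bsub>N\<^esub> n') \<ominus>\<^bsub>pair_module R M N\<^esub>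
      (free_basis R (m, n) \<oplus>\<^bsub>pair_module R M N\<^esub> free_basis R (m, n')) \<in> tensor_null R M N"
      by (intro rel) (unfold tensor_relations_def Let_def, blast)
    with * show "tensor_elem R M N m (n \<oplus>\<^bsub>N\<^esub> n') =
      tensor_elem R M N m n \<oplus>\<^bsub>tensor R M N\<^esub> tensor_elem R M N m n'"
      by (simp add: tensor_elem_def tensor_simps Q cl eq del: free_module_simps)
  next
    fix m n r assume *: "m \<in> carrier M" "n \<in> carrier N" "r \<in> carrier R"
    then have "free_basis R (m, r \<odot>\<^bsub>N\<^esub> n) \<ominus>\<^bsub>pair_module R M N\<^esub> (r \<odot>\<^bsub>pair_module R M N\<^esub> free_basis R (m, n)) \<in> tensor_null R M N"
      by (intro rel) (unfold tensor_relations_def Let_def, blast)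
    with * show "tensor_elem R M N m (r \<odot>\<^bsub>N\<^esub> n) = r \<odot>\<^bsub>tensor R M N\<^esub> tensor_elem R M N m n"
      by (simp add: tensor_elem_def tensor_simps Q cl eq del: free_module_simps)
    from * have "free_basis R (r \<odot>\<^bsub>M\<^esub> m, n) \<ominus>\<^bsub>pair_module R M N\<^esub> (r \<odot>\<^bsub>pair_module R M N\<^esub> free_basis R (m, n)) \<in> tensor_null R M N"
      by (intro rel) (unfold tensor_relations_def Let_def, blast)
    with * show "tensor_elem R M N (r \<odot>\<^bsub>M\<^esub> m) n = r \<odot>\<^bsub>tensor R M N\<^esub> tensor_elem R M N m n"
      by (simp add: tensor_elem_def tensor_simps Q cl eq del: free_module_simps)
  next
    fix m m' n assume *: "m \<in> carrier M" "m' \<in> carrier M" "n \<in> carrier N"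
    then have "free_basis R (m \<oplus>\<^bsub>M\<^esub> m', n) \<ominus>\<^bsub>pair_module R M N\<^esub>
      (free_basis R (m, n) \<oplus>\<^bsub>pair_module R M N\<^esub> free_basis R (m', n)) \<in> tensor_null R M N"
      by (intro rel) (unfold tensor_relations_def Let_def, blast)
    with * show "tensor_elem R M N (m \<oplus>\<^bsub>M\<^esub> m') n =
      tensor_elem R M N m n \<oplus>\<^bsub>tensor R M N\<^esub> tensor_elem R M N m' n"
      by (simp add: tensor_elem_def tensor_simps Q cl eq del: free_module_simps)
  qed
qed

text \<open>Representatives are finite sums of pairs, and a scalar can be moved into the first factor;
  hence every tensor is a sum of elementary tensors.\<close>

lemma tensor_induct [consumes 1, case_names zero add elem]:
  assumes X: "X \<in> carrier (tensor R M N)"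
    and zero: "Q \<zero>\<^bsub>tensor R M N\<^esub>"
    and add: "\<And>X Y. X \<in> carrier (tensor R M N) \<Longrightarrow> Y \<in> carrier (tensor R M N) \<Longrightarrow> Q X \<Longrightarrow> Q Y \<Longrightarrow>
      Q (X \<oplus>\<^bsub>tensor R M N\<^esub> Y)"
    and elem: "\<And>m n. m \<in> carrier M \<Longrightarrow> n \<in> carrier N \<Longrightarrow> Q (tensor_elem R M N m n)"
  shows "Q X"
proof -
  note QC = quotient_carrier[OF F.module_axioms tensor_null_submodule]
  note QA = quotient_add[OF F.module_axioms tensor_null_submodule]
  note QS = quotient_smult[OF F.module_axioms tensor_null_submodule]
  note QZ = quotient_coset_zero_iff[OF F.module_axioms tensor_null_submodule]
  obtain \<phi> where \<phi>: "\<phi> \<in> carrier (pair_module R M N)" and X: "X = tensor_null R M N +>\<^bsub>pair_module R M N\<^esub> \<phi>"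
    using X by (auto simp: tensor_simps QC simp del: free_module_simps)
  have "Q (tensor_null R M N +>\<^bsub>pair_module R M N\<^esub> \<phi>)"
    using M.R.cring_axioms \<phi>
  proof (induct \<phi> rule: free_module_induct)
    case zero
    have "\<zero>\<^bsub>pair_module R M N\<^esub> \<in> tensor_null R M N" by (rule submodule_zero[OF F.module_axioms tensor_null_submodule])
    then have "tensor_null R M N +>\<^bsub>pair_module R M N\<^esub> \<zero>\<^bsub>pair_module R M N\<^esub> = \<zero>\<^bsub>tensor R M N\<^esub>"
      using QZ[OF F.M.zero_closed] by (simp add: tensor_simps(2))
    then show ?case using assms(2) by simp
  next
    case (add \<phi> \<psi>)
    then show ?case using assms(3)[of "tensor_null R M N +>\<^bsub>pair_module R M N\<^esub> \<phi>" "tensor_null R M N +>\<^bsub>pair_module R M N\<^esub> \<psi>"]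
      by (simp add: tensor_simps QC QA del: free_module_simps)
  next
    case (basis r x)
    obtain m n where x: "x = (m, n)" "m \<in> carrier M" "n \<in> carrier N" using basis by auto
    have "tensor_null R M N +>\<^bsub>pair_module R M N\<^esub> (r \<odot>\<^bsub>pair_module R M N\<^esub> free_basis R x) = tensor_elem R M N (r \<odot>\<^bsub>M\<^esub> m) n"
      using basis x linear_maps_smult[OF bilinear_maps_left[OF tensor_elem_bilinear x(3)], of r m]
        QS[of r "free_basis R x"] free_pair_closed
      by (simp add: tensor_elem_def tensor_simps del: free_module_simps)
    then show ?case using elem basis x by simp
  qed
  then show ?thesis using X by simp
qed

context
  fixes P :: "('r, 'p, 'z) module_scheme" and b
  assumes P: "module R P" and b: "b \<in> bilinear_maps R M N P"
begin

interpretation P: module R P by (rule P)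

lemma pair_lift_linear: "pair_lift R P b \<in> linear_maps R (pair_module R M N) P"
  using bilinear_maps_closed[OF b] by (intro free_lift_linear P) auto

lemma pair_lift_basis: "m \<in> carrier M \<Longrightarrow> n \<in> carrier N \<Longrightarrow> pair_lift R P b (free_basis R (m, n)) = b m n"
  using bilinear_maps_closed[OF b]
    free_lift_basis[OF P, of "\<lambda>q. b (fst q) (snd q)" "carrier M \<times> carrier N" "(m, n)"]
  by (simp add: Pi_def)

text \<open>The relations express bilinearity, so the linear extension of a bilinear map kills them. Hence the
  choice of a representative in \<open>tensor_lift\<close> is irrelevant.\<close>

lemma pair_lift_tensor_null:
  assumes "\<phi> \<in> tensor_null R M N" shows "pair_lift R P b \<phi> = \<zero>\<^bsub>P\<^esub>"
proof -
  note L = linear_maps_diff[OF pair_lift_linear F.module_axioms P]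
    linear_maps_add[OF pair_lift_linear] linear_maps_smult[OF pair_lift_linear]
  note bb = linear_maps_add[OF bilinear_maps_left[OF b]] linear_maps_add[OF bilinear_maps_right[OF b]]
    linear_maps_smult[OF bilinear_maps_left[OF b]] linear_maps_smult[OF bilinear_maps_right[OF b]]
  have minus_self: "x \<ominus>\<^bsub>P\<^esub> x = \<zero>\<^bsub>P\<^esub>" if "x \<in> carrier P" for x
    using that by (simp add: a_minus_def P.M.r_neg)
  have "pair_lift R P b \<phi> = \<zero>\<^bsub>P\<^esub>" if "\<phi> \<in> tensor_relations R M N" for \<phi>
    using that unfolding tensor_relations_def Let_def
    by (auto simp del: free_module_simps simp: L bb bilinear_maps_closed[OF b] free_pair_closed
        pair_lift_basis minus_self)
  then have "tensor_relations R M N \<subseteq> {\<phi> \<in> carrier (pair_module R M N). pair_lift R P b \<phi> = \<zero>\<^bsub>P\<^esub>}"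
    using tensor_relations_subset by blast
  then have "tensor_null R M N \<subseteq> {\<phi> \<in> carrier (pair_module R M N). pair_lift R P b \<phi> = \<zero>\<^bsub>P\<^esub>}"
    unfolding tensor_null_def
    by (rule module_span_least[OF linear_maps_kernel_submodule[OF pair_lift_linear F.module_axioms P]])
  then show ?thesis using assms by blast
qed

lemma tensor_lift_linear: "tensor_lift R P b \<in> linear_maps R (tensor R M N) P"
proof -
  have "tensor_lift R P b \<in> linear_maps R (quotient_module R (pair_module R M N) (tensor_null R M N)) P"
    using quotient_lift_linear(1)[OF F.module_axioms tensor_null_submodule pair_lift_linear P
        pair_lift_tensor_null]
    by (simp add: tensor_lift_pair_lift[abs_def])
  also have "linear_maps R (quotient_module R (pair_module R M N) (tensor_null R M N)) P = linear_maps R (tensor R M N) P"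
    by (rule linear_maps_cong_scheme) (simp_all add: tensor_simps)
  finally show ?thesis .
qed

lemma tensor_lift_elem:
  assumes "m \<in> carrier M" "n \<in> carrier N"
  shows "tensor_lift R P b (tensor_elem R M N m n) = b m n"
  using quotient_lift_linear(2)[OF F.module_axioms tensor_null_submodule pair_lift_linear P
      pair_lift_tensor_null free_pair_closed[OF assms]] pair_lift_basis[OF assms]
  by (simp add: tensor_lift_pair_lift tensor_elem_def)

lemma tensor_lift_closed: "X \<in> carrier (tensor R M N) \<Longrightarrow> tensor_lift R P b X \<in> carrier P"
  by (rule linear_maps_closed[OF tensor_lift_linear])

end

text \<open>Identities between expressions that are linear in a tensor are proved by this rule: they only
  have to be compared on elementary tensors.\<close>

lemma tensor_linear_ext:
  assumes "module R P" "f \<in> linear_maps R (tensor R M N) P" "g \<in> linear_maps R (tensor R M N) P"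
    and "X \<in> carrier (tensor R M N)"
    and "\<And>m n. m \<in> carrier M \<Longrightarrow> n \<in> carrier N \<Longrightarrow> f (tensor_elem R M N m n) = g (tensor_elem R M N m n)"
  shows "f X = g X"
  using assms(4)
proof (induct rule: tensor_induct)
  case zero
  show ?case using assms(1-3) tensor_is_module by (simp add: linear_maps_zero)
next
  case (add X Y)
  then show ?case using assms(2,3) by (simp add: linear_maps_add)
qed (use assms in simp)

lemma tensor_lift_cong:
  assumes P: "module R P" and b: "b \<in> bilinear_maps R M N P" and X: "X \<in> carrier (tensor R M N)"
    and eq: "\<And>m n. m \<in> carrier M \<Longrightarrow> n \<in> carrier N \<Longrightarrow> b m n = b' m n"
  shows "tensor_lift R P b X = tensor_lift R P b' X"
proof -
  have b': "b' \<in> bilinear_maps R M N P"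
  proof (rule bilinear_mapsI)
    show "b' m \<in> linear_maps R N P" if "m \<in> carrier M" for m
      by (rule linear_maps_cong_fun[OF bilinear_maps_right[OF b that] N]) (rule eq[OF that])
    show "(\<lambda>m. b' m n) \<in> linear_maps R M P" if "n \<in> carrier N" for n
      by (rule linear_maps_cong_fun[OF bilinear_maps_left[OF b that] M]) (rule eq[OF _ that])
  qed
  show ?thesis
    by (rule tensor_linear_ext[OF P tensor_lift_linear[OF P b] tensor_lift_linear[OF P b'] X])
      (simp add: tensor_lift_elem[OF P b] tensor_lift_elem[OF P b'] eq)
qed

lemma tensor_lift_comp:
  assumes P: "module R P" and Q: "module R Q" and b: "b \<in> bilinear_maps R M N P"
    and g: "g \<in> linear_maps R P Q" and X: "X \<in> carrier (tensor R M N)"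
  shows "g (tensor_lift R P b X) = tensor_lift R Q (\<lambda>m n. g (b m n)) X"
proof -
  have gb: "(\<lambda>m n. g (b m n)) \<in> bilinear_maps R M N Q"
    using b by (auto simp: bilinear_maps_def intro: linear_maps_comp[OF g])
  show ?thesis
    by (rule tensor_linear_ext[OF Q linear_maps_comp[OF g tensor_lift_linear[OF P b]]
          tensor_lift_linear[OF Q gb] X])
      (simp add: tensor_lift_elem[OF P b] tensor_lift_elem[OF Q gb])
qed

lemma tensor_lift_tensor_elem:
  assumes X: "X \<in> carrier (tensor R M N)"
  shows "tensor_lift R (tensor R M N) (tensor_elem R M N) X = X"
  by (rule tensor_linear_ext[OF tensor_is_module
        tensor_lift_linear[OF tensor_is_module tensor_elem_bilinear] linear_maps_id X])
    (simp add: tensor_lift_elem[OF tensor_is_module tensor_elem_bilinear])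

lemma zero_bilinear:
  assumes "module R P" shows "(\<lambda>m n. \<zero>\<^bsub>P\<^esub>) \<in> bilinear_maps R M N P"
  by (intro bilinear_mapsI linear_maps_const_zero M N assms)

lemma tensor_lift_zero_map:
  assumes P: "module R P" and X: "X \<in> carrier (tensor R M N)"
  shows "tensor_lift R P (\<lambda>m n. \<zero>\<^bsub>P\<^esub>) X = \<zero>\<^bsub>P\<^esub>"
  by (rule tensor_linear_ext[OF P tensor_lift_linear[OF P zero_bilinear[OF P]]
        linear_maps_const_zero[OF tensor_is_module P] X])
    (simp add: tensor_lift_elem[OF P zero_bilinear[OF P]])

text \<open>For an elementary tensor the value is \<open>b x m n\<close>, and sums of linear maps are linear. This rule is
  what makes iterated sums in Sweedler notation linear in each of the tensors involved.\<close>

lemma tensor_lift_param_linear: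
  assumes L: "module R L" and P: "module R P" and X: "X \<in> carrier (tensor R M N)"
    and b: "\<And>x. x \<in> carrier L \<Longrightarrow> b x \<in> bilinear_maps R M N P"
    and lin: "\<And>m n. m \<in> carrier M \<Longrightarrow> n \<in> carrier N \<Longrightarrow> (\<lambda>x. b x m n) \<in> linear_maps R L P"
  shows "(\<lambda>x. tensor_lift R P (b x) X) \<in> linear_maps R L P"
  using X
proof (induct rule: tensor_induct)
  case zero
  show ?case
    by (rule linear_maps_cong_fun[OF linear_maps_const_zero[OF L P] L])
      (use linear_maps_zero[OF tensor_lift_linear[OF P b] tensor_is_module P] in simp)
next
  case (add X Y)
  show ?case
    by (rule linear_maps_cong_fun[OF linear_maps_sum[OF L P add(3,4)] L])
      (use add(1,2) linear_maps_add[OF tensor_lift_linear[OF P b]] in simp)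
next
  case (elem m n)
  show ?case
    by (rule linear_maps_cong_fun[OF lin[OF elem] L]) (use elem in \<open>simp add: tensor_lift_elem[OF P b]\<close>)
qed

end


section \<open>Maps between tensor products\<close>

lemma bilinear_maps_comp:
  assumes "g \<in> linear_maps R P Q" "b \<in> bilinear_maps R M N P"
  shows "(\<lambda>m n. g (b m n)) \<in> bilinear_maps R M N Q"
  using assms by (auto simp: bilinear_maps_def intro: linear_maps_comp)

lemma bilinear_maps_pull:
  assumes b: "b \<in> bilinear_maps R M N P" and u: "u \<in> linear_maps R M' M" and v: "v \<in> linear_maps R N' N"
  shows "(\<lambda>x y. b (u x) (v y)) \<in> bilinear_maps R M' N' P"
proof (rule bilinear_mapsI)
  show "(\<lambda>y. b (u x) (v y)) \<in> linear_maps R N' P" if "x \<in> carrier M'" for x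
    by (rule linear_maps_comp[OF bilinear_maps_right[OF b] v]) (rule linear_maps_closed[OF u that])
  show "(\<lambda>x. b (u x) (v y)) \<in> linear_maps R M' P" if "y \<in> carrier N'" for y
    by (rule linear_maps_comp[OF bilinear_maps_left[OF b] u]) (rule linear_maps_closed[OF v that])
qed

lemma bilinear_maps_flip:
  "b \<in> bilinear_maps R M N P \<Longrightarrow> (\<lambda>n m. b m n) \<in> bilinear_maps R N M P"
  by (simp add: bilinear_maps_def)

lemma ring_mult_bilinear:
  assumes "cring R"
  shows "monoid.mult R \<in> bilinear_maps R (self_module R) (self_module R) (self_module R)"
proof -
  interpret cring R by fact
  show ?thesis
    by (intro bilinear_mapsI linear_mapsI) (simp_all add: l_distr r_distr m_ac)
qed

lemma product_bilinear:
  assumes "cring R" "f \<in> functionals R M" "g \<in> functionals R N"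
  shows "(\<lambda>x y. f x \<otimes>\<^bsub>R\<^esub> g y) \<in> bilinear_maps R M N (self_module R)"
  by (rule bilinear_maps_pull[OF ring_mult_bilinear assms(2,3)]) fact

lemma smult_bilinear:
  assumes "module R M" shows "smult M \<in> bilinear_maps R (self_module R) M M"
proof -
  interpret module R M by fact
  show ?thesis
    by (intro bilinear_mapsI linear_mapsI)
      (simp_all add: smult_l_distr smult_r_distr smult_assoc1[symmetric] R.m_comm)
qed

text \<open>The functional \<open>f \<otimes> g\<close> on \<open>M \<otimes> N\<close>. Convolution products and the defining relation of the dual
  comultiplication are its values.\<close>

abbreviation functional_tensor ::
    "'r ring \<Rightarrow> ('m \<Rightarrow> 'r) \<Rightarrow> ('n \<Rightarrow> 'r) \<Rightarrow> ('m \<times> 'n \<Rightarrow> 'r) set \<Rightarrow> 'r" where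
  "functional_tensor R f g \<equiv> tensor_lift R (self_module R) (\<lambda>x y. f x \<otimes>\<^bsub>R\<^esub> g y)"

context
  fixes R :: "'r ring"
    and M :: "('r, 'm, 'x) module_scheme" and N :: "('r, 'n, 'y) module_scheme"
  assumes M: "module R M" and N: "module R N"
begin

lemma functional_tensor_linear:
  assumes "f \<in> functionals R M" "g \<in> functionals R N"
  shows "functional_tensor R f g \<in> functionals R (tensor R M N)"
  by (intro tensor_lift_linear M N self_module module_cring[OF M] product_bilinear assms)

lemma functional_tensor_elem:
  assumes "f \<in> functionals R M" "g \<in> functionals R N"
    "m \<in> carrier M" "n \<in> carrier N"
  shows "functional_tensor R f g (tensor_elem R M N m n) = f m \<otimes>\<^bsub>R\<^esub> g n"
  by (intro tensor_lift_elem M N self_module module_cring[OF M] product_bilinear assms)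

lemma functional_tensor_cong:
  assumes "f \<in> functionals R M" "g \<in> functionals R N"
    "\<And>m. m \<in> carrier M \<Longrightarrow> f m = f' m" "\<And>n. n \<in> carrier N \<Longrightarrow> g n = g' n"
    "X \<in> carrier (tensor R M N)"
  shows "functional_tensor R f g X = functional_tensor R f' g' X"
  by (rule tensor_lift_cong[OF M N self_module[OF module_cring[OF M]] product_bilinear])
    (use assms module_cring[OF M] in simp_all)

context
  fixes A :: "('r, 'a, 'w) module_scheme" and B :: "('r, 'b, 'z) module_scheme" and u v
  assumes A: "module R A" and B: "module R B"
    and u: "u \<in> linear_maps R A M" and v: "v \<in> linear_maps R B N"
begin

lemma tensor_map_bilinear: "(\<lambda>a b. tensor_elem R M N (u a) (v b)) \<in> bilinear_maps R A B (tensor R M N)"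
  by (rule bilinear_maps_pull[OF tensor_elem_bilinear[OF M N] u v])

lemma tensor_map_linear: "tensor_map R M N u v \<in> linear_maps R (tensor R A B) (tensor R M N)"
  unfolding tensor_map_def by (intro tensor_lift_linear A B tensor_is_module M N tensor_map_bilinear)

lemma tensor_map_elem:
  "a \<in> carrier A \<Longrightarrow> b \<in> carrier B \<Longrightarrow>
    tensor_map R M N u v (tensor_elem R A B a b) = tensor_elem R M N (u a) (v b)"
  unfolding tensor_map_def by (intro tensor_lift_elem A B tensor_is_module M N tensor_map_bilinear)

lemma tensor_map_closed:
  "X \<in> carrier (tensor R A B) \<Longrightarrow> tensor_map R M N u v X \<in> carrier (tensor R M N)"
  by (rule linear_maps_closed[OF tensor_map_linear])

lemma tensor_lift_tensor_map:
  assumes P: "module R P" and b: "b \<in> bilinear_maps R M N P" and X: "X \<in> carrier (tensor R A B)"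
  shows "tensor_lift R P b (tensor_map R M N u v X) = tensor_lift R P (\<lambda>x y. b (u x) (v y)) X"
proof (rule tensor_linear_ext[OF A B P _ _ X])
  note buv = bilinear_maps_pull[OF b u v]
  show "tensor_lift R P (\<lambda>x y. b (u x) (v y)) \<in> linear_maps R (tensor R A B) P"
    by (rule tensor_lift_linear[OF A B P buv])
  show "(\<lambda>X. tensor_lift R P b (tensor_map R M N u v X)) \<in> linear_maps R (tensor R A B) P"
    by (rule linear_maps_comp[OF tensor_lift_linear[OF M N P b] tensor_map_linear])
  show "tensor_lift R P b (tensor_map R M N u v (tensor_elem R A B x y)) =
      tensor_lift R P (\<lambda>x y. b (u x) (v y)) (tensor_elem R A B x y)"
    if "x \<in> carrier A" "y \<in> carrier B" for x y
    using that linear_maps_closed[OF u] linear_maps_closed[OF v]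
    by (simp add: tensor_map_elem tensor_lift_elem[OF M N P b] tensor_lift_elem[OF A B P buv])
qed

lemma functional_tensor_tensor_map:
  assumes "f \<in> functionals R M" "g \<in> functionals R N"
    "X \<in> carrier (tensor R A B)"
  shows "functional_tensor R f g (tensor_map R M N u v X) =
    functional_tensor R (\<lambda>x. f (u x)) (\<lambda>y. g (v y)) X"
  by (rule tensor_lift_tensor_map[OF self_module product_bilinear])
    (use assms module_cring[OF M] in simp_all)

end

text \<open>In the \<open>\<alpha>\<close>-condition the test module is the left factor. The exchange of the factors makes it
  available for test modules on the right, as they occur in \<open>W \<otimes> (W \<otimes> W)\<close>.\<close>

definition tensor_swap :: "('m \<times> 'n \<Rightarrow> 'r) set \<Rightarrow> ('n \<times> 'm \<Rightarrow> 'r) set" where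
  "tensor_swap = tensor_lift R (tensor R N M) (\<lambda>m n. tensor_elem R N M n m)"

lemma swap_bilinear: "(\<lambda>m n. tensor_elem R N M n m) \<in> bilinear_maps R M N (tensor R N M)"
  by (rule bilinear_maps_flip[OF tensor_elem_bilinear[OF N M]])

lemma tensor_swap_linear: "tensor_swap \<in> linear_maps R (tensor R M N) (tensor R N M)"
  unfolding tensor_swap_def by (rule tensor_lift_linear[OF M N tensor_is_module[OF N M] swap_bilinear])

lemma tensor_swap_elem:
  "m \<in> carrier M \<Longrightarrow> n \<in> carrier N \<Longrightarrow> tensor_swap (tensor_elem R M N m n) = tensor_elem R N M n m"
  unfolding tensor_swap_def by (rule tensor_lift_elem[OF M N tensor_is_module[OF N M] swap_bilinear])

lemma tensor_lift_swap:
  assumes P: "module R P" and b: "b \<in> bilinear_maps R N M P" and X: "X \<in> carrier (tensor R M N)"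
  shows "tensor_lift R P b (tensor_swap X) = tensor_lift R P (\<lambda>m n. b n m) X"
  using tensor_lift_comp[OF M N tensor_is_module[OF N M] P swap_bilinear tensor_lift_linear[OF N M P b] X]
    tensor_lift_cong[OF M N P bilinear_maps_flip[OF b] X,
      where b' = "\<lambda>m n. tensor_lift R P b (tensor_elem R N M n m)"]
  by (simp add: tensor_swap_def tensor_lift_elem[OF N M P b])

end

lemma tensor_swap_swap:
  assumes M: "module R M" and N: "module R N" and X: "X \<in> carrier (tensor R M N)"
  shows "tensor_swap R N M (tensor_swap R M N X) = X"
  by (rule tensor_linear_ext[OF M N tensor_is_module[OF M N]
        linear_maps_comp[OF tensor_swap_linear[OF N M] tensor_swap_linear[OF M N]] linear_maps_id X])
    (simp add: tensor_swap_elem[OF M N] tensor_swap_elem[OF N M])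

context
  fixes R :: "'r ring" and L :: "('r, 'l, 'w) module_scheme"
    and M :: "('r, 'm, 'x) module_scheme" and N :: "('r, 'n, 'y) module_scheme"
  assumes L: "module R L" and M: "module R M" and N: "module R N"
begin

interpretation N: module R N by (rule N)

lemma tensor_right_modules:
  "module R (tensor R M N)" "module R (tensor R L (tensor R M N))"
  by (intro tensor_is_module L M N)+

lemma assoc_inner_bilinear:
  assumes "n \<in> carrier N"
  shows "(\<lambda>l m. tensor_elem R L (tensor R M N) l (tensor_elem R M N m n)) \<in> bilinear_maps R L M (tensor R L (tensor R M N))"
  by (rule bilinear_maps_pull[OF tensor_elem_bilinear[OF L tensor_right_modules(1)] linear_maps_id
        bilinear_maps_left[OF tensor_elem_bilinear[OF M N] assms]])

lemma assoc_outer_bilinear: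
  "(\<lambda>X n. tensor_lift R (tensor R L (tensor R M N)) (\<lambda>l m. tensor_elem R L (tensor R M N) l (tensor_elem R M N m n)) X)
     \<in> bilinear_maps R (tensor R L M) N (tensor R L (tensor R M N))"
proof (rule bilinear_mapsI)
  fix n assume "n \<in> carrier N"
  then show "(\<lambda>X. tensor_lift R (tensor R L (tensor R M N)) (\<lambda>l m. tensor_elem R L (tensor R M N) l (tensor_elem R M N m n)) X)
      \<in> linear_maps R (tensor R L M) (tensor R L (tensor R M N))"
    by (rule tensor_lift_linear[OF L M tensor_right_modules(2) assoc_inner_bilinear])
next
  fix X assume X: "X \<in> carrier (tensor R L M)"
  show "(\<lambda>n. tensor_lift R (tensor R L (tensor R M N)) (\<lambda>l m. tensor_elem R L (tensor R M N) l (tensor_elem R M N m n)) X)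
      \<in> linear_maps R N (tensor R L (tensor R M N))"
  proof (rule tensor_lift_param_linear[OF L M N.module_axioms tensor_right_modules(2) X assoc_inner_bilinear])
    fix l m assume *: "l \<in> carrier L" "m \<in> carrier M"
    show "(\<lambda>n. tensor_elem R L (tensor R M N) l (tensor_elem R M N m n)) \<in> linear_maps R N (tensor R L (tensor R M N))"
      by (rule linear_maps_comp[OF bilinear_maps_right[OF tensor_elem_bilinear[OF L tensor_right_modules(1)] *(1)]
          bilinear_maps_right[OF tensor_elem_bilinear[OF M N] *(2)]])
  qed
qed

lemma tensor_assoc_linear: "tensor_assoc R L M N \<in> linear_maps R (tensor R (tensor R L M) N) (tensor R L (tensor R M N))"
  unfolding tensor_assoc_def Let_def by (rule tensor_lift_linear[OF tensor_is_module[OF L M] N tensor_right_modules(2) assoc_outer_bilinear])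

lemma tensor_assoc_elem:
  assumes "l \<in> carrier L" "m \<in> carrier M" "n \<in> carrier N"
  shows "tensor_assoc R L M N (tensor_elem R (tensor R L M) N (tensor_elem R L M l m) n) =
    tensor_elem R L (tensor R M N) l (tensor_elem R M N m n)"
  unfolding tensor_assoc_def Let_def
  using assms by (simp add: tensor_lift_elem[OF tensor_is_module[OF L M] N tensor_right_modules(2) assoc_outer_bilinear] tensor_elem_closed[OF L M]
      tensor_lift_elem[OF L M tensor_right_modules(2) assoc_inner_bilinear])

text \<open>This identity translates coassociativity in two directions: into associativity of the
  convolution product, and, for evaluations as functionals, into associativity of the product.\<close>

lemma functional_tensor_assoc:
  assumes f: "f \<in> functionals R L" and g: "g \<in> functionals R M"
    and k: "k \<in> functionals R N" and Z: "Z \<in> carrier (tensor R (tensor R L M) N)"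
  shows "functional_tensor R f (functional_tensor R g k) (tensor_assoc R L M N Z) =
    functional_tensor R (functional_tensor R f g) k Z"
proof (rule tensor_linear_ext[OF tensor_is_module[OF L M] N self_module[OF N.R.cring_axioms] _ _ Z])
  note fg = functional_tensor_linear[OF L M f g]
  note gk = functional_tensor_linear[OF M N g k]
  note f_gk = functional_tensor_linear[OF L tensor_right_modules(1) f gk]
  note fg_k = functional_tensor_linear[OF tensor_is_module[OF L M] N fg k]
  let ?l = "\<lambda>Z. functional_tensor R f (functional_tensor R g k) (tensor_assoc R L M N Z)"
  show l: "?l \<in> functionals R (tensor R (tensor R L M) N)"
    by (rule linear_maps_comp[OF f_gk tensor_assoc_linear])
  show "functional_tensor R (functional_tensor R f g) k
      \<in> functionals R (tensor R (tensor R L M) N)"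
    by (rule fg_k)
  fix X n assume X: "X \<in> carrier (tensor R L M)" and n: "n \<in> carrier N"
  show "?l (tensor_elem R (tensor R L M) N X n) =
    functional_tensor R (functional_tensor R f g) k (tensor_elem R (tensor R L M) N X n)"
  proof (rule tensor_linear_ext[OF L M self_module[OF N.R.cring_axioms] _ _ X])
    note e = bilinear_maps_left[OF tensor_elem_bilinear[OF tensor_is_module[OF L M] N] n]
    show "(\<lambda>X. ?l (tensor_elem R (tensor R L M) N X n)) \<in> functionals R (tensor R L M)"
      by (rule linear_maps_comp[OF l e])
    show "(\<lambda>X. functional_tensor R (functional_tensor R f g) k (tensor_elem R (tensor R L M) N X n))
        \<in> functionals R (tensor R L M)"
      by (rule linear_maps_comp[OF fg_k e])
    fix l m assume lm: "l \<in> carrier L" "m \<in> carrier M"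
    show "?l (tensor_elem R (tensor R L M) N (tensor_elem R L M l m) n) =
      functional_tensor R (functional_tensor R f g) k
        (tensor_elem R (tensor R L M) N (tensor_elem R L M l m) n)"
      using lm n linear_maps_closed[OF f lm(1)] linear_maps_closed[OF g lm(2)] linear_maps_closed[OF k n]
      by (simp add: tensor_assoc_elem functional_tensor_elem[OF L tensor_right_modules(1) f gk] functional_tensor_elem[OF M N g k]
          functional_tensor_elem[OF tensor_is_module[OF L M] N fg k] functional_tensor_elem[OF L M f g]
          tensor_elem_closed[OF L M] tensor_elem_closed[OF M N] N.R.m_assoc)
  qed
qed

end


section \<open>Iterated lifts and the product of tensors\<close>

text \<open>The summands of a double sum \<open>\<Sum> F(x\<^sub>1, x\<^sub>2, y\<^sub>1, y\<^sub>2)\<close> over two tensors. The first two arguments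
  come from one tensor and the last two from the other.\<close>

definition quadrilinear_maps ::
    "'r ring \<Rightarrow> ('r, 'm, 'x) module_scheme \<Rightarrow> ('r, 'n, 'y) module_scheme \<Rightarrow>
     ('r, 'm1, 'x1) module_scheme \<Rightarrow> ('r, 'n1, 'y1) module_scheme \<Rightarrow>
     ('r, 'p, 'z) module_scheme \<Rightarrow> ('m \<Rightarrow> 'n \<Rightarrow> 'm1 \<Rightarrow> 'n1 \<Rightarrow> 'p) set" where
  "quadrilinear_maps R M N M' N' P = {F.
     (\<forall>a\<in>carrier M. \<forall>b\<in>carrier N. F a b \<in> bilinear_maps R M' N' P) \<and>
     (\<forall>c\<in>carrier M'. \<forall>d\<in>carrier N'. (\<lambda>a b. F a b c d) \<in> bilinear_maps R M N P)}"

text \<open>All double sums below have this shape: the first components of the two tensors are combined with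
  each other, and so are the second components.\<close>

lemma quadrilinear_product:
  assumes b: "b \<in> bilinear_maps R P1 P2 P"
    and b1: "b1 \<in> bilinear_maps R M M' P1" and b2: "b2 \<in> bilinear_maps R N N' P2"
  shows "(\<lambda>m n m' n'. b (b1 m m') (b2 n n')) \<in> quadrilinear_maps R M N M' N' P"
  unfolding quadrilinear_maps_def
  by (auto intro: bilinear_maps_pull[OF b bilinear_maps_right[OF b1] bilinear_maps_right[OF b2]]
      bilinear_maps_pull[OF b bilinear_maps_left[OF b1] bilinear_maps_left[OF b2]])

lemma
  assumes "F \<in> quadrilinear_maps R M N M' N' P"
  shows quadrilinear_right: "a \<in> carrier M \<Longrightarrow> b \<in> carrier N \<Longrightarrow> F a b \<in> bilinear_maps R M' N' P"
    and quadrilinear_left: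
      "c \<in> carrier M' \<Longrightarrow> d \<in> carrier N' \<Longrightarrow> (\<lambda>a b. F a b c d) \<in> bilinear_maps R M N P"
  using assms by (simp_all add: quadrilinear_maps_def)

lemma quadrilinear_maps_flip:
  "F \<in> quadrilinear_maps R M N M' N' P \<Longrightarrow>
    (\<lambda>c d a b. F a b c d) \<in> quadrilinear_maps R M' N' M N P"
  by (simp add: quadrilinear_maps_def)

context
  fixes R :: "'r ring"
    and M :: "('r, 'm, 'x) module_scheme" and N :: "('r, 'n, 'y) module_scheme"
    and M' :: "('r, 'm1, 'x1) module_scheme" and N' :: "('r, 'n1, 'y1) module_scheme"
    and P :: "('r, 'p, 'z) module_scheme" and F
  assumes M: "module R M" and N: "module R N" and M': "module R M'" and N': "module R N'"
    and P: "module R P" and F: "F \<in> quadrilinear_maps R M N M' N' P"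
begin

lemma inner_lift_bilinear:
  assumes Y: "Y \<in> carrier (tensor R M' N')"
  shows "(\<lambda>a b. tensor_lift R P (F a b) Y) \<in> bilinear_maps R M N P"
proof (rule bilinear_mapsI)
  show "(\<lambda>b. tensor_lift R P (F a b) Y) \<in> linear_maps R N P" if a: "a \<in> carrier M" for a
    by (rule tensor_lift_param_linear[OF M' N' N P Y])
      (auto intro: quadrilinear_right[OF F a] bilinear_maps_right[OF quadrilinear_left[OF F] a])
  show "(\<lambda>a. tensor_lift R P (F a b) Y) \<in> linear_maps R M P" if b: "b \<in> carrier N" for b
    by (rule tensor_lift_param_linear[OF M' N' M P Y])
      (auto intro: quadrilinear_right[OF F _ b] bilinear_maps_left[OF quadrilinear_left[OF F] b])
qed

lemma double_lift_bilinear: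
  "(\<lambda>X Y. tensor_lift R P (\<lambda>a b. tensor_lift R P (F a b) Y) X)
     \<in> bilinear_maps R (tensor R M N) (tensor R M' N') P"
proof (rule bilinear_mapsI)
  fix X assume X: "X \<in> carrier (tensor R M N)"
  show "(\<lambda>Y. tensor_lift R P (\<lambda>a b. tensor_lift R P (F a b) Y) X) \<in> linear_maps R (tensor R M' N') P"
    by (rule tensor_lift_param_linear[OF M N tensor_is_module[OF M' N'] P X inner_lift_bilinear
          tensor_lift_linear[OF M' N' P quadrilinear_right[OF F]]])
qed (rule tensor_lift_linear[OF M N P inner_lift_bilinear])

lemma double_lift_elem_left:
  assumes "a \<in> carrier M" "b \<in> carrier N" "Y \<in> carrier (tensor R M' N')"
  shows "tensor_lift R P (\<lambda>a b. tensor_lift R P (F a b) Y) (tensor_elem R M N a b) =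
    tensor_lift R P (F a b) Y"
  by (rule tensor_lift_elem[OF M N P inner_lift_bilinear[OF assms(3)] assms(1,2)])

end

lemma double_lift_param_linear:
  assumes L: "module R L" and M: "module R M" and N: "module R N" and M': "module R M'" and N': "module R N'"
    and P: "module R P" and X: "X \<in> carrier (tensor R M N)" and Y: "Y \<in> carrier (tensor R M' N')"
    and F: "\<And>t. t \<in> carrier L \<Longrightarrow> F t \<in> quadrilinear_maps R M N M' N' P"
    and lin: "\<And>a b c d. a \<in> carrier M \<Longrightarrow> b \<in> carrier N \<Longrightarrow> c \<in> carrier M' \<Longrightarrow> d \<in> carrier N' \<Longrightarrow>
      (\<lambda>t. F t a b c d) \<in> linear_maps R L P"
  shows "(\<lambda>t. tensor_lift R P (\<lambda>a b. tensor_lift R P (F t a b) Y) X) \<in> linear_maps R L P"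
  by (intro tensor_lift_param_linear[OF M N L P X] tensor_lift_param_linear[OF M' N' L P Y]
      inner_lift_bilinear[OF M N M' N' P F Y] quadrilinear_right[OF F] lin)

lemma tensor_lift_interchange:
  fixes R :: "'r ring"
  assumes M: "module R M" and N: "module R N" and M': "module R M'" and N': "module R N'"
    and P: "module R P" and F: "F \<in> quadrilinear_maps R M N M' N' P"
    and X: "X \<in> carrier (tensor R M N)" and Y: "Y \<in> carrier (tensor R M' N')"
  shows "tensor_lift R P (\<lambda>a b. tensor_lift R P (F a b) Y) X =
    tensor_lift R P (\<lambda>c d. tensor_lift R P (\<lambda>a b. F a b c d) X) Y"
proof (rule tensor_linear_ext[OF M N P _ _ X])
  note F' = quadrilinear_maps_flip[OF F]
  show "tensor_lift R P (\<lambda>a b. tensor_lift R P (F a b) Y) \<in> linear_maps R (tensor R M N) P"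
    by (rule bilinear_maps_left[OF double_lift_bilinear[OF M N M' N' P F] Y])
  show "(\<lambda>X. tensor_lift R P (\<lambda>c d. tensor_lift R P (\<lambda>a b. F a b c d) X) Y) \<in> linear_maps R (tensor R M N) P"
    by (rule bilinear_maps_right[OF double_lift_bilinear[OF M' N' M N P F'] Y])
  fix a b assume ab: "a \<in> carrier M" "b \<in> carrier N"
  show "tensor_lift R P (\<lambda>a b. tensor_lift R P (F a b) Y) (tensor_elem R M N a b) =
      tensor_lift R P (\<lambda>c d. tensor_lift R P (\<lambda>a b. F a b c d) (tensor_elem R M N a b)) Y"
    unfolding double_lift_elem_left[OF M N M' N' P F ab Y]
    by (rule tensor_lift_cong[OF M' N' P quadrilinear_right[OF F ab] Y])
      (simp add: tensor_lift_elem[OF M N P quadrilinear_left[OF F]] ab)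
qed


section \<open>The alpha-condition\<close>

lemma pairingD:
  assumes "pairing R V W \<beta>"
  shows "module R V" "module R W" "\<beta> \<in> bilinear_maps R V W (self_module R)"
  using assms by (auto simp: pairing_def bilinear_maps_def)

text \<open>The map \<open>M \<otimes> W \<rightarrow> Hom(V, M)\<close> of the condition, composed with evaluation at \<open>v\<close>.\<close>

abbreviation alpha_map ::
    "'r ring \<Rightarrow> ('r, 'm, 'x) module_scheme \<Rightarrow> ('v \<Rightarrow> 'w \<Rightarrow> 'r) \<Rightarrow> 'v \<Rightarrow> ('m \<times> 'w \<Rightarrow> 'r) set \<Rightarrow> 'm" where
  "alpha_map R M \<beta> v \<equiv> tensor_lift R M (\<lambda>m w. \<beta> v w \<odot>\<^bsub>M\<^esub> m)"

lemma alpha_bilinear: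
  assumes M: "module R M" and \<beta>: "f \<in> functionals R W"
  shows "(\<lambda>m w. f w \<odot>\<^bsub>M\<^esub> m) \<in> bilinear_maps R M W M"
  using bilinear_maps_flip[OF bilinear_maps_pull[OF smult_bilinear[OF M] \<beta> linear_maps_id]] .

lemma alpha_conditionD:
  fixes M :: "('r, 'm) module"
  assumes \<alpha>: "alpha_condition TYPE('m) R V W \<beta>" and M: "module R M"
    and X: "X \<in> carrier (tensor R M W)"
    and ker: "\<And>v. v \<in> carrier V \<Longrightarrow> alpha_map R M \<beta> v X = \<zero>\<^bsub>M\<^esub>"
  shows "X = \<zero>\<^bsub>tensor R M W\<^esub>"
proof -
  have p: "pairing R V W \<beta>" using \<alpha> by (simp add: alpha_condition_def)
  note W = pairingD(2)[OF p] and b = alpha_bilinear[OF M bilinear_maps_right[OF pairingD(3)[OF p]]]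
  have inj: "inj_on (\<lambda>X. \<lambda>v\<in>carrier V. alpha_map R M \<beta> v X) (carrier (tensor R M W))"
    using \<alpha> M by (simp add: alpha_condition_def)
  have "alpha_map R M \<beta> v \<zero>\<^bsub>tensor R M W\<^esub> = \<zero>\<^bsub>M\<^esub>" if "v \<in> carrier V" for v
    by (rule linear_maps_zero[OF tensor_lift_linear[OF M W M b[OF that]] tensor_is_module[OF M W] M])
  then show ?thesis
    using X ker module_carrier_simps(1)[OF tensor_is_module[OF M W]]
    by (intro inj_onD[OF inj]) (auto simp: restrict_def)
qed

lemma alpha_conditionI:
  fixes V :: "('r, 'v, 'x) module_scheme" and W :: "('r, 'w, 'y) module_scheme"
  assumes p: "pairing R V W \<beta>"
    and ker: "\<And>(M :: ('r, 'm) module) X. module R M \<Longrightarrow> X \<in> carrier (tensor R M W) \<Longrightarrow>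
      (\<And>v. v \<in> carrier V \<Longrightarrow> alpha_map R M \<beta> v X = \<zero>\<^bsub>M\<^esub>) \<Longrightarrow> X = \<zero>\<^bsub>tensor R M W\<^esub>"
  shows "alpha_condition TYPE('m) R V W \<beta>"
  unfolding alpha_condition_def
proof (intro conjI p allI impI inj_onI)
  fix M :: "('r, 'm) module" and X Y
  assume M: "module R M" and X: "X \<in> carrier (tensor R M W)" and Y: "Y \<in> carrier (tensor R M W)"
    and eq: "(\<lambda>v\<in>carrier V. alpha_map R M \<beta> v X) = (\<lambda>v\<in>carrier V. alpha_map R M \<beta> v Y)"
  note W = pairingD(2)[OF p] and b = alpha_bilinear[OF M bilinear_maps_right[OF pairingD(3)[OF p]]]
  show "X = Y"
  proof (rule separating_family_eq[OF tensor_is_module[OF M W] M tensor_lift_linear[OF M W M b] ker[OF M] X Y])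
    fix v assume "v \<in> carrier V"
    then show "alpha_map R M \<beta> v X = alpha_map R M \<beta> v Y" using fun_cong[OF eq, of v] by simp
  qed
qed

text \<open>A tensor over \<open>M\<close> whose image in \<open>Hom(V, M)\<close> has values in \<open>K\<close> comes from \<open>K \<otimes> W\<close>. Its image in
  \<open>(M/K) \<otimes> W\<close> is zero by the condition for \<open>M/K\<close>, and \<open>(M/K) \<otimes> W\<close> maps to the quotient of
  \<open>M \<otimes> W\<close> by the image of \<open>K \<otimes> W\<close>.\<close>

lemma alpha_condition_submodule:
  fixes M :: "('r, 'm, 'z) module_scheme"
  assumes \<alpha>: "alpha_condition TYPE('m set) R V W \<beta>" and M: "module R M" and K: "submodule K R M"
    and X: "X \<in> carrier (tensor R M W)"
    and im: "\<And>v. v \<in> carrier V \<Longrightarrow> alpha_map R M \<beta> v X \<in> K"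
  shows "X \<in> module_span R (tensor R M W) {tensor_elem R M W k w | k w. k \<in> K \<and> w \<in> carrier W}"
proof -
  define E where "E = {tensor_elem R M W k w | k w. k \<in> K \<and> w \<in> carrier W}"
  define N where "N = module_span R (tensor R M W) E"
  let ?Q = "quotient_module R M K" and ?T = "tensor R M W"
  let ?U = "quotient_module R ?T N"
  let ?\<pi> = "\<lambda>m. K +>\<^bsub>M\<^esub> m"
  have p: "pairing R V W \<beta>" using \<alpha> by (simp add: alpha_condition_def)
  note W = pairingD(2)[OF p] and \<beta> = bilinear_maps_right[OF pairingD(3)[OF p]]
  note T = tensor_is_module[OF M W]
  have KM: "K \<subseteq> carrier M" using submodule_subset[OF M K] .
  have "E \<subseteq> carrier ?T" using KM tensor_elem_closed[OF M W] by (auto simp: E_def)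
  then have N: "submodule N R ?T" unfolding N_def by (rule module_span_submodule[OF T])
  note Q = quotient_is_module[OF M K] and \<pi> = quotient_projection_linear[OF M K]
  note U = quotient_is_module[OF T N] and \<nu> = quotient_projection_linear[OF T N]
  define X' where "X' = tensor_map R ?Q W ?\<pi> (\<lambda>w. w) X"
  have X'c: "X' \<in> carrier (tensor R ?Q W)"
    unfolding X'_def by (rule tensor_map_closed[OF Q W M W \<pi> linear_maps_id X])
  have X'0: "X' = \<zero>\<^bsub>tensor R ?Q W\<^esub>"
  proof (rule alpha_conditionD[OF \<alpha> Q X'c])
    fix v assume v: "v \<in> carrier V"
    have "alpha_map R ?Q \<beta> v X' = tensor_lift R ?Q (\<lambda>m w. \<beta> v w \<odot>\<^bsub>?Q\<^esub> ?\<pi> m) X"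
      unfolding X'_def
      by (rule tensor_lift_tensor_map[OF Q W M W \<pi> linear_maps_id Q alpha_bilinear[OF Q \<beta>[OF v]] X])
    also have "\<dots> = tensor_lift R ?Q (\<lambda>m w. ?\<pi> (\<beta> v w \<odot>\<^bsub>M\<^esub> m)) X"
      by (rule tensor_lift_cong[OF M W Q bilinear_maps_pull[OF alpha_bilinear[OF Q \<beta>[OF v]] \<pi> linear_maps_id] X])
        (use linear_maps_closed[OF \<beta>[OF v]] in \<open>simp add: linear_maps_smult[OF \<pi>]\<close>)
    also have "\<dots> = ?\<pi> (alpha_map R M \<beta> v X)"
      by (rule tensor_lift_comp[OF M W M Q alpha_bilinear[OF M \<beta>[OF v]] \<pi> X, symmetric])
    also have "\<dots> = \<zero>\<^bsub>?Q\<^esub>"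
      using im[OF v] KM quotient_coset_zero_iff[OF M K] by blast
    finally show "alpha_map R ?Q \<beta> v X' = \<zero>\<^bsub>?Q\<^esub>" .
  qed
  define s where "s = (\<lambda>q w. N +>\<^bsub>?T\<^esub> tensor_elem R M W (SOME m. m \<in> q) w)"
  have lin: "(\<lambda>m. N +>\<^bsub>?T\<^esub> tensor_elem R M W m w) \<in> linear_maps R M ?U" if "w \<in> carrier W" for w
    by (rule linear_maps_comp[OF \<nu> bilinear_maps_left[OF tensor_elem_bilinear[OF M W] that]])
  have kill: "N +>\<^bsub>?T\<^esub> tensor_elem R M W k w = \<zero>\<^bsub>?U\<^esub>" if "w \<in> carrier W" "k \<in> K" for k w
  proof -
    have "tensor_elem R M W k w \<in> N"
      using that module_span_superset[of E R ?T] by (auto simp: N_def E_def)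
    then show ?thesis
      using quotient_coset_zero_iff[OF T N tensor_elem_closed[OF M W]] that KM by blast
  qed
  have s: "s \<in> bilinear_maps R ?Q W ?U"
  proof (rule bilinear_mapsI)
    fix q assume "q \<in> carrier ?Q"
    then obtain m where m: "m \<in> carrier M" "q = ?\<pi> m" by (auto simp: quotient_carrier[OF M K])
    have "(SOME m. m \<in> q) \<in> q"
      using quotient_coset_self[OF M K m(1)] unfolding m(2) by (rule someI)
    then have "(SOME m. m \<in> q) \<in> carrier M"
      using quotient_coset_mem(1)[OF M K \<open>q \<in> carrier ?Q\<close>] by blast
    then show "s q \<in> linear_maps R W ?U"
      unfolding s_def
      by (rule linear_maps_comp[OF \<nu> bilinear_maps_right[OF tensor_elem_bilinear[OF M W]]])
  next
    fix w assume "w \<in> carrier W"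
    then show "(\<lambda>q. s q w) \<in> linear_maps R ?Q ?U"
      unfolding s_def by (intro quotient_lift_linear(1)[OF M K lin U kill])
  qed
  have "tensor_lift R ?U s X' = tensor_lift R ?U (\<lambda>m w. s (?\<pi> m) w) X"
    unfolding X'_def by (rule tensor_lift_tensor_map[OF Q W M W \<pi> linear_maps_id U s X])
  also have "\<dots> = tensor_lift R ?U (\<lambda>m w. N +>\<^bsub>?T\<^esub> tensor_elem R M W m w) X"
    by (rule tensor_lift_cong[OF M W U bilinear_maps_pull[OF s \<pi> linear_maps_id] X])
      (simp add: s_def quotient_lift_linear(2)[OF M K lin U kill])
  also have "\<dots> = N +>\<^bsub>?T\<^esub> X"
    using tensor_lift_comp[OF M W T U tensor_elem_bilinear[OF M W] \<nu> X]
    by (simp add: tensor_lift_tensor_elem[OF M W X])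
  finally have "N +>\<^bsub>?T\<^esub> X = \<zero>\<^bsub>?U\<^esub>"
    using X'0 linear_maps_zero[OF tensor_lift_linear[OF Q W U s] tensor_is_module[OF Q W] U] by simp
  then show ?thesis
    using quotient_coset_zero_iff[OF T N X] by (simp add: N_def E_def)
qed

text \<open>A tensor \<open>\<Sum> m\<^sub>i \<otimes> n\<^sub>i\<close> with \<open>n\<close> summands is the image of \<open>\<Sum> e\<^sub>i \<otimes> n\<^sub>i\<close> under the map
  \<open>e\<^sub>i \<mapsto> m\<^sub>i\<close>. The summands are those of a representative, numbered by \<open>h\<close>.\<close>

lemma tensor_from_free:
  fixes R :: "'r ring" and M :: "('r, 'm, 'x) module_scheme" and N :: "('r, 'n, 'y) module_scheme"
  assumes M: "module R M" and N: "module R N" and X: "X \<in> carrier (tensor R M N)"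
  obtains n :: nat and g X' where "g \<in> linear_maps R (free_module R {..<n}) M"
    "X' \<in> carrier (tensor R (free_module R {..<n}) N)" "tensor_map R M N g (\<lambda>x. x) X' = X"
proof -
  interpret M: module R M by (rule M)
  note T = tensor_is_module[OF M N]
  interpret T: module R "tensor R M N" by (rule T)
  define \<phi> where "\<phi> = (SOME \<phi>. \<phi> \<in> X)"
  define S where "S = {q. \<phi> q \<noteq> \<zero>\<^bsub>R\<^esub>}"
  let ?F2 = "free_module R (carrier M \<times> carrier N)"
  have "X \<in> carrier (quotient_module R ?F2 (tensor_null R M N))" using X by (simp add: tensor_simps)
  note Xq = this
  have mF2: "module R ?F2" by (rule free_module_is_module[OF M.R.cring_axioms])
  obtain \<psi> where "\<psi> \<in> carrier ?F2" "X = tensor_null R M N +>\<^bsub>?F2\<^esub> \<psi>"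
    using Xq by (auto simp: quotient_carrier[OF mF2 tensor_null_submodule[OF M N]] simp del: free_module_simps)
  then have "\<psi> \<in> X" using quotient_coset_self[OF mF2 tensor_null_submodule[OF M N]] by blast
  then have "\<phi> \<in> X" unfolding \<phi>_def by (rule someI[of "\<lambda>\<phi>. \<phi> \<in> X"])
  then have \<phi>: "\<phi> \<in> carrier ?F2" by (rule quotient_coset_mem(1)[OF mF2 tensor_null_submodule[OF M N] Xq])
  then have S: "finite S" "S \<subseteq> carrier M \<times> carrier N" and \<phi>R: "\<And>q. \<phi> q \<in> carrier R" by (auto simp: S_def)
  have Xsum: "X = (\<Oplus>\<^bsub>tensor R M N\<^esub>q\<in>S. \<phi> q \<odot>\<^bsub>tensor R M N\<^esub> tensor_elem R M N (fst q) (snd q))"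
    using tensor_lift_tensor_elem[OF M N X] by (simp add: tensor_lift_pair_lift free_lift_def \<phi>_def S_def)
  obtain h where h: "bij_betw h {0..<card S} S" using ex_bij_betw_nat_finite[OF S(1)] by blast
  define n where "n = card S"
  have h': "h ` {..<n} = S" "inj_on h {..<n}"
    using h by (auto simp: bij_betw_def n_def atLeast0LessThan)
  let ?F = "free_module R {..<n}"
  have mF: "module R ?F" by (rule free_module_is_module[OF M.R.cring_axioms])
  note TF = tensor_is_module[OF mF N]
  define a where "a = (\<lambda>i. \<phi> (h i) \<odot>\<^bsub>M\<^esub> fst (h i))"
  have hq: "fst (h i) \<in> carrier M" "snd (h i) \<in> carrier N" if "i < n" for i
    using h' S that by auto
  have a: "a \<in> {..<n} \<rightarrow> carrier M" using hq \<phi>R by (auto simp: a_def)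
  define g where "g = free_lift R M a"
  have g: "g \<in> linear_maps R ?F M" unfolding g_def by (rule free_lift_linear[OF M a])
  define X' where "X' = (\<Oplus>\<^bsub>tensor R ?F N\<^esub>i\<in>{..<n}. tensor_elem R ?F N (free_basis R i) (snd (h i)))"
  have cl: "(\<lambda>i. tensor_elem R ?F N (free_basis R i) (snd (h i))) \<in> {..<n} \<rightarrow> carrier (tensor R ?F N)"
    by (intro funcsetI tensor_elem_closed[OF mF N] free_basis_closed[OF M.R.cring_axioms])
      (simp_all add: hq)
  have X'c: "X' \<in> carrier (tensor R ?F N)"
    unfolding X'_def by (rule abelian_monoid.finsum_closed[OF _ cl])
      (use module_abelian_group[OF TF] in \<open>simp add: abelian_group_def\<close>)
  have "tensor_map R M N g (\<lambda>x. x) X' =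
      (\<Oplus>\<^bsub>tensor R M N\<^esub>i\<in>{..<n}. tensor_map R M N g (\<lambda>x. x) (tensor_elem R ?F N (free_basis R i) (snd (h i))))"
    unfolding X'_def
    by (rule linear_maps_finsum[OF tensor_map_linear[OF M N mF N g linear_maps_id] TF T _ cl]) simp
  also have "\<dots> = (\<Oplus>\<^bsub>tensor R M N\<^esub>i\<in>{..<n}. \<phi> (h i) \<odot>\<^bsub>tensor R M N\<^esub> tensor_elem R M N (fst (h i)) (snd (h i)))"
  proof (rule T.M.finsum_cong'[OF refl])
    show "(\<lambda>i. \<phi> (h i) \<odot>\<^bsub>tensor R M N\<^esub> tensor_elem R M N (fst (h i)) (snd (h i))) \<in> {..<n} \<rightarrow> carrier (tensor R M N)"
      using hq \<phi>R tensor_elem_closed[OF M N] by auto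
    fix i assume i: "i \<in> {..<n}"
    have "g (free_basis R i) = a i" unfolding g_def by (rule free_lift_basis[OF M a i])
    with i show "tensor_map R M N g (\<lambda>x. x) (tensor_elem R ?F N (free_basis R i) (snd (h i))) =
        \<phi> (h i) \<odot>\<^bsub>tensor R M N\<^esub> tensor_elem R M N (fst (h i)) (snd (h i))"
      using hq \<phi>R free_basis_closed[OF M.R.cring_axioms i]
        linear_maps_smult[OF bilinear_maps_left[OF tensor_elem_bilinear[OF M N]]]
      by (simp add: tensor_map_elem[OF M N mF N g linear_maps_id] a_def
          del: free_module_simps)
  qed
  also have "\<dots> = X"
    unfolding Xsum h'(1)[symmetric]
    by (rule T.M.finsum_reindex[OF _ h'(2), symmetric])
      (use h' S \<phi>R tensor_elem_closed[OF M N] in \<open>auto simp: Pi_def\<close>)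
  finally show thesis using that g X'c by blast
qed

text \<open>The condition for arbitrary modules follows from the condition for the quotients of the
  modules \<open>R\<^sup>n\<close>: a tensor over \<open>M\<close> is the image of a tensor over some \<open>R\<^sup>n\<close>, and the latter comes from
  the kernel of \<open>R\<^sup>n \<rightarrow> M\<close> if its image in \<open>Hom(V, M)\<close> is zero.\<close>

lemma alpha_condition_any_type:
  fixes R :: "'r ring" and V :: "('r, 'v, 'x) module_scheme" and W :: "('r, 'w, 'y) module_scheme"
  assumes \<alpha>: "alpha_condition TYPE((nat \<Rightarrow> 'r) set) R V W \<beta>"
  shows "alpha_condition TYPE('m) R V W \<beta>"
proof (rule alpha_conditionI)
  show p: "pairing R V W \<beta>" using \<alpha> by (simp add: alpha_condition_def)
  note W = pairingD(2)[OF p] and \<beta> = bilinear_maps_right[OF pairingD(3)[OF p]]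
  fix M :: "('r, 'm) module" and X
  assume M: "module R M" and X: "X \<in> carrier (tensor R M W)"
    and ker: "\<And>v. v \<in> carrier V \<Longrightarrow> alpha_map R M \<beta> v X = \<zero>\<^bsub>M\<^esub>"
  obtain n g X' where g: "g \<in> linear_maps R (free_module R {..<n::nat}) M"
    and X': "X' \<in> carrier (tensor R (free_module R {..<n}) W)" "tensor_map R M W g (\<lambda>x. x) X' = X"
    using tensor_from_free[OF M W X] by blast
  let ?F = "free_module R {..<n}"
  have F: "module R ?F" by (rule free_module_is_module[OF module_cring[OF M]])
  define K where "K = {x \<in> carrier ?F. g x = \<zero>\<^bsub>M\<^esub>}"
  have K: "submodule K R ?F" unfolding K_def by (rule linear_maps_kernel_submodule[OF g F M])
  have "alpha_map R ?F \<beta> v X' \<in> K" if v: "v \<in> carrier V" for v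
  proof -
    note bF = alpha_bilinear[OF F \<beta>[OF v]] and bM = alpha_bilinear[OF M \<beta>[OF v]]
    have "g (alpha_map R ?F \<beta> v X') = tensor_lift R M (\<lambda>m w. g (\<beta> v w \<odot>\<^bsub>?F\<^esub> m)) X'"
      by (rule tensor_lift_comp[OF F W F M bF g X'(1)])
    also have "\<dots> = tensor_lift R M (\<lambda>m w. \<beta> v w \<odot>\<^bsub>M\<^esub> g m) X'"
      by (rule tensor_lift_cong[OF F W M bilinear_maps_comp[OF g bF] X'(1)])
        (use linear_maps_closed[OF \<beta>[OF v]] in \<open>simp add: linear_maps_smult[OF g] del: free_module_simps\<close>)
    also have "\<dots> = alpha_map R M \<beta> v (tensor_map R M W g (\<lambda>x. x) X')"
      by (rule tensor_lift_tensor_map[OF M W F W g linear_maps_id M bM X'(1), symmetric])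
    finally show ?thesis
      using ker[OF v] X'(2) tensor_lift_closed[OF F W F bF X'(1)] by (simp add: K_def)
  qed
  then have "X' \<in> module_span R (tensor R ?F W) {tensor_elem R ?F W k w | k w. k \<in> K \<and> w \<in> carrier W}"
    by (rule alpha_condition_submodule[OF \<alpha> F K X'(1)])
  also have "\<dots> \<subseteq> {Y \<in> carrier (tensor R ?F W). tensor_map R M W g (\<lambda>x. x) Y = \<zero>\<^bsub>tensor R M W\<^esub>}"
  proof (rule module_span_least[OF linear_maps_kernel_submodule[OF
          tensor_map_linear[OF M W F W g linear_maps_id] tensor_is_module[OF F W] tensor_is_module[OF M W]]])
    show "{tensor_elem R ?F W k w | k w. k \<in> K \<and> w \<in> carrier W} \<subseteq>
        {Y \<in> carrier (tensor R ?F W). tensor_map R M W g (\<lambda>x. x) Y = \<zero>\<^bsub>tensor R M W\<^esub>}"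
      using linear_maps_zero[OF bilinear_maps_left[OF tensor_elem_bilinear[OF M W]] M tensor_is_module[OF M W]]
      by (auto simp: K_def tensor_map_elem[OF M W F W g linear_maps_id] tensor_elem_closed[OF F W]
          simp del: free_module_simps)
  qed
  finally show "X = \<zero>\<^bsub>tensor R M W\<^esub>" using X'(2) by auto
qed


section \<open>Finite duals\<close>

text \<open>Besides filters, this includes the families \<open>{J}\<close>, for which the finite dual is \<open>(A/J)\<^sup>*\<close>.\<close>

definition ideal_base :: "'r ring \<Rightarrow> ('r, 'a, 'x) module_scheme \<Rightarrow> 'a set set \<Rightarrow> bool" where
  "ideal_base R A \<FF> \<longleftrightarrow> \<FF> \<noteq> {} \<and> \<FF> \<subseteq> cofinite_ideals R A \<and> (\<forall>I\<in>\<FF>. \<forall>J\<in>\<FF>. \<exists>L\<in>\<FF>. L \<subseteq> I \<inter> J)"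

lemma dual_carrierD:
  assumes "f \<in> dual_carrier R M"
  shows "f \<in> functionals R M" "f \<in> extensional (carrier M)"
  using assms by (auto simp: dual_carrier_def)

lemma dual_carrierI:
  "module R M \<Longrightarrow> f \<in> functionals R M \<Longrightarrow> (\<lambda>x\<in>carrier M. f x) \<in> dual_carrier R M"
  using linear_maps_cong_fun[of f R M "self_module R" "\<lambda>x\<in>carrier M. f x"]
  by (simp add: dual_carrier_def)

lemma dual_algebra_simps [simp]:
  "carrier (dual_algebra R C) = dual_carrier R C"
  "monoid.mult (dual_algebra R C) = convolution R C"
  "one (dual_algebra R C) = (\<lambda>c\<in>carrier C. counit C c)"
  "zero (dual_algebra R C) = (\<lambda>c\<in>carrier C. \<zero>\<^bsub>R\<^esub>)"
  "add (dual_algebra R C) = (\<lambda>f g. \<lambda>c\<in>carrier C. f c \<oplus>\<^bsub>R\<^esub> g c)"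
  "smult (dual_algebra R C) = (\<lambda>r f. \<lambda>c\<in>carrier C. r \<otimes>\<^bsub>R\<^esub> f c)"
  by (simp_all add: dual_algebra_def)

lemma finite_dual_algebra_simps [simp]:
  "carrier (finite_dual_algebra R H \<FF>) = finite_dual_carrier R H \<FF>"
  "monoid.mult (finite_dual_algebra R H \<FF>) = convolution R H"
  "one (finite_dual_algebra R H \<FF>) = (\<lambda>c\<in>carrier H. counit H c)"
  "zero (finite_dual_algebra R H \<FF>) = (\<lambda>c\<in>carrier H. \<zero>\<^bsub>R\<^esub>)"
  "add (finite_dual_algebra R H \<FF>) = (\<lambda>f g. \<lambda>c\<in>carrier H. f c \<oplus>\<^bsub>R\<^esub> g c)"
  "smult (finite_dual_algebra R H \<FF>) = (\<lambda>r f. \<lambda>c\<in>carrier H. r \<otimes>\<^bsub>R\<^esub> f c)"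
  by (simp_all add: finite_dual_algebra_def)

lemma dual_module:
  fixes C :: "('r, 'c, 'x) coalgebra_scheme"
  assumes C: "module R C" shows "module R (dual_algebra R C)"
proof -
  interpret C: module R C by (rule C)
  note S = self_module[OF C.R.cring_axioms]
  have cl: "f c \<in> carrier R" if "f \<in> dual_carrier R C" "c \<in> carrier C" for f c
    using linear_maps_closed[OF dual_carrierD(1)[OF that(1)] that(2)] by simp
  have sum: "(\<lambda>c\<in>carrier C. f c \<oplus>\<^bsub>R\<^esub> g c) \<in> dual_carrier R C"
    if "f \<in> dual_carrier R C" "g \<in> dual_carrier R C" for f g
    using dual_carrierI[OF C linear_maps_sum[OF C S dual_carrierD(1)[OF that(1)] dual_carrierD(1)[OF that(2)]]]
    by simp
  have smult: "(\<lambda>c\<in>carrier C. r \<otimes>\<^bsub>R\<^esub> f c) \<in> dual_carrier R C"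
    if "f \<in> dual_carrier R C" "r \<in> carrier R" for f r
    using dual_carrierI[OF C linear_maps_mult_left[OF C that(2) dual_carrierD(1)[OF that(1)]]] .
  have zero: "(\<lambda>c\<in>carrier C. \<zero>\<^bsub>R\<^esub>) \<in> dual_carrier R C"
    using dual_carrierI[OF C linear_maps_const_zero[OF C S]] by simp
  note cong = restrict_cong[OF refl, unfolded simp_implies_def]
  have "abelian_group (dual_algebra R C)"
  proof (rule abelian_groupI)
    fix f assume f: "f \<in> carrier (dual_algebra R C)"
    show "\<exists>g\<in>carrier (dual_algebra R C). g \<oplus>\<^bsub>dual_algebra R C\<^esub> f = \<zero>\<^bsub>dual_algebra R C\<^esub>"
    proof (rule bexI)
      show "(\<lambda>c\<in>carrier C. \<ominus>\<^bsub>R\<^esub> \<one>\<^bsub>R\<^esub> \<otimes>\<^bsub>R\<^esub> f c) \<in> carrier (dual_algebra R C)"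
        using smult f by simp
      show "(\<lambda>c\<in>carrier C. \<ominus>\<^bsub>R\<^esub> \<one>\<^bsub>R\<^esub> \<otimes>\<^bsub>R\<^esub> f c) \<oplus>\<^bsub>dual_algebra R C\<^esub> f = \<zero>\<^bsub>dual_algebra R C\<^esub>"
        using f cl by (auto intro!: cong simp: C.R.l_minus C.R.l_neg)
    qed
  next
    fix f assume "f \<in> carrier (dual_algebra R C)"
    then show "\<zero>\<^bsub>dual_algebra R C\<^esub> \<oplus>\<^bsub>dual_algebra R C\<^esub> f = f"
      using cl dual_carrierD(2)[of f R C] by (auto simp: fun_eq_iff extensional_def)
  qed (auto simp: sum zero cl C.R.a_ac intro!: cong)
  then show ?thesis
  proof (rule moduleI[OF C.R.cring_axioms])
    fix f assume "f \<in> carrier (dual_algebra R C)"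
    then show "\<one>\<^bsub>R\<^esub> \<odot>\<^bsub>dual_algebra R C\<^esub> f = f"
      using cl dual_carrierD(2)[of f R C] by (auto simp: fun_eq_iff extensional_def)
  qed (auto simp: smult cl C.R.l_distr C.R.r_distr C.R.m_assoc intro!: cong)
qed

lemma (in assoc_algebra) mult_bilinear: "monoid.mult A \<in> bilinear_maps R A A A"
  by (intro bilinear_mapsI linear_mapsI)
    (simp_all add: r_distr l_distr smult_mult_left smult_mult_right)

lemma (in assoc_algebra) ideal_submodule:
  assumes "ideal I A" shows "submodule I R A"
proof -
  interpret I: ideal I A by fact
  show ?thesis
  proof (rule submoduleI'[OF module_axioms I.a_subset])
    fix r x assume rx: "r \<in> carrier R" "x \<in> I"
    then have "x \<in> carrier A" using I.a_subset by blast
    then have "r \<odot>\<^bsub>A\<^esub> x = (r \<odot>\<^bsub>A\<^esub> \<one>\<^bsub>A\<^esub>) \<otimes>\<^bsub>A\<^esub> x"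
      using rx by (simp add: smult_mult_left)
    then show "r \<odot>\<^bsub>A\<^esub> x \<in> I"
      using rx I.I_l_closed[of x "r \<odot>\<^bsub>A\<^esub> \<one>\<^bsub>A\<^esub>"] by simp
  qed simp_all
qed

text \<open>The elements \<open>a\<^sub>i\<close> are lifts of generators of \<open>A/I\<close>. A functional that vanishes on \<open>I\<close> is a
  functional on \<open>A/I\<close>, so it is determined by its values at them.\<close>

lemma (in assoc_algebra) cofinite_generators:
  assumes "I \<in> cofinite_ideals R A"
  obtains n :: nat and a where "\<And>i. i < n \<Longrightarrow> a i \<in> carrier A"
    "\<And>f g x. f \<in> functionals R A \<Longrightarrow> g \<in> functionals R A \<Longrightarrow>
      (\<And>x. x \<in> I \<Longrightarrow> f x = \<zero>\<^bsub>R\<^esub>) \<Longrightarrow> (\<And>x. x \<in> I \<Longrightarrow> g x = \<zero>\<^bsub>R\<^esub>) \<Longrightarrow>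
      (\<And>i. i < n \<Longrightarrow> f (a i) = g (a i)) \<Longrightarrow> x \<in> carrier A \<Longrightarrow> f x = g x"
proof -
  let ?Q = "quotient_module R A I"
  have I: "submodule I R A" and "fin_gen R ?Q"
    using assms ideal_submodule by (auto simp: cofinite_ideals_def)
  then obtain S where S: "finite S" "S \<subseteq> carrier ?Q" "module_span R ?Q S = carrier ?Q"
    by (auto simp: fin_gen_def)
  obtain h where h: "bij_betw h {0..<card S} S" using ex_bij_betw_nat_finite[OF S(1)] by blast
  have "\<exists>x. x \<in> carrier A \<and> h i = I +>\<^bsub>A\<^esub> x" if "i < card S" for i
  proof -
    have "h i \<in> carrier ?Q" using h S(2) that by (auto simp: bij_betw_def)
    then show ?thesis by (auto simp: quotient_carrier[OF module_axioms I])
  qed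
  then obtain a where a: "\<And>i. i < card S \<Longrightarrow> a i \<in> carrier A \<and> h i = I +>\<^bsub>A\<^esub> a i" by metis
  note Q = quotient_is_module[OF module_axioms I] and SR = self_module[OF R.cring_axioms]
  show thesis
  proof (rule that[of "card S" a])
    fix f g x assume f: "f \<in> functionals R A" and g: "g \<in> functionals R A"
      and fI: "\<And>x. x \<in> I \<Longrightarrow> f x = \<zero>\<^bsub>R\<^esub>" and gI: "\<And>x. x \<in> I \<Longrightarrow> g x = \<zero>\<^bsub>R\<^esub>"
      and eq: "\<And>i. i < card S \<Longrightarrow> f (a i) = g (a i)" and x: "x \<in> carrier A"
    let ?f = "\<lambda>X. f (SOME x. x \<in> X)" and ?g = "\<lambda>X. g (SOME x. x \<in> X)"
    have fQ: "?f \<in> functionals R ?Q" and gQ: "?g \<in> functionals R ?Q"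
      using quotient_lift_linear(1)[OF module_axioms I f SR] quotient_lift_linear(1)[OF module_axioms I g SR]
        fI gI by simp_all
    have fv: "?f (I +>\<^bsub>A\<^esub> x) = f x" and gv: "?g (I +>\<^bsub>A\<^esub> x) = g x" if "x \<in> carrier A" for x
      using quotient_lift_linear(2)[OF module_axioms I f SR _ that]
        quotient_lift_linear(2)[OF module_axioms I g SR _ that] fI gI by simp_all
    have "S \<subseteq> {X \<in> carrier ?Q. ?f X = ?g X}"
    proof
      fix X assume X: "X \<in> S"
      have "X \<in> h ` {0..<card S}" using h X bij_betw_imp_surj_on by blast
      then obtain i where "i < card S" "X = h i" by auto
      then show "X \<in> {X \<in> carrier ?Q. ?f X = ?g X}" using X S(2) eq a fv gv by auto
    qed
    then have "carrier ?Q \<subseteq> {X \<in> carrier ?Q. ?f X = ?g X}"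
      using module_span_least[OF linear_maps_equalizer_submodule[OF fQ gQ Q SR]] S(3) by blast
    then have "?f (I +>\<^bsub>A\<^esub> x) = ?g (I +>\<^bsub>A\<^esub> x)"
      using x by (auto simp: quotient_carrier[OF module_axioms I])
    then show "f x = g x" using fv gv x by simp
  qed (use a in simp)
qed

locale finite_dual = assoc_algebra R A
  for R :: "'r ring" and A :: "('r, 'a, 'x) coalgebra_scheme" (structure) +
  fixes \<FF> :: "'a set set"
  assumes base: "ideal_base R A \<FF>"
begin

abbreviation "W \<equiv> finite_dual_algebra R A \<FF>"

lemma base_ideal: "I \<in> \<FF> \<Longrightarrow> ideal I A"
  and base_nonempty: "\<FF> \<noteq> {}"
  and base_directed: "I \<in> \<FF> \<Longrightarrow> J \<in> \<FF> \<Longrightarrow> \<exists>L\<in>\<FF>. L \<subseteq> I \<and> L \<subseteq> J"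
  using base by (auto simp: ideal_base_def cofinite_ideals_def)

lemma base_subset: "I \<in> \<FF> \<Longrightarrow> x \<in> I \<Longrightarrow> x \<in> carrier A"
  using base_ideal ideal.axioms(1) additive_subgroup.a_subset by blast

lemma functional_linear: "f \<in> finite_dual_carrier R A \<FF> \<Longrightarrow> f \<in> functionals R A"
  by (simp add: finite_dual_carrier_def dual_carrier_def)

lemma functional_closed: "f \<in> finite_dual_carrier R A \<FF> \<Longrightarrow> x \<in> carrier A \<Longrightarrow> f x \<in> carrier R"
  using linear_maps_closed[OF functional_linear] by simp

lemma functional_eqI:
  assumes "f \<in> finite_dual_carrier R A \<FF>" "g \<in> finite_dual_carrier R A \<FF>"
    "\<And>x. x \<in> carrier A \<Longrightarrow> f x = g x"
  shows "f = g"
  using assms by (auto simp: finite_dual_carrier_def dual_carrier_def intro: extensionalityI)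

lemma finite_dualI:
  assumes "f \<in> functionals R A" "I \<in> \<FF>" "\<And>x. x \<in> I \<Longrightarrow> f x = \<zero>\<^bsub>R\<^esub>"
  shows "(\<lambda>x\<in>carrier A. f x) \<in> finite_dual_carrier R A \<FF>"
  using dual_carrierI[OF module_axioms assms(1)] assms(2,3) base_subset
  by (auto simp: finite_dual_carrier_def)

lemma finite_dual_single_subset: "J \<in> \<FF> \<Longrightarrow> finite_dual_carrier R A {J} \<subseteq> finite_dual_carrier R A \<FF>"
  by (auto simp: finite_dual_carrier_def)

lemma finite_dual_submodule: "submodule (finite_dual_carrier R A \<FF>) R (dual_algebra R A)"
proof (rule submoduleI'[OF dual_module[OF module_axioms]])
  show "finite_dual_carrier R A \<FF> \<subseteq> carrier (dual_algebra R A)"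
    by (auto simp: finite_dual_carrier_def)
  obtain I where "I \<in> \<FF>" using base_nonempty by blast
  then show "\<zero>\<^bsub>dual_algebra R A\<^esub> \<in> finite_dual_carrier R A \<FF>"
    using finite_dualI[OF linear_maps_const_zero[OF module_axioms self_module[OF R.cring_axioms]]] by simp
next
  fix f g assume f: "f \<in> finite_dual_carrier R A \<FF>" and g: "g \<in> finite_dual_carrier R A \<FF>"
  then obtain I J where "I \<in> \<FF>" "\<And>x. x \<in> I \<Longrightarrow> f x = \<zero>\<^bsub>R\<^esub>" "J \<in> \<FF>" "\<And>x. x \<in> J \<Longrightarrow> g x = \<zero>\<^bsub>R\<^esub>"
    by (auto simp: finite_dual_carrier_def)
  moreover obtain L where "L \<in> \<FF>" "L \<subseteq> I" "L \<subseteq> J"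
    using base_directed \<open>I \<in> \<FF>\<close> \<open>J \<in> \<FF>\<close> by blast
  ultimately have "f x \<oplus>\<^bsub>R\<^esub> g x = \<zero>\<^bsub>R\<^esub>" if "x \<in> L" for x
    using that by (simp add: subset_iff)
  with \<open>L \<in> \<FF>\<close> show "f \<oplus>\<^bsub>dual_algebra R A\<^esub> g \<in> finite_dual_carrier R A \<FF>"
    using finite_dualI[OF linear_maps_sum[OF module_axioms self_module[OF R.cring_axioms]
        functional_linear[OF f] functional_linear[OF g]], of L] by auto
next
  fix r f assume r: "r \<in> carrier R" and f: "f \<in> finite_dual_carrier R A \<FF>"
  then obtain I where "I \<in> \<FF>" "\<And>x. x \<in> I \<Longrightarrow> f x = \<zero>\<^bsub>R\<^esub>"
    by (auto simp: finite_dual_carrier_def)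
  then show "r \<odot>\<^bsub>dual_algebra R A\<^esub> f \<in> finite_dual_carrier R A \<FF>"
    using finite_dualI[OF linear_maps_mult_left[OF module_axioms r functional_linear[OF f]], of I] r by auto
qed

lemma W_module: "module R W"
  unfolding finite_dual_algebra_def
  by (rule submodule.submodule_is_module[OF finite_dual_submodule dual_module[OF module_axioms]])

lemma eval_bilinear: "(\<lambda>f x. f x) \<in> bilinear_maps R W A (self_module R)"
proof (rule bilinear_mapsI)
  show "f \<in> functionals R A" if "f \<in> carrier W" for f
    using functional_linear that by simp
  show "(\<lambda>f. f x) \<in> functionals R W" if "x \<in> carrier A" for x
    by (rule linear_mapsI) (use that functional_closed in simp_all)
qed

lemma eval_linear: "x \<in> carrier A \<Longrightarrow> (\<lambda>f. f x) \<in> functionals R W"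
  by (rule bilinear_maps_left[OF eval_bilinear])

lemma eval_pairing: "pairing R A W (\<lambda>x f. f x)"
  using eval_linear functional_linear module_axioms W_module by (simp add: pairing_def)

abbreviation eval2 where "eval2 x y \<equiv> functional_tensor R (\<lambda>f. f x) (\<lambda>f. f y)"

abbreviation eval3 where "eval3 x y z \<equiv> functional_tensor R (\<lambda>f. f x) (eval2 y z)"

lemma eval2_linear:
  "x \<in> carrier A \<Longrightarrow> y \<in> carrier A \<Longrightarrow> eval2 x y \<in> functionals R (tensor R W W)"
  by (rule functional_tensor_linear[OF W_module W_module eval_linear eval_linear])

lemma eval3_linear:
  "x \<in> carrier A \<Longrightarrow> y \<in> carrier A \<Longrightarrow> z \<in> carrier A \<Longrightarrow>
    eval3 x y z \<in> functionals R (tensor R W (tensor R W W))"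
  by (rule functional_tensor_linear[OF W_module tensor_is_module[OF W_module W_module] eval_linear eval2_linear])

lemma eval2_bilinear:
  assumes X: "X \<in> carrier (tensor R W W)"
  shows "(\<lambda>x y. eval2 x y X) \<in> bilinear_maps R A A (self_module R)"
proof (rule bilinear_mapsI)
  fix x assume x: "x \<in> carrier A"
  show "(\<lambda>y. eval2 x y X) \<in> functionals R A"
    by (rule tensor_lift_param_linear[OF W_module W_module module_axioms self_module[OF R.cring_axioms] X])
      (simp_all add: product_bilinear[OF R.cring_axioms] eval_linear x
        linear_maps_mult_left[OF module_axioms] functional_linear functional_closed)
next
  fix y assume y: "y \<in> carrier A"
  show "(\<lambda>x. eval2 x y X) \<in> functionals R A"
    by (rule tensor_lift_param_linear[OF W_module W_module module_axioms self_module[OF R.cring_axioms] X])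
      (simp_all add: product_bilinear[OF R.cring_axioms] eval_linear y
        linear_maps_mult_right[OF module_axioms] functional_linear functional_closed)
qed

end

text \<open>A locale cannot assume the \<open>\<alpha>\<close>-condition for test modules of all types at once; by
  \<open>alpha_condition_any_type\<close> the type that contains the quotients of the modules \<open>R\<^sup>n\<close> is enough.\<close>

locale separating_finite_dual = finite_dual R A \<FF>
  for R :: "'r ring" and A :: "('r, 'a, 'x) coalgebra_scheme" (structure) and \<FF> +
  assumes alpha: "alpha_condition TYPE((nat \<Rightarrow> 'r) set) R A (finite_dual_algebra R A \<FF>) (\<lambda>x f. f x)"
begin

lemma left_separation:
  fixes M :: "('r, 'm) module"
  assumes M: "module R M" and Y: "Y \<in> carrier (tensor R W M)"
    and ker: "\<And>x. x \<in> carrier A \<Longrightarrow> tensor_lift R M (\<lambda>f m. f x \<odot>\<^bsub>M\<^esub> m) Y = \<zero>\<^bsub>M\<^esub>"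
  shows "Y = \<zero>\<^bsub>tensor R W M\<^esub>"
proof -
  define X where "X = tensor_swap R W M Y"
  have X: "X \<in> carrier (tensor R M W)"
    unfolding X_def by (rule linear_maps_closed[OF tensor_swap_linear[OF W_module M] Y])
  have "X = \<zero>\<^bsub>tensor R M W\<^esub>"
  proof (rule alpha_conditionD[OF alpha_condition_any_type[OF alpha] M X])
    fix x assume x: "x \<in> carrier A"
    show "alpha_map R M (\<lambda>x f. f x) x X = \<zero>\<^bsub>M\<^esub>"
      unfolding X_def using ker[OF x]
      by (simp add: tensor_lift_swap[OF W_module M M alpha_bilinear[OF M eval_linear[OF x]] Y])
  qed
  then have "tensor_swap R M W X = \<zero>\<^bsub>tensor R W M\<^esub>"
    using linear_maps_zero[OF tensor_swap_linear[OF M W_module] tensor_is_module[OF M W_module]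
        tensor_is_module[OF W_module M]] by simp
  then show ?thesis by (simp add: X_def tensor_swap_swap[OF W_module M Y])
qed

lemma left_bilinear:
  "module R M \<Longrightarrow> x \<in> carrier A \<Longrightarrow> (\<lambda>f m. f x \<odot>\<^bsub>M\<^esub> m) \<in> bilinear_maps R W M M"
  by (rule bilinear_maps_flip[OF alpha_bilinear[OF _ eval_linear]])

text \<open>The condition for the test module \<open>W\<close> leads from tensors to the functionals that they define when
  the first factor is evaluated, and these are functions on \<open>A\<close>.\<close>

lemma eval2_eqI:
  assumes X: "X \<in> carrier (tensor R W W)" and Y: "Y \<in> carrier (tensor R W W)"
    and eq: "\<And>x y. x \<in> carrier A \<Longrightarrow> y \<in> carrier A \<Longrightarrow> eval2 x y X = eval2 x y Y"
  shows "X = Y"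
proof (rule separating_family_eq[OF _ _ _ _ X Y, where I = "carrier A \<times> carrier A"
      and \<phi> = "\<lambda>p. eval2 (fst p) (snd p)" and P = "self_module R"])
  fix Z assume Z: "Z \<in> carrier (tensor R W W)"
    and ker: "\<And>p. p \<in> carrier A \<times> carrier A \<Longrightarrow> eval2 (fst p) (snd p) Z = \<zero>\<^bsub>self_module R\<^esub>"
  show "Z = \<zero>\<^bsub>tensor R W W\<^esub>"
  proof (rule left_separation[OF W_module Z])
    fix x assume x: "x \<in> carrier A"
    note b = left_bilinear[OF W_module x]
    show "tensor_lift R W (\<lambda>f m. f x \<odot>\<^bsub>W\<^esub> m) Z = \<zero>\<^bsub>W\<^esub>"
    proof (rule functional_eqI)
      show "tensor_lift R W (\<lambda>f m. f x \<odot>\<^bsub>W\<^esub> m) Z \<in> finite_dual_carrier R A \<FF>"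
        using tensor_lift_closed[OF W_module W_module W_module b Z] by simp
      show "\<zero>\<^bsub>W\<^esub> \<in> finite_dual_carrier R A \<FF>"
        using module_carrier_simps(1)[OF W_module] by simp
      fix y assume y: "y \<in> carrier A"
      have "tensor_lift R W (\<lambda>f m. f x \<odot>\<^bsub>W\<^esub> m) Z y =
          tensor_lift R (self_module R) (\<lambda>f m. (f x \<odot>\<^bsub>W\<^esub> m) y) Z"
        by (rule tensor_lift_comp[OF W_module W_module W_module self_module[OF R.cring_axioms] b eval_linear[OF y] Z])
      also have "\<dots> = eval2 x y Z" using y by simp
      finally show "tensor_lift R W (\<lambda>f m. f x \<odot>\<^bsub>W\<^esub> m) Z y = \<zero>\<^bsub>W\<^esub> y"
        using ker[of "(x, y)"] x y by simp
    qed
  qed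
qed (use eq eval2_linear tensor_is_module[OF W_module W_module] self_module[OF R.cring_axioms] in auto)

text \<open>Evaluation of the first factor leads to \<open>W \<otimes> W\<close>, the test module in this case.\<close>

lemma eval3_eqI:
  assumes X: "X \<in> carrier (tensor R W (tensor R W W))" and Y: "Y \<in> carrier (tensor R W (tensor R W W))"
    and eq: "\<And>x y z. x \<in> carrier A \<Longrightarrow> y \<in> carrier A \<Longrightarrow> z \<in> carrier A \<Longrightarrow> eval3 x y z X = eval3 x y z Y"
  shows "X = Y"
proof -
  let ?T = "tensor R W W"
  note T = tensor_is_module[OF W_module W_module]
  interpret T: module R ?T by (rule T)
  show ?thesis
  proof (rule separating_family_eq[OF _ _ _ _ X Y, where I = "carrier A \<times> carrier A \<times> carrier A"
        and \<phi> = "\<lambda>p. eval3 (fst p) (fst (snd p)) (snd (snd p))" and P = "self_module R"])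
    fix Z assume Z: "Z \<in> carrier (tensor R W ?T)"
      and ker: "\<And>p. p \<in> carrier A \<times> carrier A \<times> carrier A \<Longrightarrow>
        eval3 (fst p) (fst (snd p)) (snd (snd p)) Z = \<zero>\<^bsub>self_module R\<^esub>"
    show "Z = \<zero>\<^bsub>tensor R W ?T\<^esub>"
    proof (rule left_separation[OF T Z])
      fix x assume x: "x \<in> carrier A"
      note b = left_bilinear[OF T x]
      show "tensor_lift R ?T (\<lambda>f m. f x \<odot>\<^bsub>?T\<^esub> m) Z = \<zero>\<^bsub>?T\<^esub>"
      proof (rule eval2_eqI)
        show "tensor_lift R ?T (\<lambda>f m. f x \<odot>\<^bsub>?T\<^esub> m) Z \<in> carrier ?T"
          by (rule tensor_lift_closed[OF W_module T T b Z])
        show "\<zero>\<^bsub>?T\<^esub> \<in> carrier ?T" by simp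
        fix y z assume y: "y \<in> carrier A" and z: "z \<in> carrier A"
        note e = eval2_linear[OF y z]
        have "eval2 y z (tensor_lift R ?T (\<lambda>f m. f x \<odot>\<^bsub>?T\<^esub> m) Z) =
            tensor_lift R (self_module R) (\<lambda>f m. eval2 y z (f x \<odot>\<^bsub>?T\<^esub> m)) Z"
          by (rule tensor_lift_comp[OF W_module T T self_module[OF R.cring_axioms] b e Z])
        also have "\<dots> = eval3 x y z Z"
          by (rule tensor_lift_cong[OF W_module T self_module[OF R.cring_axioms] bilinear_maps_comp[OF e b] Z])
            (use x functional_closed in \<open>simp add: linear_maps_smult[OF e]\<close>)
        finally show "eval2 y z (tensor_lift R ?T (\<lambda>f m. f x \<odot>\<^bsub>?T\<^esub> m) Z) = eval2 y z \<zero>\<^bsub>?T\<^esub>"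
          using ker[of "(x, y, z)"] x y z linear_maps_zero[OF e T self_module[OF R.cring_axioms]] by simp
      qed
    qed
  qed (use eq eval3_linear tensor_is_module[OF W_module T] self_module[OF R.cring_axioms] in auto)
qed

end


section \<open>The dual comultiplication\<close>

context separating_finite_dual
begin

lemma translate_linear:
  assumes "f \<in> finite_dual_carrier R A \<FF>" "a \<in> carrier A"
  shows "(\<lambda>x. f (x \<otimes> a)) \<in> functionals R A" "(\<lambda>x. f (a \<otimes> x)) \<in> functionals R A"
  by (rule linear_maps_comp[OF functional_linear[OF assms(1)]],
      rule bilinear_maps_left[OF mult_bilinear assms(2)] bilinear_maps_right[OF mult_bilinear assms(2)])+

lemma coordinate_linear: "(\<lambda>r. r j) \<in> functionals R (free_module R X)"
  by (rule linear_mapsI) simp_all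

text \<open>The tensor \<open>\<Sum> e\<^sub>i \<otimes> w\<^sub>i\<close> over \<open>R\<^sup>n\<close>.\<close>

lemma coordinate_tensor:
  fixes n :: nat
  assumes w: "w \<in> {..<n} \<rightarrow> carrier W"
  obtains X where "X \<in> carrier (tensor R (free_module R {..<n}) W)"
    "\<And>x j. x \<in> carrier A \<Longrightarrow>
      functional_tensor R (\<lambda>r. r j) (\<lambda>f. f x) X = (if j < n then w j x else \<zero>\<^bsub>R\<^esub>)"
proof -
  let ?F = "free_module R {..<n}" and ?S = "self_module R"
  note SR = self_module[OF R.cring_axioms]
  note F = free_module_is_module[OF R.cring_axioms, where X = "{..<n}"]
  note T = tensor_is_module[OF F W_module]
  interpret T: module R "tensor R ?F W" by (rule T)
  interpret S: module R ?S by (rule SR)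
  define X where "X = (\<Oplus>\<^bsub>tensor R ?F W\<^esub>i\<in>{..<n}. tensor_elem R ?F W (free_basis R i) (w i))"
  have e: "free_basis R i \<in> carrier ?F" if "i < n" for i
    by (rule free_basis_closed[OF R.cring_axioms]) (use that in simp)
  have cl: "(\<lambda>i. tensor_elem R ?F W (free_basis R i) (w i)) \<in> {..<n} \<rightarrow> carrier (tensor R ?F W)"
    by (intro funcsetI tensor_elem_closed[OF F W_module] e funcset_mem[OF w]) simp_all
  show thesis
  proof (rule that)
    show "X \<in> carrier (tensor R ?F W)" unfolding X_def by (rule T.M.finsum_closed[OF cl])
    fix x j assume x: "x \<in> carrier A"
    have wc: "w i x \<in> carrier R" if "i < n" for i
      using functional_closed[OF _ x] funcset_mem[OF w, of i] that by simp
    have val: "functional_tensor R (\<lambda>r. r j) (\<lambda>f. f x) (tensor_elem R ?F W (free_basis R i) (w i)) =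
        (if j = i then w i x else \<zero>\<^bsub>R\<^esub>)" if "i < n" for i
      using functional_tensor_elem[OF F W_module coordinate_linear eval_linear[OF x] e[OF that] funcset_mem[OF w, of i], of j]
        wc[OF that] that by (simp add: free_basis_def)
    have "functional_tensor R (\<lambda>r. r j) (\<lambda>f. f x) X =
        (\<Oplus>\<^bsub>?S\<^esub>i\<in>{..<n}. functional_tensor R (\<lambda>r. r j) (\<lambda>f. f x) (tensor_elem R ?F W (free_basis R i) (w i)))"
      unfolding X_def
      by (rule linear_maps_finsum[OF functional_tensor_linear[OF F W_module coordinate_linear eval_linear[OF x]]
            T SR _ cl]) simp
    also have "\<dots> = (\<Oplus>\<^bsub>?S\<^esub>i\<in>{..<n}. if j = i then w i x else \<zero>\<^bsub>?S\<^esub>)"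
      by (rule S.M.finsum_cong'[OF refl]) (use wc in \<open>simp_all add: val Pi_def\<close>)
    also have "\<dots> = (if j < n then w j x else \<zero>\<^bsub>R\<^esub>)"
    proof (cases "j < n")
      case True
      then show ?thesis using S.M.finsum_singleton[of j "{..<n}" "\<lambda>i. w i x"] wc by (simp add: Pi_def)
    next
      case False
      then have "(\<Oplus>\<^bsub>?S\<^esub>i\<in>{..<n}. if j = i then w i x else \<zero>\<^bsub>?S\<^esub>) = (\<Oplus>\<^bsub>?S\<^esub>i\<in>{..<n}. \<zero>\<^bsub>?S\<^esub>)"
        by (intro S.M.finsum_cong'[OF refl]) auto
      then show ?thesis using False S.M.finsum_zero[of "{..<n}"] by simp
    qed
    finally show "functional_tensor R (\<lambda>r. r j) (\<lambda>f. f x) X = (if j < n then w j x else \<zero>\<^bsub>R\<^esub>)" .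
  qed
qed

lemma alpha_map_coordinate:
  assumes x: "x \<in> carrier A" and X: "X \<in> carrier (tensor R (free_module R Z) W)"
  shows "alpha_map R (free_module R Z) (\<lambda>x f. f x) x X j = functional_tensor R (\<lambda>r. r j) (\<lambda>f. f x) X"
proof -
  let ?F = "free_module R Z" and ?S = "self_module R"
  note F = free_module_is_module[OF R.cring_axioms, where X = Z] and SR = self_module[OF R.cring_axioms]
  note b = alpha_bilinear[OF F eval_linear[OF x]]
  have "alpha_map R ?F (\<lambda>x f. f x) x X j = tensor_lift R ?S (\<lambda>r g. (g x \<odot>\<^bsub>?F\<^esub> r) j) X"
    by (rule tensor_lift_comp[OF F W_module F SR b coordinate_linear X])
  also have "\<dots> = functional_tensor R (\<lambda>r. r j) (\<lambda>f. f x) X"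
    by (rule tensor_lift_cong[OF F W_module SR bilinear_maps_comp[OF coordinate_linear b] X])
      (use functional_closed x in \<open>simp add: R.m_comm\<close>)
  finally show ?thesis .
qed

text \<open>Let \<open>f\<close> vanish on \<open>I\<close> and let \<open>a\<^sub>1, \<dots>, a\<^sub>n\<close> generate \<open>A\<close> modulo \<open>I\<close>. The map
  \<open>x \<mapsto> (f (x a\<^sub>i))\<^sub>i\<close> comes from the tensor \<open>\<Sum> e\<^sub>i \<otimes> f(- a\<^sub>i)\<close> over \<open>R\<^sup>n\<close>, and its values lie in the
  submodule \<open>K\<close> of the vectors \<open>(g a\<^sub>i)\<^sub>i\<close> for functionals \<open>g\<close> on \<open>A/I\<close>, because \<open>f(x -)\<close> is one of
  them. Hence the tensor comes from \<open>K \<otimes> W\<close>, and lifting its coordinates to functionals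
  gives \<open>f (x a\<^sub>i) = \<Sum> w\<^sub>k(x) g\<^sub>k(a\<^sub>i)\<close> for all \<open>i\<close>. Both sides vanish on \<open>I\<close> as functions of the second
  argument, so they agree on \<open>A\<close>.\<close>

lemma dual_comult_exists:
  assumes f: "f \<in> finite_dual_carrier R A \<FF>"
  shows "\<exists>Y\<in>carrier (tensor R W W). \<forall>x\<in>carrier A. \<forall>y\<in>carrier A. f (x \<otimes> y) = eval2 x y Y"
proof -
  obtain I where I: "I \<in> \<FF>" and fI: "\<And>x. x \<in> I \<Longrightarrow> f x = \<zero>\<^bsub>R\<^esub>"
    using f by (auto simp: finite_dual_carrier_def)
  interpret I: ideal I A by (rule base_ideal[OF I])
  have Ic: "I \<in> cofinite_ideals R A" using base I by (auto simp: ideal_base_def)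
  interpret D: finite_dual R A "{I}" by unfold_locales (use Ic in \<open>simp add: ideal_base_def\<close>)
  obtain n a where a: "\<And>i::nat. i < n \<Longrightarrow> a i \<in> carrier A"
    and gen: "\<And>f g x. f \<in> functionals R A \<Longrightarrow> g \<in> functionals R A \<Longrightarrow>
      (\<And>x. x \<in> I \<Longrightarrow> f x = \<zero>\<^bsub>R\<^esub>) \<Longrightarrow> (\<And>x. x \<in> I \<Longrightarrow> g x = \<zero>\<^bsub>R\<^esub>) \<Longrightarrow>
      (\<And>i. i < n \<Longrightarrow> f (a i) = g (a i)) \<Longrightarrow> x \<in> carrier A \<Longrightarrow> f x = g x"
    using cofinite_generators[OF Ic] by blast
  let ?F = "free_module R {..<n}" and ?S = "self_module R"
  note SR = self_module[OF R.cring_axioms]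
  note F = free_module_is_module[OF R.cring_axioms, where X = "{..<n}"]
  note T = tensor_is_module[OF F W_module] and WD = tensor_is_module[OF W_module D.W_module]
  define t where "t = (\<lambda>i. \<lambda>x\<in>carrier A. f (x \<otimes> a i))"
  have t: "t \<in> {..<n} \<rightarrow> carrier W"
    unfolding t_def
    using finite_dualI[OF translate_linear(1)[OF f a] I] fI I.I_r_closed a by auto
  obtain X where X: "X \<in> carrier (tensor R ?F W)" and coordX: "\<And>x j. x \<in> carrier A \<Longrightarrow>
      functional_tensor R (\<lambda>r. r j) (\<lambda>f. f x) X = (if j < n then t j x else \<zero>\<^bsub>R\<^esub>)"
    using coordinate_tensor[OF t] by blast
  \<comment> \<open>the vectors \<open>(g a\<^sub>i)\<^sub>i\<close> for functionals \<open>g\<close> on \<open>A/I\<close>\<close>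
  define K where "K = {r \<in> carrier ?F. \<exists>g\<in>carrier D.W. \<forall>i\<in>{..<n}. r i = g (a i)}"
  have K: "submodule K R ?F"
    unfolding K_def
    by (rule linear_relation_submodule[OF F D.W_module SR coordinate_linear D.eval_linear]) (use a in simp)
  have "alpha_map R ?F (\<lambda>x f. f x) x X \<in> K" if x: "x \<in> carrier A" for x
  proof -
    have "alpha_map R ?F (\<lambda>x f. f x) x X \<in> carrier ?F"
      by (rule tensor_lift_closed[OF F W_module F alpha_bilinear[OF F eval_linear[OF x]] X])
    moreover have "(\<lambda>y\<in>carrier A. f (x \<otimes> y)) \<in> carrier D.W"
      using D.finite_dualI[OF translate_linear(2)[OF f x], of I] fI I.I_l_closed x by simp
    moreover have "\<forall>i\<in>{..<n}. alpha_map R ?F (\<lambda>x f. f x) x X i = (\<lambda>y\<in>carrier A. f (x \<otimes> y)) (a i)"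
      using a x by (simp add: alpha_map_coordinate[OF x X] coordX t_def del: free_module_simps)
    ultimately show ?thesis unfolding K_def by blast
  qed
  then have mem: "X \<in> module_span R (tensor R ?F W) {tensor_elem R ?F W k w | k w. k \<in> K \<and> w \<in> carrier W}"
    by (rule alpha_condition_submodule[OF alpha F K X])
  \<comment> \<open>the tensors over \<open>R\<^sup>n\<close> whose coordinates come from a tensor in \<open>W \<otimes> (A/I)\<^sup>*\<close>\<close>
  define E where "E = {Z \<in> carrier (tensor R ?F W). \<exists>Y\<in>carrier (tensor R W D.W). \<forall>p\<in>carrier A \<times> {..<n}.
      functional_tensor R (\<lambda>r. r (snd p)) (\<lambda>f. f (fst p)) Z = eval2 (fst p) (a (snd p)) Y}"
  have E: "submodule E R (tensor R ?F W)"
    unfolding E_def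
    by (rule linear_relation_submodule[OF T WD SR]; rule functional_tensor_linear)
      (use F W_module D.W_module a in \<open>auto intro: coordinate_linear eval_linear D.eval_linear\<close>)
  have "{tensor_elem R ?F W k w | k w. k \<in> K \<and> w \<in> carrier W} \<subseteq> E"
  proof clarify
    fix k w assume k: "k \<in> K" and w: "w \<in> carrier W"
    then obtain g where kF: "k \<in> carrier ?F" and g: "g \<in> carrier D.W" "\<And>i. i < n \<Longrightarrow> k i = g (a i)"
      unfolding K_def by blast
    have "functional_tensor R (\<lambda>r. r j) (\<lambda>f. f x) (tensor_elem R ?F W k w) = eval2 x (a j) (tensor_elem R W D.W w g)"
      if x: "x \<in> carrier A" and j: "j < n" for x j
      using linear_maps_closed[OF eval_linear[OF x] w] linear_maps_closed[OF D.eval_linear[OF a[OF j]] g(1)]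
      by (simp add: functional_tensor_elem[OF F W_module coordinate_linear eval_linear[OF x] kF w]
          functional_tensor_elem[OF W_module D.W_module eval_linear[OF x] D.eval_linear[OF a[OF j]] w g(1)]
          g(2)[OF j] R.m_comm)
    then show "tensor_elem R ?F W k w \<in> E"
      unfolding E_def using tensor_elem_closed[OF F W_module kF w] tensor_elem_closed[OF W_module D.W_module w g(1)]
      by (auto intro!: bexI simp del: free_module_simps finite_dual_algebra_simps)
  qed
  then have "X \<in> E" using module_span_least[OF E] mem by blast
  then obtain Y where Y: "Y \<in> carrier (tensor R W D.W)"
      and eqY: "\<And>x j. x \<in> carrier A \<Longrightarrow> j < n \<Longrightarrow> functional_tensor R (\<lambda>r. r j) (\<lambda>f. f x) X = eval2 x (a j) Y"
    unfolding E_def by auto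
  have incl: "(\<lambda>g. g) \<in> linear_maps R D.W W"
    by (rule linear_mapsI) (use finite_dual_single_subset[OF I] in auto)
  define Y' where "Y' = tensor_map R W W (\<lambda>f. f) (\<lambda>g. g) Y"
  have Y': "Y' \<in> carrier (tensor R W W)"
    unfolding Y'_def by (rule tensor_map_closed[OF W_module W_module W_module D.W_module linear_maps_id incl Y])
  have evY': "eval2 x y Y' = eval2 x y Y" if "x \<in> carrier A" "y \<in> carrier A" for x y
    unfolding Y'_def
    by (rule functional_tensor_tensor_map[OF W_module W_module W_module D.W_module linear_maps_id incl
          eval_linear eval_linear Y]) (rule that)+
  have "eval2 x y Y = \<zero>\<^bsub>R\<^esub>" if x: "x \<in> carrier A" and y: "y \<in> I" for x y
  proof -
    have yA: "y \<in> carrier A" using y I.a_subset by blast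
    have gI: "g y = \<zero>\<^bsub>R\<^esub>" if "g \<in> finite_dual_carrier R A {I}" for g
      using that y by (simp add: finite_dual_carrier_def)
    have "eval2 x y Y = tensor_lift R ?S (\<lambda>f g. \<zero>\<^bsub>?S\<^esub>) Y"
      by (rule tensor_lift_cong[OF W_module D.W_module SR
            product_bilinear[OF R.cring_axioms eval_linear[OF x] D.eval_linear[OF yA]] Y])
        (simp add: gI functional_closed x)
    then show ?thesis using tensor_lift_zero_map[OF W_module D.W_module SR Y] by simp
  qed
  note vanish = this
  have "f (x \<otimes> y) = eval2 x y Y'" if x: "x \<in> carrier A" and y: "y \<in> carrier A" for x y
  proof (rule gen[OF translate_linear(2)[OF f x] bilinear_maps_right[OF eval2_bilinear[OF Y'] x] _ _ _ y])
    fix z assume z: "z \<in> I"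
    then show "f (x \<otimes> z) = \<zero>\<^bsub>R\<^esub>" using fI I.I_l_closed[OF z x] by blast
    show "eval2 x z Y' = \<zero>\<^bsub>R\<^esub>" using evY'[OF x] vanish[OF x z] z I.a_subset by auto
  next
    show "f (x \<otimes> a i) = eval2 x (a i) Y'" if i: "i < n" for i
      using eqY[OF x i] coordX[OF x, of i] evY'[OF x a[OF i]] x i by (simp add: t_def)
  qed
  then show ?thesis using Y' by blast
qed

lemma dual_comult_unique:
  assumes "f \<in> finite_dual_carrier R A \<FF>"
  shows "\<exists>!X. is_dual_comult R A \<FF> f X"
proof (rule ex_ex1I)
  show "\<exists>X. is_dual_comult R A \<FF> f X"
    using dual_comult_exists[OF assms] by (auto simp: is_dual_comult_def)
  show "X = Y" if "is_dual_comult R A \<FF> f X" "is_dual_comult R A \<FF> f Y" for X Y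
    using that by (intro eval2_eqI) (auto simp: is_dual_comult_def)
qed

definition "dual_comult f = (THE X. is_dual_comult R A \<FF> f X)"

lemma
  assumes "f \<in> finite_dual_carrier R A \<FF>"
  shows dual_comult_closed: "dual_comult f \<in> carrier (tensor R W W)"
    and eval2_comult: "x \<in> carrier A \<Longrightarrow> y \<in> carrier A \<Longrightarrow> eval2 x y (dual_comult f) = f (x \<otimes> y)"
  using theI'[OF dual_comult_unique[OF assms]] by (auto simp: dual_comult_def is_dual_comult_def)

lemma dual_comult_linear: "dual_comult \<in> linear_maps R W (tensor R W W)"
proof -
  note WW = tensor_is_module[OF W_module W_module]
  interpret WW: module R "tensor R W W" by (rule WW)
  interpret W: module R W by (rule W_module)
  show ?thesis
  proof (rule linear_mapsI)
    show "dual_comult f \<in> carrier (tensor R W W)" if "f \<in> carrier W" for f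
      using dual_comult_closed that by simp
    fix f g assume f: "f \<in> carrier W" and g: "g \<in> carrier W"
    have fg: "f \<oplus>\<^bsub>W\<^esub> g \<in> carrier W" using f g by (rule W.M.a_closed)
    note c = dual_comult_closed[of f] dual_comult_closed[of g] dual_comult_closed[of "f \<oplus>\<^bsub>W\<^esub> g"]
    show "dual_comult (f \<oplus>\<^bsub>W\<^esub> g) = dual_comult f \<oplus>\<^bsub>tensor R W W\<^esub> dual_comult g"
    proof (rule eval2_eqI)
      fix x y assume "x \<in> carrier A" "y \<in> carrier A"
      then show "eval2 x y (dual_comult (f \<oplus>\<^bsub>W\<^esub> g)) = eval2 x y (dual_comult f \<oplus>\<^bsub>tensor R W W\<^esub> dual_comult g)"
        using f g fg c eval2_comult[of "f \<oplus>\<^bsub>W\<^esub> g"]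
        by (simp add: linear_maps_add[OF eval2_linear] eval2_comult)
    qed (use f g fg c in simp_all)
  next
    fix r f assume r: "r \<in> carrier R" and f: "f \<in> carrier W"
    have rf: "r \<odot>\<^bsub>W\<^esub> f \<in> carrier W" using r f by (rule W.smult_closed)
    note c = dual_comult_closed[of f] dual_comult_closed[of "r \<odot>\<^bsub>W\<^esub> f"]
    show "dual_comult (r \<odot>\<^bsub>W\<^esub> f) = r \<odot>\<^bsub>tensor R W W\<^esub> dual_comult f"
    proof (rule eval2_eqI)
      fix x y assume "x \<in> carrier A" "y \<in> carrier A"
      then show "eval2 x y (dual_comult (r \<odot>\<^bsub>W\<^esub> f)) = eval2 x y (r \<odot>\<^bsub>tensor R W W\<^esub> dual_comult f)"
        using r f rf c eval2_comult[of "r \<odot>\<^bsub>W\<^esub> f"]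
        by (simp add: linear_maps_smult[OF eval2_linear] eval2_comult)
    qed (use r f rf c in simp_all)
  qed
qed

end

text \<open>The record \<open>K\<close> is arbitrary up to the fields that matter, because the results are applied to
  bialgebra records, to Hopf algebra records and to subcoalgebras of either.\<close>

locale coalgebra_dual = separating_finite_dual R A \<FF>
  for R :: "'r ring" and A :: "('r, 'a, 'x) coalgebra_scheme" (structure) and \<FF> +
  fixes K :: "('r, 'a \<Rightarrow> 'r, 'k) coalgebra_scheme"
  assumes K_carrier: "carrier K = finite_dual_carrier R A \<FF>"
    and K_zero: "zero K = zero (finite_dual_algebra R A \<FF>)"
    and K_add: "add K = add (finite_dual_algebra R A \<FF>)"
    and K_smult: "smult K = smult (finite_dual_algebra R A \<FF>)"
    and K_comult: "f \<in> finite_dual_carrier R A \<FF> \<Longrightarrow> comult K f = (THE X. is_dual_comult R A \<FF> f X)"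
    and K_counit: "f \<in> finite_dual_carrier R A \<FF> \<Longrightarrow> counit K f = f \<one>"
begin

lemma K_module: "module R K"
  by (rule module_cong[OF W_module]) (simp_all add: K_carrier K_zero K_add K_smult)

lemma K_same: "carrier K = carrier W" "add K = add W" "smult K = smult W"
  by (simp_all add: K_carrier K_add K_smult)

lemmas KK_same = tensor_carrier_cong[OF K_same K_same] tensor_zero_cong[OF K_same K_same]
  tensor_add_cong[OF K_same K_same] tensor_smult_cong[OF K_same K_same] tensor_elem_cong[OF K_same K_same]

lemma K_linear: "linear_maps R K M = linear_maps R W M" "linear_maps R M K = linear_maps R M W"
  by (rule linear_maps_cong_scheme; simp add: K_same)+

lemma KK_linear: "linear_maps R M (tensor R K K) = linear_maps R M (tensor R W W)"
  "linear_maps R (tensor R K K) M = linear_maps R (tensor R W W) M"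
  by (rule linear_maps_cong_scheme; simp add: KK_same)+

lemma K_comult_linear: "comult K \<in> linear_maps R K (tensor R K K)"
  unfolding K_linear KK_linear
  by (rule linear_maps_cong_fun[OF dual_comult_linear W_module]) (simp add: K_comult dual_comult_def)

lemma K_counit_linear: "counit K \<in> functionals R K"
  unfolding K_linear
  by (rule linear_maps_cong_fun[OF eval_linear[OF one_closed] W_module]) (simp add: K_counit)

lemma K_eval_linear: "x \<in> carrier A \<Longrightarrow> (\<lambda>f. f x) \<in> functionals R K"
  unfolding K_linear by (rule eval_linear)

lemma K_eval2_linear:
  "x \<in> carrier A \<Longrightarrow> y \<in> carrier A \<Longrightarrow> eval2 x y \<in> functionals R (tensor R K K)"
  unfolding KK_linear by (rule eval2_linear)

lemma K_comult_closed: "f \<in> carrier K \<Longrightarrow> comult K f \<in> carrier (tensor R K K)"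
  by (rule linear_maps_closed[OF K_comult_linear])

lemma K_eval2_comult:
  "f \<in> carrier K \<Longrightarrow> x \<in> carrier A \<Longrightarrow> y \<in> carrier A \<Longrightarrow> eval2 x y (comult K f) = f (x \<otimes> y)"
  using eval2_comult[of f x y] by (simp add: K_carrier K_comult dual_comult_def)

lemma K_eval2_eqI:
  assumes "X \<in> carrier (tensor R K K)" "Y \<in> carrier (tensor R K K)"
    "\<And>x y. x \<in> carrier A \<Longrightarrow> y \<in> carrier A \<Longrightarrow> eval2 x y X = eval2 x y Y"
  shows "X = Y"
  using assms eval2_eqI by (simp add: KK_same)

lemma K_eval3_eqI:
  assumes "X \<in> carrier (tensor R K (tensor R K K))" "Y \<in> carrier (tensor R K (tensor R K K))"
    "\<And>x y z. x \<in> carrier A \<Longrightarrow> y \<in> carrier A \<Longrightarrow> z \<in> carrier A \<Longrightarrow> eval3 x y z X = eval3 x y z Y"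
  shows "X = Y"
proof -
  have "carrier (tensor R K (tensor R K K)) = carrier (tensor R W (tensor R W W))"
    by (rule tensor_carrier_cong[OF K_same KK_same(1,3,4)])
  then show ?thesis using assms eval3_eqI by simp
qed

text \<open>Both counit axioms are instances: the counit of \<open>K\<close> is evaluation at \<open>\<one>\<close>, and \<open>x = \<one> x = x \<one>\<close>.\<close>

lemma K_comult_section:
  assumes b: "b \<in> bilinear_maps R K K K"
    and eq: "\<And>g h x. g \<in> carrier K \<Longrightarrow> h \<in> carrier K \<Longrightarrow> x \<in> carrier A \<Longrightarrow> b g h x = g (u x) \<otimes>\<^bsub>R\<^esub> h (v x)"
    and f: "f \<in> carrier K"
    and uv: "\<And>x. x \<in> carrier A \<Longrightarrow> u x \<in> carrier A" "\<And>x. x \<in> carrier A \<Longrightarrow> v x \<in> carrier A"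
      "\<And>x. x \<in> carrier A \<Longrightarrow> u x \<otimes> v x = x"
  shows "tensor_lift R K b (comult K f) = f"
proof (rule functional_eqI)
  note SR = self_module[OF R.cring_axioms] and fc = K_comult_closed[OF f]
  show "tensor_lift R K b (comult K f) \<in> finite_dual_carrier R A \<FF>" "f \<in> finite_dual_carrier R A \<FF>"
    using tensor_lift_closed[OF K_module K_module K_module b fc] f by (simp_all add: K_carrier)
  fix x assume x: "x \<in> carrier A"
  have "tensor_lift R K b (comult K f) x = tensor_lift R (self_module R) (\<lambda>g h. b g h x) (comult K f)"
    by (rule tensor_lift_comp[OF K_module K_module K_module SR b K_eval_linear[OF x] fc])
  also have "\<dots> = eval2 (u x) (v x) (comult K f)"
    by (rule tensor_lift_cong[OF K_module K_module SR bilinear_maps_comp[OF K_eval_linear[OF x] b] fc])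
      (rule eq[OF _ _ x])
  finally show "tensor_lift R K b (comult K f) x = f x"
    using x f uv by (simp add: K_eval2_comult)
qed

text \<open>At \<open>(x, y, z)\<close>, the two sides of coassociativity for \<open>f\<close> take the values \<open>f ((x y) z)\<close> and
  \<open>f (x (y z))\<close>.\<close>

theorem finite_dual_is_coalgebra: "coalgebra R K"
proof (intro coalgebra.intro coalgebra_axioms.intro K_module K_comult_linear K_counit_linear)
  note KK = tensor_is_module[OF K_module K_module]
  fix f assume f: "f \<in> carrier K"
  note fc = K_comult_closed[OF f]
  let ?l = "tensor_map R (tensor R K K) K (comult K) (\<lambda>x. x) (comult K f)"
  let ?r = "tensor_map R K (tensor R K K) (\<lambda>x. x) (comult K) (comult K f)"
  note lc = tensor_map_closed[OF KK K_module K_module K_module K_comult_linear linear_maps_id fc]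
  note rc = tensor_map_closed[OF K_module KK K_module K_module linear_maps_id K_comult_linear fc]
  show "tensor_assoc R K K K ?l = ?r"
  proof (rule K_eval3_eqI[OF linear_maps_closed[OF tensor_assoc_linear[OF K_module K_module K_module] lc] rc])
    fix x y z assume xyz: "x \<in> carrier A" "y \<in> carrier A" "z \<in> carrier A"
    note ex = K_eval_linear[OF xyz(1)] and ey = K_eval_linear[OF xyz(2)] and ez = K_eval_linear[OF xyz(3)]
    note e2 = K_eval2_linear[OF xyz(1,2)] and e2' = K_eval2_linear[OF xyz(2,3)]
    have "eval3 x y z (tensor_assoc R K K K ?l) = functional_tensor R (eval2 x y) (\<lambda>f. f z) ?l"
      by (rule functional_tensor_assoc[OF K_module K_module K_module ex ey ez lc])
    also have "\<dots> = functional_tensor R (\<lambda>f. eval2 x y (comult K f)) (\<lambda>f. f z) (comult K f)"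
      by (rule functional_tensor_tensor_map[OF KK K_module K_module K_module K_comult_linear linear_maps_id e2 ez fc])
    also have "\<dots> = eval2 (x \<otimes> y) z (comult K f)"
      by (rule functional_tensor_cong[OF K_module K_module linear_maps_comp[OF e2 K_comult_linear] ez _ _ fc])
        (simp_all add: K_eval2_comult xyz)
    also have "\<dots> = eval2 x (y \<otimes> z) (comult K f)"
      using xyz by (simp add: K_eval2_comult f m_assoc)
    also have "\<dots> = functional_tensor R (\<lambda>f. f x) (\<lambda>f. eval2 y z (comult K f)) (comult K f)"
      by (rule functional_tensor_cong[OF K_module K_module ex K_eval_linear _ _ fc])
        (simp_all add: K_eval2_comult xyz)
    also have "\<dots> = eval3 x y z ?r"
      by (rule functional_tensor_tensor_map[OF K_module KK K_module K_module linear_maps_id K_comult_linear ex e2' fc,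
            symmetric])
    finally show "eval3 x y z (tensor_assoc R K K K ?l) = eval3 x y z ?r" .
  qed
  note bl = bilinear_maps_pull[OF smult_bilinear[OF K_module] K_counit_linear linear_maps_id]
  show "tensor_lift R K (\<lambda>x y. counit K x \<odot>\<^bsub>K\<^esub> y) (comult K f) = f"
    by (rule K_comult_section[OF bl _ f, where u = "\<lambda>x. \<one>" and v = "\<lambda>x. x"])
      (simp_all add: K_smult K_counit K_carrier)
  show "tensor_lift R K (\<lambda>x y. counit K y \<odot>\<^bsub>K\<^esub> x) (comult K f) = f"
    by (rule K_comult_section[OF bilinear_maps_flip[OF bl] _ f, where u = "\<lambda>x. x" and v = "\<lambda>x. \<one>"])
      (simp_all add: K_smult K_counit K_carrier functional_closed R.m_comm)
qed

end


section \<open>Products of tensors and convolution\<close>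

lemma tensor_lift_cong_module:
  fixes P P' :: "('r, 'p, 'z) module_scheme"
  assumes "carrier P' = carrier P" "zero P' = zero P" "add P' = add P" "smult P' = smult P"
  shows "tensor_lift R P' b X = tensor_lift R P b X"
  using assms by (simp add: tensor_lift_def finsum_def)

context
  fixes R :: "'r ring" and A :: "('r, 'a, 'x) module_scheme" and B :: "('r, 'b, 'y) module_scheme"
  assumes A: "assoc_algebra R A" and B: "assoc_algebra R B"
begin

interpretation A: assoc_algebra R A by (rule A)
interpretation B: assoc_algebra R B by (rule B)

lemma tensor_mult_quadrilinear:
  "(\<lambda>a b c d. tensor_elem R A B (a \<otimes>\<^bsub>A\<^esub> c) (b \<otimes>\<^bsub>B\<^esub> d)) \<in> quadrilinear_maps R A B A B (tensor R A B)"
  by (rule quadrilinear_product[OF tensor_elem_bilinear[OF A.module_axioms B.module_axioms]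
        A.mult_bilinear B.mult_bilinear])

lemma tensor_mult_eq:
  "X \<otimes>\<^bsub>tensor R A B\<^esub> Y = tensor_lift R (tensor R A B) (\<lambda>a b. tensor_lift R (tensor R A B)
     (\<lambda>c d. tensor_elem R A B (a \<otimes>\<^bsub>A\<^esub> c) (b \<otimes>\<^bsub>B\<^esub> d)) Y) X"
  by (subst (1) tensor_def) (simp add: Let_def
    tensor_lift_cong_module[OF tensor_simps(1-4)[of R A B, symmetric]])

lemma tensor_mult_closed:
  "X \<in> carrier (tensor R A B) \<Longrightarrow> Y \<in> carrier (tensor R A B) \<Longrightarrow>
    X \<otimes>\<^bsub>tensor R A B\<^esub> Y \<in> carrier (tensor R A B)"
  unfolding tensor_mult_eq
  by (rule bilinear_maps_closed[OF double_lift_bilinear[OF A.module_axioms B.module_axioms A.module_axioms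
        B.module_axioms tensor_is_module[OF A.module_axioms B.module_axioms] tensor_mult_quadrilinear]])

lemma functional_tensor_mult:
  assumes f: "f \<in> functionals R A" and g: "g \<in> functionals R B"
    and X: "X \<in> carrier (tensor R A B)" and Y: "Y \<in> carrier (tensor R A B)"
  shows "functional_tensor R f g (X \<otimes>\<^bsub>tensor R A B\<^esub> Y) =
    tensor_lift R (self_module R) (\<lambda>a b. tensor_lift R (self_module R)
      (\<lambda>c d. f (a \<otimes>\<^bsub>A\<^esub> c) \<otimes>\<^bsub>R\<^esub> g (b \<otimes>\<^bsub>B\<^esub> d)) Y) X"
proof -
  let ?T = "tensor R A B" and ?S = "self_module R"
  note M = A.module_axioms B.module_axioms
  note T = tensor_is_module[OF M] and SR = self_module[OF A.R.cring_axioms]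
  note q = tensor_mult_quadrilinear and fg = functional_tensor_linear[OF M f g]
  note bX = inner_lift_bilinear[OF M M T q Y]
  have "functional_tensor R f g (X \<otimes>\<^bsub>?T\<^esub> Y) = tensor_lift R ?S (\<lambda>a b. functional_tensor R f g
      (tensor_lift R ?T (\<lambda>c d. tensor_elem R A B (a \<otimes>\<^bsub>A\<^esub> c) (b \<otimes>\<^bsub>B\<^esub> d)) Y)) X"
    unfolding tensor_mult_eq by (rule tensor_lift_comp[OF M T SR bX fg X])
  also have "\<dots> = tensor_lift R ?S (\<lambda>a b. tensor_lift R ?S
      (\<lambda>c d. f (a \<otimes>\<^bsub>A\<^esub> c) \<otimes>\<^bsub>R\<^esub> g (b \<otimes>\<^bsub>B\<^esub> d)) Y) X"
  proof (rule tensor_lift_cong[OF M SR bilinear_maps_comp[OF fg bX] X])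
    fix a b assume ab: "a \<in> carrier A" "b \<in> carrier B"
    note bY = quadrilinear_right[OF q ab]
    have "functional_tensor R f g (tensor_lift R ?T (\<lambda>c d. tensor_elem R A B (a \<otimes>\<^bsub>A\<^esub> c) (b \<otimes>\<^bsub>B\<^esub> d)) Y) =
        tensor_lift R ?S (\<lambda>c d. functional_tensor R f g (tensor_elem R A B (a \<otimes>\<^bsub>A\<^esub> c) (b \<otimes>\<^bsub>B\<^esub> d))) Y"
      by (rule tensor_lift_comp[OF M T SR bY fg Y])
    also have "\<dots> = tensor_lift R ?S (\<lambda>c d. f (a \<otimes>\<^bsub>A\<^esub> c) \<otimes>\<^bsub>R\<^esub> g (b \<otimes>\<^bsub>B\<^esub> d)) Y"
      by (rule tensor_lift_cong[OF M SR bilinear_maps_comp[OF fg bY] Y])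
        (simp add: functional_tensor_elem[OF M f g] ab)
    finally show "functional_tensor R f g
        (tensor_lift R ?T (\<lambda>c d. tensor_elem R A B (a \<otimes>\<^bsub>A\<^esub> c) (b \<otimes>\<^bsub>B\<^esub> d)) Y) =
      tensor_lift R ?S (\<lambda>c d. f (a \<otimes>\<^bsub>A\<^esub> c) \<otimes>\<^bsub>R\<^esub> g (b \<otimes>\<^bsub>B\<^esub> d)) Y" .
  qed
  finally show ?thesis .
qed

end

context coalgebra
begin

lemma comult_closed: "c \<in> carrier C \<Longrightarrow> comult C c \<in> carrier (tensor R C C)"
  by (rule linear_maps_closed[OF comult_linear])

lemma convolution_linear:
  assumes "f \<in> functionals R C" "g \<in> functionals R C"
  shows "(\<lambda>c. functional_tensor R f g (comult C c)) \<in> functionals R C"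
  by (rule linear_maps_comp[OF functional_tensor_linear[OF module_axioms module_axioms assms] comult_linear])

lemma convolution_apply:
  "c \<in> carrier C \<Longrightarrow> convolution R C f g c = functional_tensor R f g (comult C c)"
  by (simp add: convolution_def)

lemma convolution_functional:
  assumes "f \<in> functionals R C" "g \<in> functionals R C"
  shows "convolution R C f g \<in> functionals R C"
  by (rule linear_maps_cong_fun[OF convolution_linear[OF assms] module_axioms]) (simp add: convolution_apply)

lemma convolution_assoc:
  assumes f: "f \<in> functionals R C" and g: "g \<in> functionals R C"
    and k: "k \<in> functionals R C"
  shows "convolution R C (convolution R C f g) k = convolution R C f (convolution R C g k)"
proof (rule extensionalityI)
  note C = module_axioms and CC = tensor_is_module[OF module_axioms module_axioms]
  note fg = functional_tensor_linear[OF C C f g] and gk = functional_tensor_linear[OF C C g k]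
  fix c assume c: "c \<in> carrier C"
  note cc = comult_closed[OF c]
  note lc = tensor_map_closed[OF CC C C C comult_linear linear_maps_id cc]
  have "convolution R C (convolution R C f g) k c = functional_tensor R (convolution R C f g) k (comult C c)"
    using c by (simp add: convolution_apply)
  also have "\<dots> = functional_tensor R (\<lambda>x. functional_tensor R f g (comult C x)) k (comult C c)"
    by (rule functional_tensor_cong[OF C C convolution_functional[OF f g] k _ _ cc]) (simp_all add: convolution_apply)
  also have "\<dots> = functional_tensor R (functional_tensor R f g) k
      (tensor_map R (tensor R C C) C (comult C) (\<lambda>x. x) (comult C c))"
    by (rule functional_tensor_tensor_map[OF CC C C C comult_linear linear_maps_id fg k cc, symmetric])
  also have "\<dots> = functional_tensor R f (functional_tensor R g k)
      (tensor_map R C (tensor R C C) (\<lambda>x. x) (comult C) (comult C c))"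
    unfolding coassoc[OF c, symmetric] by (rule functional_tensor_assoc[OF C C C f g k lc, symmetric])
  also have "\<dots> = functional_tensor R f (\<lambda>x. functional_tensor R g k (comult C x)) (comult C c)"
    by (rule functional_tensor_tensor_map[OF C CC C C linear_maps_id comult_linear f gk cc])
  also have "\<dots> = functional_tensor R f (convolution R C g k) (comult C c)"
    by (rule functional_tensor_cong[OF C C f convolution_linear[OF g k] _ _ cc]) (simp_all add: convolution_apply)
  finally show "convolution R C (convolution R C f g) k c = convolution R C f (convolution R C g k) c"
    using c by (simp add: convolution_apply)
qed (simp_all add: convolution_def)

lemma convolution_counit_left:
  assumes f: "f \<in> functionals R C" and c: "c \<in> carrier C"
  shows "convolution R C (\<lambda>x\<in>carrier C. counit C x) f c = f c"
proof -
  note C = module_axioms and SR = self_module[OF R.cring_axioms] and cc = comult_closed[OF c]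
  note b = bilinear_maps_pull[OF smult_bilinear[OF C] counit_linear linear_maps_id]
  have "f c = f (tensor_lift R C (\<lambda>x y. counit C x \<odot> y) (comult C c))"
    using counit_left[OF c] by simp
  also have "\<dots> = tensor_lift R (self_module R) (\<lambda>x y. f (counit C x \<odot> y)) (comult C c)"
    by (rule tensor_lift_comp[OF C C C SR b f cc])
  also have "\<dots> = functional_tensor R (\<lambda>x\<in>carrier C. counit C x) f (comult C c)"
    by (rule tensor_lift_cong[OF C C SR bilinear_maps_comp[OF f b] cc])
      (use linear_maps_smult[OF f] linear_maps_closed[OF counit_linear] in simp)
  finally show ?thesis using c by (simp add: convolution_apply)
qed

lemma convolution_counit_right:
  assumes f: "f \<in> functionals R C" and c: "c \<in> carrier C"
  shows "convolution R C f (\<lambda>x\<in>carrier C. counit C x) c = f c"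
proof -
  note C = module_axioms and SR = self_module[OF R.cring_axioms] and cc = comult_closed[OF c]
  note b = bilinear_maps_flip[OF bilinear_maps_pull[OF smult_bilinear[OF C] counit_linear linear_maps_id]]
  have "f c = f (tensor_lift R C (\<lambda>x y. counit C y \<odot> x) (comult C c))"
    using counit_right[OF c] by simp
  also have "\<dots> = tensor_lift R (self_module R) (\<lambda>x y. f (counit C y \<odot> x)) (comult C c)"
    by (rule tensor_lift_comp[OF C C C SR b f cc])
  also have "\<dots> = functional_tensor R f (\<lambda>x\<in>carrier C. counit C x) (comult C c)"
    by (rule tensor_lift_cong[OF C C SR bilinear_maps_comp[OF f b] cc])
      (use linear_maps_smult[OF f] linear_maps_closed[OF counit_linear] linear_maps_closed[OF f]
        in \<open>simp add: R.m_comm\<close>)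
  finally show ?thesis using c by (simp add: convolution_apply)
qed

end


section \<open>The bialgebra structure of the finite dual\<close>

locale bialgebra_dual = coalgebra_dual R A \<FF> K + bialgebra R A
  for R :: "'r ring" and A :: "('r, 'a, 'x) coalgebra_scheme" (structure) and \<FF>
    and K :: "('r, 'a \<Rightarrow> 'r, 'k) coalgebra_scheme" +
  assumes K_mult: "monoid.mult K = convolution R A"
    and K_one: "one K = (\<lambda>x\<in>carrier A. counit A x)"
    and K_mult_closed: "f \<in> finite_dual_carrier R A \<FF> \<Longrightarrow> g \<in> finite_dual_carrier R A \<FF> \<Longrightarrow>
      convolution R A f g \<in> finite_dual_carrier R A \<FF>"
    and K_one_closed: "(\<lambda>x\<in>carrier A. counit A x) \<in> finite_dual_carrier R A \<FF>"
begin

lemma K_functional: "f \<in> carrier K \<Longrightarrow> f \<in> functionals R A"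
  using functional_linear by (simp add: K_carrier)

lemma K_eqI: "f \<in> carrier K \<Longrightarrow> g \<in> carrier K \<Longrightarrow> (\<And>x. x \<in> carrier A \<Longrightarrow> f x = g x) \<Longrightarrow> f = g"
  using functional_eqI by (simp add: K_carrier)

lemma K_add_apply: "x \<in> carrier A \<Longrightarrow> (f \<oplus>\<^bsub>K\<^esub> g) x = f x \<oplus>\<^bsub>R\<^esub> g x"
  by (simp add: K_add)

lemma K_smult_apply: "x \<in> carrier A \<Longrightarrow> (r \<odot>\<^bsub>K\<^esub> f) x = r \<otimes>\<^bsub>R\<^esub> f x"
  by (simp add: K_smult)

lemma K_mult_apply: "x \<in> carrier A \<Longrightarrow> (f \<otimes>\<^bsub>K\<^esub> g) x = functional_tensor R f g (comult A x)"
  by (simp add: K_mult convolution_apply)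

lemma K_eval_bilinear: "(\<lambda>f x. f x) \<in> bilinear_maps R K A (self_module R)"
  using eval_bilinear by (simp add: bilinear_maps_def K_linear K_carrier)

lemma functional_tensor_bilinear:
  assumes U: "U \<in> carrier (tensor R A A)"
  shows "(\<lambda>f g. functional_tensor R f g U) \<in> bilinear_maps R K K (self_module R)"
proof (rule bilinear_mapsI)
  note SR = self_module[OF R.cring_axioms]
  note ev = bilinear_maps_left[OF K_eval_bilinear]
  show "(\<lambda>g. functional_tensor R f g U) \<in> functionals R K" if f: "f \<in> carrier K" for f
    by (rule tensor_lift_param_linear[OF module_axioms module_axioms K_module SR U])
      (use linear_maps_closed[OF K_functional[OF f]] in
        \<open>simp_all add: product_bilinear[OF R.cring_axioms] K_functional f linear_maps_mult_left[OF K_module] ev\<close>)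
  show "(\<lambda>f. functional_tensor R f g U) \<in> functionals R K" if g: "g \<in> carrier K" for g
    by (rule tensor_lift_param_linear[OF module_axioms module_axioms K_module SR U])
      (use linear_maps_closed[OF K_functional[OF g]] in
        \<open>simp_all add: product_bilinear[OF R.cring_axioms] K_functional g linear_maps_mult_right[OF K_module] ev\<close>)
qed

lemma K_algebra: "assoc_algebra R K"
proof -
  interpret K: module R K by (rule K_module)
  have mc: "f \<otimes>\<^bsub>K\<^esub> g \<in> carrier K" if "f \<in> carrier K" "g \<in> carrier K" for f g
    using K_mult_closed that by (simp add: K_carrier K_mult)
  have oc: "\<one>\<^bsub>K\<^esub> \<in> carrier K" using K_one_closed by (simp add: K_carrier K_one)
  note b = functional_tensor_bilinear[OF comult_closed]
  note br = bilinear_maps_right[OF b] and bl = bilinear_maps_left[OF b]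
  have "monoid K"
  proof (rule monoidI)
    fix f g h assume "f \<in> carrier K" "g \<in> carrier K" "h \<in> carrier K"
    then show "f \<otimes>\<^bsub>K\<^esub> g \<otimes>\<^bsub>K\<^esub> h = f \<otimes>\<^bsub>K\<^esub> (g \<otimes>\<^bsub>K\<^esub> h)"
      by (simp add: K_mult convolution_assoc K_functional)
  next
    fix f assume f: "f \<in> carrier K"
    show "\<one>\<^bsub>K\<^esub> \<otimes>\<^bsub>K\<^esub> f = f"
      by (rule K_eqI[OF mc[OF oc f] f]) (simp add: K_mult K_one convolution_counit_left K_functional f)
    show "f \<otimes>\<^bsub>K\<^esub> \<one>\<^bsub>K\<^esub> = f"
      by (rule K_eqI[OF mc[OF f oc] f]) (simp add: K_mult K_one convolution_counit_right K_functional f)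
  qed (simp_all add: mc oc)
  moreover have "(f \<oplus>\<^bsub>K\<^esub> g) \<otimes>\<^bsub>K\<^esub> h = f \<otimes>\<^bsub>K\<^esub> h \<oplus>\<^bsub>K\<^esub> g \<otimes>\<^bsub>K\<^esub> h"
    "h \<otimes>\<^bsub>K\<^esub> (f \<oplus>\<^bsub>K\<^esub> g) = h \<otimes>\<^bsub>K\<^esub> f \<oplus>\<^bsub>K\<^esub> h \<otimes>\<^bsub>K\<^esub> g"
    if "f \<in> carrier K" "g \<in> carrier K" "h \<in> carrier K" for f g h
    using that by (auto intro!: K_eqI K.M.a_closed mc
        simp: K_mult_apply K_add_apply linear_maps_add[OF bl] linear_maps_add[OF br])
  ultimately have "ring K"
    by (intro ringI K.M.abelian_group_axioms) simp_all
  moreover have "(r \<odot>\<^bsub>K\<^esub> f) \<otimes>\<^bsub>K\<^esub> g = r \<odot>\<^bsub>K\<^esub> (f \<otimes>\<^bsub>K\<^esub> g)" "f \<otimes>\<^bsub>K\<^esub> (r \<odot>\<^bsub>K\<^esub> g) = r \<odot>\<^bsub>K\<^esub> (f \<otimes>\<^bsub>K\<^esub> g)"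
    if "r \<in> carrier R" "f \<in> carrier K" "g \<in> carrier K" for r f g
    using that by (auto intro!: K_eqI K.smult_closed mc
        simp: K_mult_apply K_smult_apply linear_maps_smult[OF bl] linear_maps_smult[OF br])
  ultimately show ?thesis
    by (simp add: assoc_algebra_def assoc_algebra_axioms_def K_module)
qed

text \<open>This identity is used for comultiplications \<open>X\<close>, \<open>Y\<close> of functionals and \<open>U\<close>, \<open>V\<close> of elements of
  \<open>A\<close>. The left side is then the value of the product of \<open>X\<close> and \<open>Y\<close>, and the right side the value of
  a convolution product at a product, so it exchanges the multiplicativity of one
  comultiplication for that of the other. For \<open>X = p \<otimes> q\<close> and \<open>Y = r \<otimes> s\<close> both sides are
  \<open>\<Sum> p(u\<^sub>1) r(u\<^sub>2) \<cdot> \<Sum> q(v\<^sub>1) s(v\<^sub>2)\<close>.\<close>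

lemma eval_tensor_product:
  assumes X: "X \<in> carrier (tensor R K K)" and Y: "Y \<in> carrier (tensor R K K)"
    and U: "U \<in> carrier (tensor R A A)" and V: "V \<in> carrier (tensor R A A)"
  shows "tensor_lift R (self_module R) (\<lambda>p q. tensor_lift R (self_module R)
      (\<lambda>r s. functional_tensor R p r U \<otimes>\<^bsub>R\<^esub> functional_tensor R q s V) Y) X =
    tensor_lift R (self_module R) (\<lambda>a b. tensor_lift R (self_module R)
      (\<lambda>c d. eval2 a c X \<otimes>\<^bsub>R\<^esub> eval2 b d Y) V) U"
    (is "?L X Y = ?R X Y")
proof -
  let ?S = "self_module R"
  note A = module_axioms and SR = self_module[OF R.cring_axioms] and KK = tensor_is_module[OF K_module K_module]
  note qK = quadrilinear_product[OF ring_mult_bilinear[OF R.cring_axioms]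
      functional_tensor_bilinear[OF U] functional_tensor_bilinear[OF V]]
  note L = double_lift_bilinear[OF K_module K_module K_module K_module SR qK]
  have e2: "(\<lambda>x y. eval2 x y Z) \<in> bilinear_maps R A A ?S" if "Z \<in> carrier (tensor R K K)" for Z
    using eval2_bilinear that by (simp add: KK_same)
  have qA: "(\<lambda>a b c d. eval2 a c X \<otimes>\<^bsub>R\<^esub> eval2 b d Y) \<in> quadrilinear_maps R A A A A ?S"
    if "X \<in> carrier (tensor R K K)" "Y \<in> carrier (tensor R K K)" for X Y
    by (rule quadrilinear_product[OF ring_mult_bilinear[OF R.cring_axioms] e2 e2]) (rule that)+
  have e2c: "eval2 a c Z \<in> carrier R" if "a \<in> carrier A" "c \<in> carrier A" "Z \<in> carrier (tensor R K K)" for a c Z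
    using linear_maps_closed[OF K_eval2_linear] that by simp
  have R_left: "(\<lambda>X. ?R X Y) \<in> linear_maps R (tensor R K K) ?S" if Y: "Y \<in> carrier (tensor R K K)" for Y
    by (rule double_lift_param_linear[OF KK A A A A SR U V qA])
      (use Y in \<open>simp_all add: linear_maps_mult_right[OF KK] K_eval2_linear e2c\<close>)
  have R_right: "(\<lambda>Y. ?R X Y) \<in> linear_maps R (tensor R K K) ?S" if X: "X \<in> carrier (tensor R K K)" for X
    by (rule double_lift_param_linear[OF KK A A A A SR U V qA])
      (use X in \<open>simp_all add: linear_maps_mult_left[OF KK] K_eval2_linear e2c\<close>)
  have elem: "?L (tensor_elem R K K p q) (tensor_elem R K K r s) =
      ?R (tensor_elem R K K p q) (tensor_elem R K K r s)"
    if pq: "p \<in> carrier K" "q \<in> carrier K" and rs: "r \<in> carrier K" "s \<in> carrier K" for p q r s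
  proof -
    let ?X = "tensor_elem R K K p q" and ?Y = "tensor_elem R K K r s"
    have Xc: "?X \<in> carrier (tensor R K K)" and Yc: "?Y \<in> carrier (tensor R K K)"
      using that tensor_elem_closed[OF K_module K_module] by auto
    note fl = K_functional[OF pq(1)] K_functional[OF pq(2)] K_functional[OF rs(1)] K_functional[OF rs(2)]
    have fc: "p x \<in> carrier R" "q x \<in> carrier R" "r x \<in> carrier R" "s x \<in> carrier R" if "x \<in> carrier A" for x
      using fl[THEN linear_maps_closed, OF that] by simp_all
    have ft: "functional_tensor R p r U \<in> carrier R" "functional_tensor R q s V \<in> carrier R"
      using linear_maps_closed[OF functional_tensor_linear[OF A A fl(1,3)] U]
        linear_maps_closed[OF functional_tensor_linear[OF A A fl(2,4)] V] by simp_all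
    have "?R ?X ?Y = tensor_lift R ?S (\<lambda>a b. functional_tensor R q s V \<otimes>\<^bsub>R\<^esub> (p a \<otimes>\<^bsub>R\<^esub> r b)) U"
    proof (rule tensor_lift_cong[OF A A SR inner_lift_bilinear[OF A A A A SR qA[OF Xc Yc] V] U])
      fix a b assume ab: "a \<in> carrier A" "b \<in> carrier A"
      have "tensor_lift R ?S (\<lambda>c d. eval2 a c ?X \<otimes>\<^bsub>R\<^esub> eval2 b d ?Y) V =
          tensor_lift R ?S (\<lambda>c d. (p a \<otimes>\<^bsub>R\<^esub> r b) \<otimes>\<^bsub>R\<^esub> (q c \<otimes>\<^bsub>R\<^esub> s d)) V"
        by (rule tensor_lift_cong[OF A A SR quadrilinear_right[OF qA[OF Xc Yc] ab] V])
          (simp add: functional_tensor_elem[OF K_module K_module] K_eval_linear that ab fc R.m_ac)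
      also have "\<dots> = (p a \<otimes>\<^bsub>R\<^esub> r b) \<otimes>\<^bsub>R\<^esub> functional_tensor R q s V"
        by (rule tensor_lift_comp[OF A A SR SR product_bilinear[OF R.cring_axioms fl(2,4)] _ V, symmetric])
          (use linear_maps_mult_left[OF SR _ linear_maps_id] fc ab in simp)
      finally show "tensor_lift R ?S (\<lambda>c d. eval2 a c ?X \<otimes>\<^bsub>R\<^esub> eval2 b d ?Y) V =
          functional_tensor R q s V \<otimes>\<^bsub>R\<^esub> (p a \<otimes>\<^bsub>R\<^esub> r b)"
        using fc ab ft by (simp add: R.m_comm)
    qed
    also have "\<dots> = functional_tensor R q s V \<otimes>\<^bsub>R\<^esub> functional_tensor R p r U"
      by (rule tensor_lift_comp[OF A A SR SR product_bilinear[OF R.cring_axioms fl(1,3)] _ U, symmetric])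
        (use linear_maps_mult_left[OF SR _ linear_maps_id] ft in simp)
    also have "\<dots> = ?L ?X ?Y"
      using ft pq rs Yc by (simp add: double_lift_elem_left[OF K_module K_module K_module K_module SR qK]
          tensor_lift_elem[OF K_module K_module SR quadrilinear_right[OF qK]] R.m_comm)
    finally show ?thesis by simp
  qed
  show ?thesis
  proof (rule tensor_linear_ext[OF K_module K_module SR bilinear_maps_left[OF L Y] R_left[OF Y] X])
    fix p q assume pq: "p \<in> carrier K" "q \<in> carrier K"
    note Xc = tensor_elem_closed[OF K_module K_module pq]
    show "?L (tensor_elem R K K p q) Y = ?R (tensor_elem R K K p q) Y"
      by (rule tensor_linear_ext[OF K_module K_module SR bilinear_maps_right[OF L Xc] R_right[OF Xc] Y])
        (rule elem[OF pq])
  qed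
qed

lemma comult_mult:
  "x \<in> carrier A \<Longrightarrow> y \<in> carrier A \<Longrightarrow> comult A (x \<otimes> y) = comult A x \<otimes>\<^bsub>tensor R A A\<^esub> comult A y"
  "comult A \<one> = tensor_elem R A A \<one> \<one>"
proof -
  have "comult A \<in> ring_hom A (tensor R A A)" using comult_algebra_hom by (simp add: algebra_homs_def)
  from ring_hom_mult[OF this] ring_hom_one[OF this]
  show "x \<in> carrier A \<Longrightarrow> y \<in> carrier A \<Longrightarrow> comult A (x \<otimes> y) = comult A x \<otimes>\<^bsub>tensor R A A\<^esub> comult A y"
    "comult A \<one> = tensor_elem R A A \<one> \<one>"
    by (simp_all add: tensor_simps(5))
qed

lemma counit_mult:
  "x \<in> carrier A \<Longrightarrow> y \<in> carrier A \<Longrightarrow> counit A (x \<otimes> y) = counit A x \<otimes>\<^bsub>R\<^esub> counit A y"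
  "counit A \<one> = \<one>\<^bsub>R\<^esub>"
proof -
  have "counit A \<in> ring_hom A (self_module R)" using counit_algebra_hom by (simp add: algebra_homs_def)
  from ring_hom_mult[OF this] ring_hom_one[OF this]
  show "x \<in> carrier A \<Longrightarrow> y \<in> carrier A \<Longrightarrow> counit A (x \<otimes> y) = counit A x \<otimes>\<^bsub>R\<^esub> counit A y"
    "counit A \<one> = \<one>\<^bsub>R\<^esub>"
    by simp_all
qed

lemma K_comult_mult:
  assumes f: "f \<in> carrier K" and g: "g \<in> carrier K"
  shows "comult K (f \<otimes>\<^bsub>K\<^esub> g) = comult K f \<otimes>\<^bsub>tensor R K K\<^esub> comult K g"
proof -
  interpret K: assoc_algebra R K by (rule K_algebra)
  let ?S = "self_module R"
  note A = module_axioms and SR = self_module[OF R.cring_axioms] and KA = assoc_algebra_axioms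
  note fc = K_comult_closed[OF f] and gc = K_comult_closed[OF g]
  note fl = K_functional[OF f] K_functional[OF g]
  show ?thesis
  proof (rule K_eval2_eqI)
    show "comult K (f \<otimes>\<^bsub>K\<^esub> g) \<in> carrier (tensor R K K)" by (rule K_comult_closed) (simp add: f g)
    show "comult K f \<otimes>\<^bsub>tensor R K K\<^esub> comult K g \<in> carrier (tensor R K K)"
      by (rule tensor_mult_closed[OF K_algebra K_algebra fc gc])
    fix x y assume xy: "x \<in> carrier A" "y \<in> carrier A"
    note xc = comult_closed[OF xy(1)] and yc = comult_closed[OF xy(2)]
    note qA = quadrilinear_product[OF ring_mult_bilinear[OF R.cring_axioms]
        bilinear_maps_comp[OF fl(1) mult_bilinear] bilinear_maps_comp[OF fl(2) mult_bilinear]]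
    have "eval2 x y (comult K f \<otimes>\<^bsub>tensor R K K\<^esub> comult K g) =
        tensor_lift R ?S (\<lambda>p q. tensor_lift R ?S (\<lambda>r s. (p \<otimes>\<^bsub>K\<^esub> r) x \<otimes>\<^bsub>R\<^esub> (q \<otimes>\<^bsub>K\<^esub> s) y) (comult K g)) (comult K f)"
      by (rule functional_tensor_mult[OF K_algebra K_algebra K_eval_linear K_eval_linear fc gc]) (rule xy)+
    also have "\<dots> = tensor_lift R ?S (\<lambda>p q. tensor_lift R ?S (\<lambda>r s. functional_tensor R p r (comult A x) \<otimes>\<^bsub>R\<^esub>
        functional_tensor R q s (comult A y)) (comult K g)) (comult K f)"
      using xy by (simp add: K_mult_apply)
    also have "\<dots> = tensor_lift R ?S (\<lambda>a b. tensor_lift R ?S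
        (\<lambda>c d. eval2 a c (comult K f) \<otimes>\<^bsub>R\<^esub> eval2 b d (comult K g)) (comult A y)) (comult A x)"
      by (rule eval_tensor_product[OF fc gc xc yc])
    also have "\<dots> = tensor_lift R ?S (\<lambda>a b. tensor_lift R ?S
        (\<lambda>c d. f (a \<otimes> c) \<otimes>\<^bsub>R\<^esub> g (b \<otimes> d)) (comult A y)) (comult A x)"
    proof (rule sym, rule tensor_lift_cong[OF A A SR inner_lift_bilinear[OF A A A A SR qA yc] xc])
      fix a b assume ab: "a \<in> carrier A" "b \<in> carrier A"
      show "tensor_lift R ?S (\<lambda>c d. f (a \<otimes> c) \<otimes>\<^bsub>R\<^esub> g (b \<otimes> d)) (comult A y) =
          tensor_lift R ?S (\<lambda>c d. eval2 a c (comult K f) \<otimes>\<^bsub>R\<^esub> eval2 b d (comult K g)) (comult A y)"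
        by (rule tensor_lift_cong[OF A A SR quadrilinear_right[OF qA ab] yc]) (simp add: K_eval2_comult f g ab)
    qed
    also have "\<dots> = functional_tensor R f g (comult A x \<otimes>\<^bsub>tensor R A A\<^esub> comult A y)"
      by (rule functional_tensor_mult[OF KA KA fl xc yc, symmetric])
    also have "\<dots> = eval2 x y (comult K (f \<otimes>\<^bsub>K\<^esub> g))"
      using xy f g by (simp add: K_eval2_comult comult_mult K_mult_apply)
    finally show "eval2 x y (comult K (f \<otimes>\<^bsub>K\<^esub> g)) = eval2 x y (comult K f \<otimes>\<^bsub>tensor R K K\<^esub> comult K g)" by simp
  qed
qed

theorem finite_dual_is_bialgebra: "bialgebra R K"
proof -
  interpret K: assoc_algebra R K by (rule K_algebra)
  note A = module_axioms
  have "comult K \<one>\<^bsub>K\<^esub> = tensor_elem R K K \<one>\<^bsub>K\<^esub> \<one>\<^bsub>K\<^esub>"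
  proof (rule K_eval2_eqI)
    fix x y assume "x \<in> carrier A" "y \<in> carrier A"
    then show "eval2 x y (comult K \<one>\<^bsub>K\<^esub>) = eval2 x y (tensor_elem R K K \<one>\<^bsub>K\<^esub> \<one>\<^bsub>K\<^esub>)"
      by (simp add: K_eval2_comult functional_tensor_elem[OF K_module K_module] K_eval_linear)
        (simp add: K_one counit_mult)
  qed (simp_all add: K_comult_closed tensor_elem_closed[OF K_module K_module])
  then have "comult K \<in> ring_hom K (tensor R K K)"
    by (intro ring_hom_memI)
      (simp_all add: K_comult_closed K_comult_mult linear_maps_add[OF K_comult_linear] tensor_simps(5))
  moreover have "counit K \<in> ring_hom K (self_module R)"
  proof (rule ring_hom_memI)
    fix f g assume fg: "f \<in> carrier K" "g \<in> carrier K"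
    then have "(f \<otimes>\<^bsub>K\<^esub> g) \<one> = f \<one> \<otimes>\<^bsub>R\<^esub> g \<one>"
      by (simp add: K_mult_apply comult_mult functional_tensor_elem[OF A A] K_functional)
    moreover have "f \<otimes>\<^bsub>K\<^esub> g \<in> carrier K" using fg by simp
    ultimately show "counit K (f \<otimes>\<^bsub>K\<^esub> g) = counit K f \<otimes>\<^bsub>self_module R\<^esub> counit K g"
      using fg by (simp add: K_carrier K_counit)
    show "counit K (f \<oplus>\<^bsub>K\<^esub> g) = counit K f \<oplus>\<^bsub>self_module R\<^esub> counit K g"
      using fg by (rule linear_maps_add[OF K_counit_linear])
  next
    show "counit K \<one>\<^bsub>K\<^esub> = \<one>\<^bsub>self_module R\<^esub>"
      using K.one_closed by (simp add: K_carrier K_counit) (simp add: K_one counit_mult)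
  qed (rule linear_maps_closed[OF K_counit_linear])
  ultimately show ?thesis
    using finite_dual_is_coalgebra K_algebra
    by (simp add: bialgebra_def bialgebra_axioms_def algebra_homs_def K_comult_linear K_counit_linear)
qed

theorem finite_dual_alpha_pairing: "bialgebra_alpha_pairing TYPE('m) R A K (\<lambda>x f. f x)"
proof -
  note A = module_axioms
  have ev: "(\<lambda>f\<in>carrier K. f x) \<in> dual_carrier R K" if "x \<in> carrier A" for x
    by (rule dual_carrierI[OF K_module K_eval_linear[OF that]])
  have evl: "(\<lambda>f\<in>carrier K. f x) \<in> functionals R K" if "x \<in> carrier A" for x
    by (rule dual_carrierD(1)[OF ev[OF that]])
  have "(\<lambda>x. \<lambda>f\<in>carrier K. f x) \<in> linear_maps R A (dual_algebra R K)"
    by (rule linear_mapsI) (simp_all add: ev linear_maps_add[OF K_functional] linear_maps_smult[OF K_functional]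
      cong: restrict_cong)
  moreover have "(\<lambda>x. \<lambda>f\<in>carrier K. f x) \<in> ring_hom A (dual_algebra R K)"
  proof (rule ring_hom_memI)
    fix x y assume xy: "x \<in> carrier A" "y \<in> carrier A"
    have "functional_tensor R (\<lambda>f\<in>carrier K. f x) (\<lambda>f\<in>carrier K. f y) (comult K f) = f (x \<otimes> y)"
      if f: "f \<in> carrier K" for f
      using functional_tensor_cong[OF K_module K_module evl[OF xy(1)] evl[OF xy(2)] _ _ K_comult_closed[OF f],
          of "\<lambda>f. f x" "\<lambda>f. f y"] K_eval2_comult[OF f xy] by simp
    then show "(\<lambda>f\<in>carrier K. f (x \<otimes> y)) =
        (\<lambda>f\<in>carrier K. f x) \<otimes>\<^bsub>dual_algebra R K\<^esub> (\<lambda>f\<in>carrier K. f y)"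
      by (auto simp: convolution_def intro!: restrict_ext)
    show "(\<lambda>f\<in>carrier K. f (x \<oplus> y)) =
        (\<lambda>f\<in>carrier K. f x) \<oplus>\<^bsub>dual_algebra R K\<^esub> (\<lambda>f\<in>carrier K. f y)"
      using xy by (auto simp: linear_maps_add[OF K_functional] intro!: restrict_ext)
  next
    show "(\<lambda>f\<in>carrier K. f \<one>) = \<one>\<^bsub>dual_algebra R K\<^esub>"
      by (auto simp: K_counit K_carrier intro!: restrict_ext)
  qed (simp add: ev)
  moreover have id: "(\<lambda>x\<in>carrier A. f x) = f" "f \<in> dual_carrier R A" if "f \<in> carrier K" for f
    using that by (auto simp: K_carrier finite_dual_carrier_def dual_carrier_def extensional_restrict)
  moreover have "(\<lambda>f. \<lambda>x\<in>carrier A. f x) \<in> algebra_homs R K (dual_algebra R A)"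
  proof -
    interpret K: assoc_algebra R K by (rule K_algebra)
    show ?thesis
      unfolding algebra_homs_def
    proof
      have "(\<lambda>f. f) \<in> linear_maps R K (dual_algebra R A)"
        by (rule linear_mapsI) (simp_all add: id K_add K_smult)
      then show "(\<lambda>f. \<lambda>x\<in>carrier A. f x) \<in> linear_maps R K (dual_algebra R A)"
        by (rule linear_maps_cong_fun[OF _ K_module]) (simp add: id(1))
      show "(\<lambda>f. \<lambda>x\<in>carrier A. f x) \<in> ring_hom K (dual_algebra R A)"
      proof (rule ring_hom_memI)
        fix f g assume f: "f \<in> carrier K" and g: "g \<in> carrier K"
        show "(\<lambda>x\<in>carrier A. f x) \<in> carrier (dual_algebra R A)"
          unfolding id(1)[OF f] using id(2)[OF f] by simp
        show "(\<lambda>x\<in>carrier A. (f \<otimes>\<^bsub>K\<^esub> g) x) =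
            (\<lambda>x\<in>carrier A. f x) \<otimes>\<^bsub>dual_algebra R A\<^esub> (\<lambda>x\<in>carrier A. g x)"
          unfolding id(1)[OF f] id(1)[OF g] id(1)[OF K.m_closed[OF f g]] by (simp add: K_mult)
        show "(\<lambda>x\<in>carrier A. (f \<oplus>\<^bsub>K\<^esub> g) x) =
            (\<lambda>x\<in>carrier A. f x) \<oplus>\<^bsub>dual_algebra R A\<^esub> (\<lambda>x\<in>carrier A. g x)"
          unfolding id(1)[OF f] id(1)[OF g] id(1)[OF K.a_closed[OF f g]] by (simp add: K_add)
      next
        show "(\<lambda>x\<in>carrier A. \<one>\<^bsub>K\<^esub> x) = \<one>\<^bsub>dual_algebra R A\<^esub>"
          unfolding id(1)[OF K.one_closed] by (simp add: K_one)
      qed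
    qed
  qed
  moreover have "alpha_condition TYPE('m) R A K (\<lambda>x f. f x)"
  proof (rule alpha_conditionI)
    show "pairing R A K (\<lambda>x f. f x)"
      using K_eval_linear K_functional by (simp add: pairing_def A K_module)
    fix M :: "('r, 'm) module" and X
    assume M: "module R M" and X: "X \<in> carrier (tensor R M K)"
      and ker: "\<And>x. x \<in> carrier A \<Longrightarrow> alpha_map R M (\<lambda>x f. f x) x X = \<zero>\<^bsub>M\<^esub>"
    note same = tensor_carrier_cong[OF refl refl refl K_same, where M = M]
      tensor_zero_cong[OF refl refl refl K_same, where M = M]
    show "X = \<zero>\<^bsub>tensor R M K\<^esub>"
      using alpha_conditionD[OF alpha_condition_any_type[OF alpha] M, of X] X ker by (simp add: same)
  qed
  ultimately show ?thesis
    using bialgebra_axioms finite_dual_is_bialgebra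
    by (simp add: bialgebra_alpha_pairing_def algebra_homs_def)
qed

end


section \<open>The antipode of the finite dual\<close>

locale hopf_dual = bialgebra_dual R A \<FF> K + hopf_algebra R A
  for R :: "'r ring" and A :: "('r, 'a, 'x) hopf_algebra_scheme" (structure) and \<FF>
    and K :: "('r, 'a \<Rightarrow> 'r, 'k) hopf_algebra_scheme" +
  assumes K_antipode: "f \<in> finite_dual_carrier R A \<FF> \<Longrightarrow> antipode K f = (\<lambda>x\<in>carrier A. f (antipode A x))"
    and K_antipode_closed: "f \<in> finite_dual_carrier R A \<FF> \<Longrightarrow>
      (\<lambda>x\<in>carrier A. f (antipode A x)) \<in> finite_dual_carrier R A \<FF>"
begin

lemma antipode_closed: "x \<in> carrier A \<Longrightarrow> antipode A x \<in> carrier A"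
  by (rule linear_maps_closed[OF antipode_linear])

lemma K_antipode_apply: "f \<in> carrier K \<Longrightarrow> x \<in> carrier A \<Longrightarrow> antipode K f x = f (antipode A x)"
  by (simp add: K_antipode K_carrier)

lemma K_antipode_linear: "antipode K \<in> linear_maps R K K"
proof (rule linear_mapsI)
  interpret K: module R K by (rule K_module)
  show cl: "antipode K f \<in> carrier K" if "f \<in> carrier K" for f
    using that K_antipode_closed by (simp add: K_carrier K_antipode)
  show "antipode K (f \<oplus>\<^bsub>K\<^esub> g) = antipode K f \<oplus>\<^bsub>K\<^esub> antipode K g" if "f \<in> carrier K" "g \<in> carrier K" for f g
    using that by (intro K_eqI) (simp_all add: cl K_antipode_apply K_add_apply antipode_closed)
  show "antipode K (r \<odot>\<^bsub>K\<^esub> f) = r \<odot>\<^bsub>K\<^esub> antipode K f" if "r \<in> carrier R" "f \<in> carrier K" for r f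
    using that by (intro K_eqI) (simp_all add: cl K_antipode_apply K_smult_apply antipode_closed)
qed

text \<open>Each of the two antipode axioms is an instance, with the antipode and the identity in the roles
  of \<open>u\<close> and \<open>v\<close>. At \<open>x\<close>, the axiom for \<open>K\<close> becomes the value of \<open>f\<close> at the axiom for \<open>A\<close>, because the
  sums over the comultiplications of \<open>f\<close> and of \<open>x\<close> can be interchanged.\<close>

lemma K_antipode_sum:
  assumes u: "u \<in> linear_maps R A A" and v: "v \<in> linear_maps R A A"
    and u': "u' \<in> linear_maps R K K" and v': "v' \<in> linear_maps R K K"
    and uu': "\<And>f x. f \<in> carrier K \<Longrightarrow> x \<in> carrier A \<Longrightarrow> u' f x = f (u x)"
    and vv': "\<And>f x. f \<in> carrier K \<Longrightarrow> x \<in> carrier A \<Longrightarrow> v' f x = f (v x)"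
    and ax: "\<And>x. x \<in> carrier A \<Longrightarrow> tensor_lift R A (\<lambda>x y. u x \<otimes> v y) (comult A x) = counit A x \<odot> \<one>"
    and f: "f \<in> carrier K"
  shows "tensor_lift R K (\<lambda>g h. u' g \<otimes>\<^bsub>K\<^esub> v' h) (comult K f) = counit K f \<odot>\<^bsub>K\<^esub> \<one>\<^bsub>K\<^esub>"
proof (rule K_eqI)
  interpret K: assoc_algebra R K by (rule K_algebra)
  let ?S = "self_module R"
  note A = module_axioms and SR = self_module[OF R.cring_axioms]
  note fc = K_comult_closed[OF f]
  note bK = bilinear_maps_pull[OF K.mult_bilinear u' v']
  note bA = bilinear_maps_pull[OF mult_bilinear u v]
  have cf: "counit K f = f \<one>" using f by (simp add: K_carrier K_counit)
  have f1: "f \<one> \<in> carrier R" using linear_maps_closed[OF K_functional[OF f]] by simp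
  show "tensor_lift R K (\<lambda>g h. u' g \<otimes>\<^bsub>K\<^esub> v' h) (comult K f) \<in> carrier K"
    by (rule tensor_lift_closed[OF K_module K_module K_module bK fc])
  show "counit K f \<odot>\<^bsub>K\<^esub> \<one>\<^bsub>K\<^esub> \<in> carrier K" using f1 cf by simp
  fix x assume x: "x \<in> carrier A"
  note xc = comult_closed[OF x] and ex = K_eval_linear[OF x]
  note q = quadrilinear_product[OF ring_mult_bilinear[OF R.cring_axioms]
      bilinear_maps_pull[OF K_eval_bilinear linear_maps_id u]
      bilinear_maps_pull[OF K_eval_bilinear linear_maps_id v]]
  have "tensor_lift R K (\<lambda>g h. u' g \<otimes>\<^bsub>K\<^esub> v' h) (comult K f) x =
      tensor_lift R ?S (\<lambda>g h. (u' g \<otimes>\<^bsub>K\<^esub> v' h) x) (comult K f)"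
    by (rule tensor_lift_comp[OF K_module K_module K_module SR bK ex fc])
  also have "\<dots> = tensor_lift R ?S (\<lambda>g h. tensor_lift R ?S (\<lambda>a b. g (u a) \<otimes>\<^bsub>R\<^esub> h (v b)) (comult A x)) (comult K f)"
  proof (rule tensor_lift_cong[OF K_module K_module SR bilinear_maps_comp[OF ex bK] fc])
    fix g h assume gh: "g \<in> carrier K" "h \<in> carrier K"
    have "u' g \<in> carrier K" "v' h \<in> carrier K"
      using gh linear_maps_closed[OF u'] linear_maps_closed[OF v'] by auto
    then have "functional_tensor R (u' g) (v' h) (comult A x) =
        tensor_lift R ?S (\<lambda>a b. g (u a) \<otimes>\<^bsub>R\<^esub> h (v b)) (comult A x)"
      by (intro functional_tensor_cong[OF A A K_functional K_functional _ _ xc]) (simp_all add: uu' vv' gh)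
    then show "(u' g \<otimes>\<^bsub>K\<^esub> v' h) x = tensor_lift R ?S (\<lambda>a b. g (u a) \<otimes>\<^bsub>R\<^esub> h (v b)) (comult A x)"
      using x by (simp add: K_mult_apply)
  qed
  also have "\<dots> = tensor_lift R ?S (\<lambda>a b. eval2 (u a) (v b) (comult K f)) (comult A x)"
    by (rule tensor_lift_interchange[OF K_module K_module A A SR q fc xc])
  also have "\<dots> = tensor_lift R ?S (\<lambda>a b. f (u a \<otimes> v b)) (comult A x)"
    by (rule sym, rule tensor_lift_cong[OF A A SR bilinear_maps_comp[OF K_functional[OF f] bA] xc])
      (simp add: K_eval2_comult f linear_maps_closed[OF u] linear_maps_closed[OF v])
  also have "\<dots> = f (tensor_lift R A (\<lambda>a b. u a \<otimes> v b) (comult A x))"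
    by (rule tensor_lift_comp[OF A A A SR bA K_functional[OF f] xc, symmetric])
  also have "\<dots> = counit A x \<otimes>\<^bsub>R\<^esub> f \<one>"
    using linear_maps_closed[OF counit_linear x] by (simp add: ax x linear_maps_smult[OF K_functional[OF f]])
  also have "\<dots> = (counit K f \<odot>\<^bsub>K\<^esub> \<one>\<^bsub>K\<^esub>) x"
    using linear_maps_closed[OF counit_linear x] f1 x by (simp add: K_smult_apply K_one cf R.m_comm)
  finally show "tensor_lift R K (\<lambda>g h. u' g \<otimes>\<^bsub>K\<^esub> v' h) (comult K f) x = (counit K f \<odot>\<^bsub>K\<^esub> \<one>\<^bsub>K\<^esub>) x" .
qed

theorem finite_dual_is_hopf_algebra: "hopf_algebra R K"
proof (intro hopf_algebra.intro hopf_algebra_axioms.intro finite_dual_is_bialgebra K_antipode_linear)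
  fix f assume f: "f \<in> carrier K"
  show "tensor_lift R K (\<lambda>x y. antipode K x \<otimes>\<^bsub>K\<^esub> y) (comult K f) = counit K f \<odot>\<^bsub>K\<^esub> \<one>\<^bsub>K\<^esub>"
    by (rule K_antipode_sum[OF antipode_linear linear_maps_id K_antipode_linear linear_maps_id])
      (simp_all add: K_antipode_apply antipode_left f)
  show "tensor_lift R K (\<lambda>x y. x \<otimes>\<^bsub>K\<^esub> antipode K y) (comult K f) = counit K f \<odot>\<^bsub>K\<^esub> \<one>\<^bsub>K\<^esub>"
    by (rule K_antipode_sum[OF linear_maps_id antipode_linear linear_maps_id K_antipode_linear])
      (simp_all add: K_antipode_apply antipode_right f)
qed

end


section \<open>Ideals with projective quotient\<close>

lemma free_lift_unique:
  assumes P: "module R P" and g: "g \<in> linear_maps R (free_module R X) P" and \<phi>: "\<phi> \<in> carrier (free_module R X)"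
  shows "g \<phi> = free_lift R P (\<lambda>x. g (free_basis R x)) \<phi>"
proof -
  have R: "cring R" by (rule module_cring[OF P])
  note F = free_module_is_module[OF R, where X = X]
  have gb: "(\<lambda>x. g (free_basis R x)) \<in> X \<rightarrow> carrier P"
    using linear_maps_closed[OF g free_basis_closed[OF R]] by blast
  note l = free_lift_linear[OF P gb]
  show ?thesis
    using R \<phi>
  proof (induct \<phi> rule: free_module_induct)
    case zero
    show ?case using linear_maps_zero[OF g F P] linear_maps_zero[OF l F P] by simp
  next
    case (add \<phi> \<psi>)
    then show ?case
      using linear_maps_add[OF g add(1,2)] linear_maps_add[OF l add(1,2)] by simp
  next
    case (basis r x)
    then show ?case
      using linear_maps_smult[OF g basis(1) free_basis_closed[OF R basis(2)]]
        linear_maps_smult[OF l basis(1) free_basis_closed[OF R basis(2)]] free_lift_basis[OF P gb basis(2)]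
      by simp
  qed
qed

text \<open>A dual basis of \<open>A/J\<close> with the elements of \<open>A/J\<close> lifted to \<open>A\<close>. It is indexed by its functionals,
  because \<open>projective\<close> asks for a basis set in the type of the elements of the module, which
  are functionals in the case of \<open>(A/J)\<^sup>*\<close>.\<close>

definition dual_basis ::
    "'r ring \<Rightarrow> ('r, 'a, 'x) module_scheme \<Rightarrow> 'a set \<Rightarrow> ('a \<Rightarrow> 'r) set \<Rightarrow> (('a \<Rightarrow> 'r) \<Rightarrow> 'a) \<Rightarrow> bool" where
  "dual_basis R A J Y b \<longleftrightarrow> finite Y \<and> Y \<subseteq> finite_dual_carrier R A {J} \<and> b \<in> Y \<rightarrow> carrier A \<and>
     (\<forall>f\<in>finite_dual_carrier R A {J}. \<forall>x\<in>carrier A.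
        f x = (\<Oplus>\<^bsub>self_module R\<^esub>y\<in>Y. f (b y) \<otimes>\<^bsub>R\<^esub> y x))"

text \<open>A dual basis in which several elements have the same functional can be indexed by its functionals,
  if the elements that belong to the same functional are added up.\<close>

lemma merge_equal_functionals:
  assumes A: "module R A" and Z: "finite Z" and \<phi>: "\<phi> \<in> Z \<rightarrow> functionals R A" and a: "a \<in> Z \<rightarrow> carrier A"
  obtains b where "b \<in> \<phi> ` Z \<rightarrow> carrier A"
    "\<And>f x. f \<in> functionals R A \<Longrightarrow> x \<in> carrier A \<Longrightarrow>
      (\<Oplus>\<^bsub>self_module R\<^esub>z\<in>Z. f (a z) \<otimes>\<^bsub>R\<^esub> \<phi> z x) = (\<Oplus>\<^bsub>self_module R\<^esub>y\<in>\<phi> ` Z. f (b y) \<otimes>\<^bsub>R\<^esub> y x)"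
proof -
  interpret A: module R A by (rule A)
  note SR = self_module[OF A.R.cring_axioms]
  interpret S: module R "self_module R" by (rule SR)
  let ?S = "self_module R"
  define fibre where "fibre y = {z \<in> Z. \<phi> z = y}" for y
  define b where "b y = (\<Oplus>\<^bsub>A\<^esub>z\<in>fibre y. a z)" for y
  have fin: "finite (fibre y)" and af: "a \<in> fibre y \<rightarrow> carrier A" for y using Z a by (auto simp: fibre_def)
  have bc: "b y \<in> carrier A" for y unfolding b_def by (rule A.M.finsum_closed[OF af])
  show thesis
  proof (rule that)
    show "b \<in> \<phi> ` Z \<rightarrow> carrier A" using bc by blast
    fix f x assume f: "f \<in> functionals R A" and x: "x \<in> carrier A"
    have yc: "y x \<in> carrier R" if "y \<in> \<phi> ` Z" for y
      using that \<phi> linear_maps_closed[of y R A ?S x] x by auto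
    have fc: "f u \<in> carrier R" if "u \<in> carrier A" for u using linear_maps_closed[OF f that] by simp
    have tc: "f (a z) \<otimes>\<^bsub>R\<^esub> \<phi> z x \<in> carrier R" if "z \<in> Z" for z
      using fc[OF funcset_mem[OF a that]] yc[of "\<phi> z"] that by simp
    have "(\<Oplus>\<^bsub>?S\<^esub>z\<in>Z. f (a z) \<otimes>\<^bsub>R\<^esub> \<phi> z x) = (\<Oplus>\<^bsub>?S\<^esub>z\<in>(\<Union>y\<in>\<phi> ` Z. fibre y). f (a z) \<otimes>\<^bsub>R\<^esub> \<phi> z x)"
      by (rule arg_cong[of _ _ "finsum ?S (\<lambda>z. f (a z) \<otimes>\<^bsub>R\<^esub> \<phi> z x)"]) (auto simp: fibre_def)
    also have "\<dots> = (\<Oplus>\<^bsub>?S\<^esub>y\<in>\<phi> ` Z. \<Oplus>\<^bsub>?S\<^esub>z\<in>fibre y. f (a z) \<otimes>\<^bsub>R\<^esub> \<phi> z x)"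
      by (rule S.M.add.finprod_UN_disjoint) (use Z fin tc in \<open>auto simp: fibre_def pairwise_def disjnt_def\<close>)
    also have "\<dots> = (\<Oplus>\<^bsub>?S\<^esub>y\<in>\<phi> ` Z. f (b y) \<otimes>\<^bsub>R\<^esub> y x)"
    proof (rule S.M.finsum_cong'[OF refl])
      show "(\<lambda>y. f (b y) \<otimes>\<^bsub>R\<^esub> y x) \<in> \<phi> ` Z \<rightarrow> carrier ?S" using fc[OF bc] yc by auto
      fix y assume y: "y \<in> \<phi> ` Z"
      have "(\<Oplus>\<^bsub>?S\<^esub>z\<in>fibre y. f (a z) \<otimes>\<^bsub>R\<^esub> \<phi> z x) = (\<Oplus>\<^bsub>?S\<^esub>z\<in>fibre y. f (a z) \<otimes>\<^bsub>R\<^esub> y x)"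
        by (rule S.M.finsum_cong'[OF refl]) (use fc a yc[OF y] in \<open>auto simp: fibre_def Pi_def\<close>)
      also have "\<dots> = f (b y) \<otimes>\<^bsub>R\<^esub> y x"
        unfolding b_def
        by (rule linear_maps_finsum[OF linear_maps_mult_right[OF A f yc[OF y]] A SR fin af, symmetric])
      finally show "(\<Oplus>\<^bsub>?S\<^esub>z\<in>fibre y. f (a z) \<otimes>\<^bsub>R\<^esub> \<phi> z x) = f (b y) \<otimes>\<^bsub>R\<^esub> y x" .
    qed
    finally show "(\<Oplus>\<^bsub>?S\<^esub>z\<in>Z. f (a z) \<otimes>\<^bsub>R\<^esub> \<phi> z x) = (\<Oplus>\<^bsub>?S\<^esub>y\<in>\<phi> ` Z. f (b y) \<otimes>\<^bsub>R\<^esub> y x)" .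
  qed
qed

text \<open>Write \<open>A/J\<close> as a direct summand of a free module. The coordinates of the inclusion are functionals
  on \<open>A/J\<close>, and the images of the basis under the projection are the matching elements. As
  \<open>A/J\<close> is finitely generated, only finitely many coordinates are not identically zero.\<close>

lemma (in assoc_algebra) dual_basis_exists:
  fixes J
  assumes J: "ideal J A" and fg: "fin_gen R (quotient_module R A J)"
    and proj: "projective R (quotient_module R A J)"
  obtains Y b where "dual_basis R A J Y b"
proof -
  let ?Q = "quotient_module R A J" and ?S = "self_module R"
  note A = module_axioms and SR = self_module[OF R.cring_axioms] and JS = ideal_submodule[OF J]
  note Q = quotient_is_module[OF A JS] and \<pi> = quotient_projection_linear[OF A JS]
  have JA: "J \<subseteq> carrier A" by (rule submodule_subset[OF A JS])
  obtain X :: "'a set set" and i p where i: "i \<in> linear_maps R ?Q (free_module R X)"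
    and p: "p \<in> linear_maps R (free_module R X) ?Q" and pi: "\<And>q. q \<in> carrier ?Q \<Longrightarrow> p (i q) = q"
    using proj unfolding projective_def by (elim exE bexE) blast
  obtain S where S: "finite S" "S \<subseteq> carrier ?Q" "module_span R ?Q S = carrier ?Q"
    using fg by (auto simp: fin_gen_def)
  let ?F = "free_module R X"
  note F = free_module_is_module[OF R.cring_axioms, where X = X]
  define Z where "Z = (\<Union>s\<in>S. {z. i s z \<noteq> \<zero>\<^bsub>R\<^esub>})"
  have supp: "finite {z. i q z \<noteq> \<zero>\<^bsub>R\<^esub>}" "{z. i q z \<noteq> \<zero>\<^bsub>R\<^esub>} \<subseteq> X" "i q z \<in> carrier R"
    if "q \<in> carrier ?Q" for q z
    using linear_maps_closed[OF i that] by simp_all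
  have Z: "finite Z" "Z \<subseteq> X" 
    unfolding Z_def using S(1,2) supp(1) by (auto intro!: finite_UN_I) (use S(2) supp(2) in blast)
  have coord: "(\<lambda>\<phi>. \<phi> z) \<in> linear_maps R ?F ?S" for z
    by (rule linear_mapsI) simp_all
  have "submodule {q \<in> carrier ?Q. \<forall>z. z \<notin> Z \<longrightarrow> i q z = \<zero>\<^bsub>R\<^esub>} R ?Q"
    using module_carrier_simps[OF Q]
    by (intro submoduleI'[OF Q]) (auto simp: linear_maps_zero[OF i Q F] linear_maps_add[OF i] linear_maps_smult[OF i])
  moreover have "S \<subseteq> {q \<in> carrier ?Q. \<forall>z. z \<notin> Z \<longrightarrow> i q z = \<zero>\<^bsub>R\<^esub>}"
    using S(2) by (auto simp: Z_def)
  ultimately have "module_span R ?Q S \<subseteq> {q \<in> carrier ?Q. \<forall>z. z \<notin> Z \<longrightarrow> i q z = \<zero>\<^bsub>R\<^esub>}"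
    by (rule module_span_least)
  then have iZ: "{z. i q z \<noteq> \<zero>\<^bsub>R\<^esub>} \<subseteq> Z" if "q \<in> carrier ?Q" for q
    using that S(3) by blast
  have \<pi>c: "J +>\<^bsub>A\<^esub> x \<in> carrier ?Q" if "x \<in> carrier A" for x
    by (rule linear_maps_closed[OF \<pi> that])
  define \<phi> where "\<phi> = (\<lambda>z. \<lambda>x\<in>carrier A. i (J +>\<^bsub>A\<^esub> x) z)"
  have "(\<lambda>x. i (J +>\<^bsub>A\<^esub> x) z) \<in> linear_maps R A ?S" for z
    by (rule linear_maps_comp[OF coord linear_maps_comp[OF i \<pi>]])
  then have \<phi>d: "\<phi> z \<in> dual_carrier R A" for z unfolding \<phi>_def by (rule dual_carrierI[OF A])
  have \<phi>J: "\<phi> z x = \<zero>\<^bsub>R\<^esub>" if "x \<in> J" for x z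
  proof -
    have "J +>\<^bsub>A\<^esub> x = \<zero>\<^bsub>?Q\<^esub>" using quotient_coset_zero_iff[OF A JS] that JA by blast
    then show ?thesis using that JA by (auto simp: \<phi>_def linear_maps_zero[OF i Q F])
  qed
  define a where "a = (\<lambda>z. SOME x. x \<in> p (free_basis R z))"
  have a: "a z \<in> carrier A \<and> p (free_basis R z) = J +>\<^bsub>A\<^esub> a z" if "z \<in> Z" for z
  proof -
    have "p (free_basis R z) \<in> carrier ?Q"
      by (rule linear_maps_closed[OF p free_basis_closed[OF R.cring_axioms]]) (use that Z in blast)
    then obtain x where x: "x \<in> carrier A" "p (free_basis R z) = J +>\<^bsub>A\<^esub> x"
      by (auto simp: quotient_carrier[OF A JS])
    then have "x \<in> p (free_basis R z)" using quotient_coset_self[OF A JS] by simp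
    then have "a z \<in> p (free_basis R z)" unfolding a_def by (rule someI[of "\<lambda>x. x \<in> p (free_basis R z)"])
    then show ?thesis using quotient_coset_mem[OF A JS \<open>p (free_basis R z) \<in> carrier ?Q\<close>] by blast
  qed
  have expand: "f x = (\<Oplus>\<^bsub>?S\<^esub>z\<in>Z. f (a z) \<otimes>\<^bsub>R\<^esub> \<phi> z x)"
    if f: "f \<in> finite_dual_carrier R A {J}" and x: "x \<in> carrier A" for f x
  proof -
    interpret S: module R ?S by (rule SR)
    have fl: "f \<in> linear_maps R A ?S" and fJ: "\<And>x. x \<in> J \<Longrightarrow> f x = \<zero>\<^bsub>R\<^esub>"
      using f by (auto simp: finite_dual_carrier_def dual_carrier_def)
    let ?f = "\<lambda>X. f (SOME x. x \<in> X)"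
    have fQ: "?f \<in> linear_maps R ?Q ?S" and fv: "\<And>x. x \<in> carrier A \<Longrightarrow> ?f (J +>\<^bsub>A\<^esub> x) = f x"
      using quotient_lift_linear[OF A JS fl SR] fJ by auto
    note fp = linear_maps_comp[OF fQ p]
    let ?q = "J +>\<^bsub>A\<^esub> x"
    note q = \<pi>c[OF x]
    have gc: "(\<lambda>z. ?f (p (free_basis R z))) \<in> X \<rightarrow> carrier ?S"
      by (intro funcsetI linear_maps_closed[OF fp] free_basis_closed[OF R.cring_axioms])
    have "f x = ?f (p (i ?q))" using fv[OF x] pi[OF q] by simp
    also have "\<dots> = free_lift R ?S (\<lambda>z. ?f (p (free_basis R z))) (i ?q)"
      by (rule free_lift_unique[OF SR fp linear_maps_closed[OF i q]])
    also have "\<dots> = (\<Oplus>\<^bsub>?S\<^esub>z\<in>Z. i ?q z \<odot>\<^bsub>?S\<^esub> ?f (p (free_basis R z)))"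
      by (rule free_lift_superset[OF SR linear_maps_closed[OF i q] gc Z(1) iZ[OF q] Z(2)])
    also have "\<dots> = (\<Oplus>\<^bsub>?S\<^esub>z\<in>Z. f (a z) \<otimes>\<^bsub>R\<^esub> \<phi> z x)"
      by (rule S.M.finsum_cong'[OF refl])
        (use a fv x supp(3)[OF q] linear_maps_closed[OF fl] in \<open>simp_all add: \<phi>_def R.m_comm\<close>)
    finally show ?thesis .
  qed
  have \<phi>a: "\<phi> \<in> Z \<rightarrow> functionals R A" "a \<in> Z \<rightarrow> carrier A"
    using dual_carrierD(1)[OF \<phi>d] a by auto
  show thesis
  proof (rule merge_equal_functionals[OF A Z(1) \<phi>a])
    fix b assume b: "b \<in> \<phi> ` Z \<rightarrow> carrier A"
      and merge: "\<And>f x. f \<in> functionals R A \<Longrightarrow> x \<in> carrier A \<Longrightarrow>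
        (\<Oplus>\<^bsub>?S\<^esub>z\<in>Z. f (a z) \<otimes>\<^bsub>R\<^esub> \<phi> z x) = (\<Oplus>\<^bsub>?S\<^esub>y\<in>\<phi> ` Z. f (b y) \<otimes>\<^bsub>R\<^esub> y x)"
    have "dual_basis R A J (\<phi> ` Z) b"
      unfolding dual_basis_def
    proof (intro conjI ballI b)
      show "\<phi> ` Z \<subseteq> finite_dual_carrier R A {J}" using \<phi>d \<phi>J by (auto simp: finite_dual_carrier_def)
      fix f x assume f: "f \<in> finite_dual_carrier R A {J}" and x: "x \<in> carrier A"
      have "f \<in> linear_maps R A ?S" using f by (auto simp: finite_dual_carrier_def dual_carrier_def)
      from merge[OF this x]
      show "f x = (\<Oplus>\<^bsub>?S\<^esub>y\<in>\<phi> ` Z. f (b y) \<otimes>\<^bsub>R\<^esub> y x)" using expand[OF f x] by simp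
    qed (use Z in simp)
    then show thesis by (rule that)
  qed
qed

context finite_dual
begin

text \<open>The module \<open>M\<close> is the finite dual itself in one application and \<open>(A/J)\<^sup>*\<close> in the other.\<close>

lemma dual_basis_expansion:
  fixes M :: "('r, 'a \<Rightarrow> 'r, 'z) module_scheme"
  assumes M: "module R M" and ev: "\<And>x. x \<in> carrier A \<Longrightarrow> (\<lambda>f. f x) \<in> functionals R M"
    and MW: "carrier M \<subseteq> carrier W" and b: "dual_basis R A J Y b" and YM: "Y \<subseteq> carrier M"
    and fM: "f \<in> carrier M" and f: "f \<in> finite_dual_carrier R A {J}"
  shows "f = (\<Oplus>\<^bsub>M\<^esub>y\<in>Y. f (b y) \<odot>\<^bsub>M\<^esub> y)"
proof (rule functional_eqI)
  interpret M: module R M by (rule M)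
  interpret S: module R "self_module R" by (rule self_module[OF R.cring_axioms])
  have Y: "finite Y" "\<And>y. y \<in> Y \<Longrightarrow> b y \<in> carrier A" using b by (auto simp: dual_basis_def)
  have fb: "f (b y) \<in> carrier R" if "y \<in> Y" for y
    using functional_closed[of f] fM MW Y(2)[OF that] by auto
  have cl: "(\<lambda>y. f (b y) \<odot>\<^bsub>M\<^esub> y) \<in> Y \<rightarrow> carrier M" using fb YM by auto
  show "f \<in> finite_dual_carrier R A \<FF>" using fM MW by auto
  show "(\<Oplus>\<^bsub>M\<^esub>y\<in>Y. f (b y) \<odot>\<^bsub>M\<^esub> y) \<in> finite_dual_carrier R A \<FF>"
    using M.M.finsum_closed[OF cl] MW by auto
  fix x assume x: "x \<in> carrier A"
  have "(\<Oplus>\<^bsub>M\<^esub>y\<in>Y. f (b y) \<odot>\<^bsub>M\<^esub> y) x = (\<Oplus>\<^bsub>self_module R\<^esub>y\<in>Y. (f (b y) \<odot>\<^bsub>M\<^esub> y) x)"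
    by (rule linear_maps_finsum[OF ev[OF x] M S.module_axioms Y(1) cl])
  also have "\<dots> = (\<Oplus>\<^bsub>self_module R\<^esub>y\<in>Y. f (b y) \<otimes>\<^bsub>R\<^esub> y x)"
    by (rule S.M.finsum_cong'[OF refl])
      (use fb YM linear_maps_smult[OF ev[OF x]] linear_maps_closed[OF ev[OF x]] in \<open>auto simp: subset_iff\<close>)
  also have "\<dots> = f x" using b f x by (simp add: dual_basis_def)
  finally show "f x = (\<Oplus>\<^bsub>M\<^esub>y\<in>Y. f (b y) \<odot>\<^bsub>M\<^esub> y) x" by simp
qed

text \<open>Only finitely many functionals occur in a tensor, and the family of ideals is directed.\<close>

lemma tensor_common_ideal:
  fixes M :: "('r, 'm, 'z) module_scheme"
  assumes M: "module R M" and X: "X \<in> carrier (tensor R M W)"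
  shows "\<exists>I\<in>\<FF>. \<forall>J\<in>\<FF>. J \<subseteq> I \<longrightarrow> X \<in> module_span R (tensor R M W)
    {tensor_elem R M W m f | m f. m \<in> carrier M \<and> f \<in> finite_dual_carrier R A {J}}"
    (is "\<exists>I\<in>\<FF>. \<forall>J\<in>\<FF>. J \<subseteq> I \<longrightarrow> X \<in> ?span J")
proof -
  note T = tensor_is_module[OF M W_module]
  have sub: "submodule (?span J) R (tensor R M W)" if "J \<in> \<FF>" for J
    using finite_dual_single_subset[OF that] tensor_elem_closed[OF M W_module]
    by (intro module_span_submodule[OF T]) auto
  show ?thesis
    using X
  proof (induct rule: tensor_induct[OF M W_module, consumes 1, case_names zero add elem])
    case zero
    obtain I where "I \<in> \<FF>" using base_nonempty by blast
    then show ?case by (intro bexI[of _ I] ballI impI submodule_zero[OF T sub])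
  next
    case (add X Y)
    then obtain I I' where I: "I \<in> \<FF>" "\<forall>J\<in>\<FF>. J \<subseteq> I \<longrightarrow> X \<in> ?span J"
      and I': "I' \<in> \<FF>" "\<forall>J\<in>\<FF>. J \<subseteq> I' \<longrightarrow> Y \<in> ?span J" by (elim bexE)
    obtain L where L: "L \<in> \<FF>" "L \<subseteq> I" "L \<subseteq> I'" using base_directed[OF I(1) I'(1)] by blast
    show ?case
    proof (intro bexI[OF _ L(1)] ballI impI)
      fix J assume J: "J \<in> \<FF>" "J \<subseteq> L"
      show "X \<oplus>\<^bsub>tensor R M W\<^esub> Y \<in> ?span J"
        by (rule submodule_add[OF T sub[OF J(1)]]) (use I(2) I'(2) J L in auto)
    qed
  next
    case (elem m f)
    then obtain I where I: "I \<in> \<FF>" "\<And>x. x \<in> I \<Longrightarrow> f x = \<zero>\<^bsub>R\<^esub>" "f \<in> dual_carrier R A"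
      by (auto simp: finite_dual_carrier_def)
    show ?case
    proof (intro bexI[OF _ I(1)] ballI impI subsetD[OF module_span_superset])
      fix J assume "J \<subseteq> I"
      then have "f \<in> finite_dual_carrier R A {J}" using I by (auto simp: finite_dual_carrier_def)
      then show "tensor_elem R M W m f \<in>
          {tensor_elem R M W m f | m f. m \<in> carrier M \<and> f \<in> finite_dual_carrier R A {J}}"
        using elem(1) by blast
    qed
  qed
qed

text \<open>If \<open>(y, b\<^sub>y)\<close> is a dual basis that expands all second factors of a tensor \<open>X\<close>, then
  \<open>X = \<Sum> X(b\<^sub>y) \<otimes> y\<close>, where \<open>X(b\<^sub>y)\<close> is the value of the map \<open>A \<rightarrow> M\<close> that is defined by \<open>X\<close>.\<close>

theorem cofinitary_alpha_condition:
  assumes "cofinitary R A \<FF>"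
  shows "alpha_condition TYPE('m) R A W (\<lambda>x f. f x)"
proof (rule alpha_conditionI[OF eval_pairing])
  fix M :: "('r, 'm) module" and X
  assume M: "module R M" and X: "X \<in> carrier (tensor R M W)"
    and ker: "\<And>x. x \<in> carrier A \<Longrightarrow> alpha_map R M (\<lambda>x f. f x) x X = \<zero>\<^bsub>M\<^esub>"
  let ?T = "tensor R M W"
  note T = tensor_is_module[OF M W_module] and te = tensor_elem_bilinear[OF M W_module]
  interpret T: module R ?T by (rule T)
  obtain I where I: "I \<in> \<FF>" "\<forall>J\<in>\<FF>. J \<subseteq> I \<longrightarrow> X \<in> module_span R ?T
      {tensor_elem R M W m f | m f. m \<in> carrier M \<and> f \<in> finite_dual_carrier R A {J}}"
    using tensor_common_ideal[OF M X] by (elim bexE)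
  obtain J where J: "J \<in> \<FF>" "J \<subseteq> I" "fin_gen R (quotient_module R A J)" "projective R (quotient_module R A J)"
    using assms I(1) by (auto simp: cofinitary_def)
  obtain Y b where b: "dual_basis R A J Y b" using dual_basis_exists[OF base_ideal[OF J(1)] J(3,4)] by blast
  have fin: "finite Y" and YJ: "Y \<subseteq> finite_dual_carrier R A {J}" and bY: "\<And>y. y \<in> Y \<Longrightarrow> b y \<in> carrier A"
    using b by (auto simp: dual_basis_def)
  have YW: "Y \<subseteq> carrier W" using YJ finite_dual_single_subset[OF J(1)] by auto
  define G where "G y X = tensor_elem R M W (alpha_map R M (\<lambda>x f. f x) (b y) X) y" for y X
  have G: "G y \<in> linear_maps R ?T ?T" if "y \<in> Y" for y
    unfolding G_def
    by (rule linear_maps_comp[OF bilinear_maps_left[OF te] tensor_lift_linear[OF M W_module M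
          alpha_bilinear[OF M eval_linear[OF bY[OF that]]]]]) (use that YW in blast)
  have "tensor_elem R M W m f = (\<Oplus>\<^bsub>?T\<^esub>y\<in>Y. G y (tensor_elem R M W m f))"
    if m: "m \<in> carrier M" and f: "f \<in> finite_dual_carrier R A {J}" for m f
  proof -
    have fW: "f \<in> carrier W" using f finite_dual_single_subset[OF J(1)] by auto
    have fb: "f (b y) \<in> carrier R" if "y \<in> Y" for y using functional_closed fW bY[OF that] by simp
    have cl: "(\<lambda>y. f (b y) \<odot>\<^bsub>W\<^esub> y) \<in> Y \<rightarrow> carrier W"
      by (intro funcsetI module_carrier_simps(3)[OF W_module] fb subsetD[OF YW])
    have "tensor_elem R M W m f = tensor_elem R M W m (\<Oplus>\<^bsub>W\<^esub>y\<in>Y. f (b y) \<odot>\<^bsub>W\<^esub> y)"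
      by (rule arg_cong[OF dual_basis_expansion[OF W_module eval_linear subset_refl b YW fW f]])
    also have "\<dots> = (\<Oplus>\<^bsub>?T\<^esub>y\<in>Y. tensor_elem R M W m (f (b y) \<odot>\<^bsub>W\<^esub> y))"
      by (rule linear_maps_finsum[OF bilinear_maps_right[OF te m] W_module T fin cl])
    also have "\<dots> = (\<Oplus>\<^bsub>?T\<^esub>y\<in>Y. G y (tensor_elem R M W m f))"
    proof (rule T.M.finsum_cong'[OF refl])
      show "(\<lambda>y. G y (tensor_elem R M W m f)) \<in> Y \<rightarrow> carrier ?T"
        by (intro funcsetI linear_maps_closed[OF G] tensor_elem_closed[OF M W_module m fW])
      fix y assume y: "y \<in> Y"
      have "alpha_map R M (\<lambda>x f. f x) (b y) (tensor_elem R M W m f) = f (b y) \<odot>\<^bsub>M\<^esub> m"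
        by (rule tensor_lift_elem[OF M W_module M alpha_bilinear[OF M eval_linear[OF bY[OF y]]] m fW])
      then show "tensor_elem R M W m (f (b y) \<odot>\<^bsub>W\<^esub> y) = G y (tensor_elem R M W m f)"
        using linear_maps_smult[OF bilinear_maps_left[OF te subsetD[OF YW y]] fb[OF y] m]
          linear_maps_smult[OF bilinear_maps_right[OF te m] fb[OF y] subsetD[OF YW y]]
        by (simp add: G_def)
    qed
    finally show ?thesis .
  qed
  then have "{tensor_elem R M W m f | m f. m \<in> carrier M \<and> f \<in> finite_dual_carrier R A {J}} \<subseteq>
      {X \<in> carrier ?T. X = (\<Oplus>\<^bsub>?T\<^esub>y\<in>Y. G y X)}"
    using finite_dual_single_subset[OF J(1)] tensor_elem_closed[OF M W_module] by auto
  from module_span_least[OF linear_maps_equalizer_submodule[OF linear_maps_id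
      linear_maps_finsum_pointwise[OF T T fin G] T T] this]
  have "X = (\<Oplus>\<^bsub>?T\<^esub>y\<in>Y. G y X)" using I(2) J(1,2) by blast
  also have "\<dots> = (\<Oplus>\<^bsub>?T\<^esub>y\<in>Y. \<zero>\<^bsub>?T\<^esub>)"
    by (rule T.M.finsum_cong'[OF refl])
      (use YW ker bY linear_maps_zero[OF bilinear_maps_left[OF te] M T] in \<open>auto simp: G_def\<close>)
  finally show "X = \<zero>\<^bsub>?T\<^esub>" by simp
qed

end

text \<open>The map \<open>f \<mapsto> (f(b\<^sub>y))\<^sub>y\<close> is a section of the map from the free module on \<open>Y\<close> to \<open>M\<close>.\<close>

lemma (in assoc_algebra) dual_basis_fin_gen_projective:
  fixes M :: "('r, 'a \<Rightarrow> 'r, 'z) module_scheme"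
  assumes M: "module R M" and ev: "\<And>x. x \<in> carrier A \<Longrightarrow> (\<lambda>f. f x) \<in> functionals R M"
    and Mc: "carrier M = finite_dual_carrier R A {J}" and b: "dual_basis R A J Y b"
    and exp: "\<And>f. f \<in> carrier M \<Longrightarrow> f = (\<Oplus>\<^bsub>M\<^esub>y\<in>Y. f (b y) \<odot>\<^bsub>M\<^esub> y)"
  shows "fin_gen R M" "projective R M"
proof -
  interpret M: module R M by (rule M)
  have Y: "finite Y" "Y \<subseteq> carrier M" "\<And>y. y \<in> Y \<Longrightarrow> b y \<in> carrier A" using b Mc by (auto simp: dual_basis_def)
  have fb: "f (b y) \<in> carrier R" if "f \<in> carrier M" "y \<in> Y" for f y
    using linear_maps_closed[OF ev[OF Y(3)[OF that(2)]] that(1)] by simp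
  have "carrier M \<subseteq> module_span R M Y"
  proof
    fix f assume f: "f \<in> carrier M"
    have sub: "submodule (module_span R M Y) R M" by (rule module_span_submodule[OF M Y(2)])
    have "(\<lambda>y. f (b y) \<odot>\<^bsub>M\<^esub> y) \<in> Y \<rightarrow> module_span R M Y"
      by (intro funcsetI submodule_smult[OF M sub] fb[OF f] subsetD[OF module_span_superset[of Y]])
    then have "(\<Oplus>\<^bsub>M\<^esub>y\<in>Y. f (b y) \<odot>\<^bsub>M\<^esub> y) \<in> module_span R M Y" by (rule submodule_finsum[OF M sub Y(1)])
    then show "f \<in> module_span R M Y" by (simp only: exp[OF f, symmetric])
  qed
  moreover have "module_span R M Y \<subseteq> carrier M" by (rule module_span_least[OF M.carrier_is_submodule Y(2)])
  ultimately show "fin_gen R M" using Y by (auto simp: fin_gen_def)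
  define i where "i = (\<lambda>f y. if y \<in> Y then f (b y) else \<zero>\<^bsub>R\<^esub>)"
  have ic: "i f \<in> carrier (free_module R Y)" "{y. i f y \<noteq> \<zero>\<^bsub>R\<^esub>} \<subseteq> Y" if "f \<in> carrier M" for f
  proof -
    show "{y. i f y \<noteq> \<zero>\<^bsub>R\<^esub>} \<subseteq> Y" by (auto simp: i_def)
    then show "i f \<in> carrier (free_module R Y)"
      using fb[OF that] finite_subset[OF _ Y(1)] by (auto simp: i_def)
  qed
  have i: "i \<in> linear_maps R M (free_module R Y)"
  proof (rule linear_mapsI)
    show "i f \<in> carrier (free_module R Y)" if "f \<in> carrier M" for f by (rule ic(1)[OF that])
    show "i (f \<oplus>\<^bsub>M\<^esub> g) = i f \<oplus>\<^bsub>free_module R Y\<^esub> i g" if "f \<in> carrier M" "g \<in> carrier M" for f g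
      using that Y by (auto simp: i_def linear_maps_add[OF ev])
    show "i (r \<odot>\<^bsub>M\<^esub> f) = r \<odot>\<^bsub>free_module R Y\<^esub> i f" if "r \<in> carrier R" "f \<in> carrier M" for r f
      using that Y by (auto simp: i_def linear_maps_smult[OF ev])
  qed
  have id: "(\<lambda>y. y) \<in> Y \<rightarrow> carrier M" using Y by auto
  have "free_lift R M (\<lambda>y. y) (i f) = f" if f: "f \<in> carrier M" for f
  proof -
    have "free_lift R M (\<lambda>y. y) (i f) = (\<Oplus>\<^bsub>M\<^esub>y\<in>Y. i f y \<odot>\<^bsub>M\<^esub> y)"
      by (rule free_lift_superset[OF M ic(1)[OF f] id Y(1) ic(2)[OF f] subset_refl])
    also have "\<dots> = (\<Oplus>\<^bsub>M\<^esub>y\<in>Y. f (b y) \<odot>\<^bsub>M\<^esub> y)"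
      by (rule M.M.finsum_cong'[OF refl]) (use fb[OF f] Y in \<open>auto simp: i_def\<close>)
    finally show ?thesis by (simp only: exp[OF f, symmetric])
  qed
  then show "projective R M"
    unfolding projective_def
    by (intro exI[of _ Y] bexI[OF _ i] bexI[OF _ free_lift_linear[OF M id]] ballI)
qed

text \<open>The subcoalgebras are the modules \<open>(A/J)\<^sup>*\<close> for the ideals \<open>J\<close> of the family with finitely
  generated projective quotient. The family \<open>{J}\<close> is cofinitary, so its finite dual satisfies the
  \<open>\<alpha>\<close>-condition and is a coalgebra. The inclusion respects the comultiplications, since both are
  characterized by their values \<open>f (x y)\<close>.\<close>

theorem (in coalgebra_dual) cofinitary_infinitesimal_flat:
  assumes cof: "cofinitary R A \<FF>"
  shows "infinitesimal_flat R K"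
proof -
  define \<J> where "\<J> = {J \<in> \<FF>. fin_gen R (quotient_module R A J) \<and> projective R (quotient_module R A J)}"
  have below: "\<exists>J\<in>\<J>. J \<subseteq> I" if "I \<in> \<FF>" for I using cof that by (auto simp: cofinitary_def \<J>_def)
  let ?D = "\<lambda>J. finite_dual_carrier R A {J}"
  have dual_K: "subcoalgebra R (?D J) K \<and> fin_gen R (K\<lparr>carrier := ?D J\<rparr>) \<and> projective R (K\<lparr>carrier := ?D J\<rparr>)"
    if J: "J \<in> \<J>" for J
  proof -
    have JF: "J \<in> \<FF>" and Jfp: "fin_gen R (quotient_module R A J)" "projective R (quotient_module R A J)"
      using J by (auto simp: \<J>_def)
    have D_K: "?D J \<subseteq> carrier K" using finite_dual_single_subset[OF JF] by (simp add: K_carrier)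
    have "ideal_base R A {J}" using base JF by (auto simp: ideal_base_def)
    then interpret J: finite_dual R A "{J}"
      by (simp add: finite_dual_def finite_dual_axioms_def assoc_algebra_axioms)
    have "cofinitary R A {J}" using Jfp by (simp add: cofinitary_def)
    then interpret J: separating_finite_dual R A "{J}"
      using J.cofinitary_alpha_condition by unfold_locales
    let ?\<delta> = "\<lambda>f. THE X. is_dual_comult R A {J} f X" and ?\<epsilon> = "\<lambda>f. f \<one>"
    let ?C = "K\<lparr>carrier := ?D J, comult := ?\<delta>, counit := ?\<epsilon>\<rparr>" and ?M = "K\<lparr>carrier := ?D J\<rparr>"
    interpret J: coalgebra_dual R A "{J}" ?C
      by unfold_locales (simp_all add: K_zero K_add K_smult)
    have M: "module R ?M" by (rule module_cong[OF J.W_module]) (simp_all add: K_zero K_add K_smult)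
    have sub: "submodule (?D J) R K"
      by (rule module.module_incl_imp_submodule[OF K_module D_K M])
    have incl: "(\<lambda>f. f) \<in> linear_maps R ?C K"
      by (rule linear_mapsI) (use D_K in auto)
    have "comult K f = tensor_map R K K (\<lambda>f. f) (\<lambda>f. f) (?\<delta> f)" if f: "f \<in> ?D J" for f
    proof (rule K_eval2_eqI)
      have fC: "f \<in> carrier ?C" using f by simp
      have fc: "?\<delta> f \<in> carrier (tensor R ?C ?C)" using J.K_comult_closed[OF fC] by simp
      show "comult K f \<in> carrier (tensor R K K)" using D_K f by (intro K_comult_closed) auto
      show "tensor_map R K K (\<lambda>f. f) (\<lambda>f. f) (?\<delta> f) \<in> carrier (tensor R K K)"
        by (rule tensor_map_closed[OF K_module K_module J.K_module J.K_module incl incl fc])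
      fix x y assume xy: "x \<in> carrier A" "y \<in> carrier A"
      have "eval2 x y (tensor_map R K K (\<lambda>f. f) (\<lambda>f. f) (?\<delta> f)) = eval2 x y (?\<delta> f)"
        by (rule functional_tensor_tensor_map[OF K_module K_module J.K_module J.K_module incl incl
              K_eval_linear[OF xy(1)] K_eval_linear[OF xy(2)] fc])
      also have "\<dots> = f (x \<otimes> y)" using J.K_eval2_comult[OF fC xy] by simp
      finally show "eval2 x y (comult K f) = eval2 x y (tensor_map R K K (\<lambda>f. f) (\<lambda>f. f) (?\<delta> f))"
        using K_eval2_comult[of f x y] D_K f xy by auto
    qed
    moreover have "counit K f = f \<one>" if "f \<in> ?D J" for f
      using D_K that by (intro K_counit) (auto simp: K_carrier)
    ultimately have "(\<lambda>f. f) \<in> coalgebra_homs R ?C K"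
      using incl by (simp add: coalgebra_homs_def)
    then have "subcoalgebra R (?D J) K"
      unfolding subcoalgebra_def Let_def using sub J.finite_dual_is_coalgebra by blast
    moreover obtain Y b where b: "dual_basis R A J Y b"
      using dual_basis_exists[OF base_ideal[OF JF] Jfp] by blast
    have Mlin: "linear_maps R ?M N = linear_maps R J.W N" for N :: "('r, 'r) module"
      by (rule linear_maps_cong_scheme) (simp_all add: K_add K_smult)
    have ev: "(\<lambda>f. f x) \<in> functionals R ?M" if "x \<in> carrier A" for x
      unfolding Mlin by (rule J.eval_linear[OF that])
    have "f = (\<Oplus>\<^bsub>?M\<^esub>y\<in>Y. f (b y) \<odot>\<^bsub>?M\<^esub> y)" if "f \<in> carrier ?M" for f
      by (rule J.dual_basis_expansion[OF M ev _ b _ that])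
        (use that b in \<open>auto simp: dual_basis_def\<close>)
    then have "fin_gen R ?M" "projective R ?M"
      using dual_basis_fin_gen_projective[OF M ev _ b] by simp_all
    ultimately show ?thesis by blast
  qed
  show ?thesis
    unfolding infinitesimal_flat_def
  proof (intro exI[of _ "?D ` \<J>"] conjI)
    show "?D ` \<J> \<noteq> {}" using base_nonempty below by blast
    show "\<forall>D\<in>?D ` \<J>. \<forall>E\<in>?D ` \<J>. \<exists>G\<in>?D ` \<J>. D \<subseteq> G \<and> E \<subseteq> G"
    proof clarify
      fix I J assume "I \<in> \<J>" "J \<in> \<J>"
      then have "I \<in> \<FF>" "J \<in> \<FF>" by (auto simp: \<J>_def)
      then obtain L where "L \<in> \<FF>" "L \<subseteq> I" "L \<subseteq> J" using base_directed by blast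
      then obtain G where "G \<in> \<J>" "G \<subseteq> I" "G \<subseteq> J" using below by blast
      then show "\<exists>G\<in>?D ` \<J>. ?D I \<subseteq> G \<and> ?D J \<subseteq> G"
        by (intro bexI[of _ "?D G"]) (auto simp: finite_dual_carrier_def)
    qed
    show "\<Union> (?D ` \<J>) = carrier K"
    proof
      show "\<Union> (?D ` \<J>) \<subseteq> carrier K"
        by (auto simp: K_carrier finite_dual_carrier_def \<J>_def)
      show "carrier K \<subseteq> \<Union> (?D ` \<J>)"
      proof
        fix f assume "f \<in> carrier K"
        then obtain I where I: "f \<in> dual_carrier R A" "I \<in> \<FF>" "\<forall>x\<in>I. f x = \<zero>\<^bsub>R\<^esub>"
          by (auto simp: K_carrier finite_dual_carrier_def)
        obtain J where "J \<in> \<J>" "J \<subseteq> I" using below[OF I(2)] by blast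
        with I show "f \<in> \<Union> (?D ` \<J>)" by (auto simp: finite_dual_carrier_def)
      qed
    qed
    show "\<forall>D\<in>?D ` \<J>. subcoalgebra R D K \<and> fin_gen R (K\<lparr>carrier := D\<rparr>) \<and> projective R (K\<lparr>carrier := D\<rparr>)"
      using dual_K by blast
  qed
qed


section \<open>Quasi-admissible filters\<close>

lemma cofinite_filter_base: "cofinite_filter R A \<FF> \<Longrightarrow> ideal_base R A \<FF>"
  unfolding cofinite_filter_def ideal_base_def by blast

text \<open>In the condition on the comultiplication, \<open>f \<otimes> g\<close> vanishes on the image of \<open>I \<otimes> A\<close> if \<open>f\<close> vanishes
  on \<open>I\<close>, and on the image of \<open>A \<otimes> J\<close> if \<open>g\<close> vanishes on \<open>J\<close>.\<close>

lemma functional_tensor_image: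
  assumes M: "module R M" and I: "submodule I R M" and J: "submodule J R M"
    and f: "f \<in> functionals R M" and g: "g \<in> functionals R M"
    and zero: "\<And>a b. a \<in> I \<Longrightarrow> b \<in> J \<Longrightarrow> f a \<otimes>\<^bsub>R\<^esub> g b = \<zero>\<^bsub>R\<^esub>"
    and u: "u \<in> tensor_image R M I J"
  shows "u \<in> carrier (tensor R M M)" "functional_tensor R f g u = \<zero>\<^bsub>R\<^esub>"
proof -
  let ?I = "M\<lparr>carrier := I\<rparr>" and ?J = "M\<lparr>carrier := J\<rparr>" and ?S = "self_module R"
  note SR = self_module[OF module_cring[OF M]]
  note mI = submodule.submodule_is_module[OF I M] and mJ = submodule.submodule_is_module[OF J M]
  have iI: "(\<lambda>x. x) \<in> linear_maps R ?I M" and iJ: "(\<lambda>x. x) \<in> linear_maps R ?J M"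
    using submodule_subset[OF M I] submodule_subset[OF M J] by (auto simp: linear_maps_def)
  obtain Z where Z: "Z \<in> carrier (tensor R ?I ?J)" "u = tensor_map R M M (\<lambda>x. x) (\<lambda>x. x) Z"
    using u by (auto simp: tensor_image_def)
  show "u \<in> carrier (tensor R M M)" unfolding Z(2) by (rule tensor_map_closed[OF M M mI mJ iI iJ Z(1)])
  have "functional_tensor R f g u = functional_tensor R f g Z"
    unfolding Z(2) by (rule functional_tensor_tensor_map[OF M M mI mJ iI iJ f g Z(1)])
  also have "\<dots> = tensor_lift R ?S (\<lambda>a b. \<zero>\<^bsub>?S\<^esub>) Z"
    by (rule tensor_lift_cong[OF mI mJ SR product_bilinear[OF module_cring[OF M] linear_maps_comp[OF f iI]
          linear_maps_comp[OF g iJ]] Z(1)]) (simp add: zero)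
  also have "\<dots> = \<zero>\<^bsub>?S\<^esub>" by (rule tensor_lift_zero_map[OF mI mJ SR Z(1)])
  finally show "functional_tensor R f g u = \<zero>\<^bsub>R\<^esub>" by simp
qed

text \<open>If \<open>f\<close> vanishes on \<open>I\<close> and \<open>g\<close> on \<open>J\<close>, then the convolution product vanishes on the ideal \<open>L\<close> that
  quasi-admissibility yields for \<open>I\<close> and \<open>J\<close>. That some ideal lies in the kernel of the counit
  means that the unit of the convolution product belongs to the finite dual.\<close>

lemma quasi_admissible_bialgebra_dual:
  fixes R :: "'r ring" and A :: "('r, 'a, 'x) coalgebra_scheme"
    and K :: "('r, 'a \<Rightarrow> 'r, 'k) coalgebra_scheme"
  assumes A: "bialgebra R A" and F: "cofinite_filter R A \<FF>" and qa: "quasi_admissible R A \<FF>"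
    and \<alpha>: "alpha_filter TYPE((nat \<Rightarrow> 'r) set) R A \<FF>"
    and K: "carrier K = finite_dual_carrier R A \<FF>" "zero K = zero (finite_dual_algebra R A \<FF>)"
      "add K = add (finite_dual_algebra R A \<FF>)" "smult K = smult (finite_dual_algebra R A \<FF>)"
      "monoid.mult K = convolution R A" "one K = (\<lambda>x\<in>carrier A. counit A x)"
      "comult K = (\<lambda>f. THE X. is_dual_comult R A \<FF> f X)" "counit K = (\<lambda>f. f \<one>\<^bsub>A\<^esub>)"
  shows "bialgebra_dual R A \<FF> K"
proof -
  interpret bialgebra R A by (rule A)
  interpret finite_dual R A \<FF>
    using cofinite_filter_base[OF F] by unfold_locales
  interpret separating_finite_dual R A \<FF>
    using \<alpha> by unfold_locales (simp add: alpha_filter_def)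
  interpret coalgebra_dual R A \<FF> K
    by unfold_locales (simp_all add: K)
  have sub: "submodule I R A" if "I \<in> \<FF>" for I by (rule ideal_submodule[OF base_ideal[OF that]])
  show ?thesis
  proof unfold_locales
    fix f g assume f: "f \<in> finite_dual_carrier R A \<FF>" and g: "g \<in> finite_dual_carrier R A \<FF>"
    obtain I where I: "I \<in> \<FF>" "\<And>x. x \<in> I \<Longrightarrow> f x = \<zero>\<^bsub>R\<^esub>" using f by (auto simp: finite_dual_carrier_def)
    obtain J where J: "J \<in> \<FF>" "\<And>x. x \<in> J \<Longrightarrow> g x = \<zero>\<^bsub>R\<^esub>" using g by (auto simp: finite_dual_carrier_def)
    obtain L where L: "L \<in> \<FF>" "comult A ` L \<subseteq>
        tensor_image R A I (carrier A) <+>\<^bsub>tensor R A A\<^esub> tensor_image R A (carrier A) J"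
      using qa I(1) J(1) unfolding quasi_admissible_def by blast
    note fl = functional_linear[OF f] and gl = functional_linear[OF g]
    have fc: "f x \<in> carrier R" "g x \<in> carrier R" if "x \<in> carrier A" for x
      using functional_closed f g that by auto
    have "functional_tensor R f g (comult A x) = \<zero>\<^bsub>R\<^esub>" if x: "x \<in> L" for x
    proof -
      obtain u v where u: "u \<in> tensor_image R A I (carrier A)" and v: "v \<in> tensor_image R A (carrier A) J"
        and uv: "comult A x = u \<oplus>\<^bsub>tensor R A A\<^esub> v"
        using L(2) x by (auto simp: set_add_def' image_subset_iff)
      have "functional_tensor R f g u = \<zero>\<^bsub>R\<^esub>" "u \<in> carrier (tensor R A A)"
        using functional_tensor_image[OF module_axioms sub[OF I(1)] carrier_is_submodule fl gl _ u] I fc by simp_all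
      moreover have "functional_tensor R f g v = \<zero>\<^bsub>R\<^esub>" "v \<in> carrier (tensor R A A)"
        using functional_tensor_image[OF module_axioms carrier_is_submodule sub[OF J(1)] fl gl _ v] J fc by simp_all
      ultimately show ?thesis
        by (simp add: uv linear_maps_add[OF functional_tensor_linear[OF module_axioms module_axioms fl gl]])
    qed
    then show "convolution R A f g \<in> finite_dual_carrier R A \<FF>"
      unfolding convolution_def by (rule finite_dualI[OF convolution_linear[OF fl gl] L(1)])
  next
    obtain I where "I \<in> \<FF>" "I \<subseteq> {h \<in> carrier A. counit A h = \<zero>\<^bsub>R\<^esub>}"
      using qa unfolding quasi_admissible_def by blast
    then show "(\<lambda>x\<in>carrier A. counit A x) \<in> finite_dual_carrier R A \<FF>"
      by (intro finite_dualI[OF counit_linear]) auto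
  qed (simp_all add: K)
qed

lemma cofinitary_alpha_filter:
  assumes "bialgebra R A" "cofinite_filter R A \<FF>" "cofinitary R A \<FF>"
  shows "alpha_filter TYPE('m) R A \<FF>"
proof -
  interpret bialgebra R A by fact
  interpret finite_dual R A \<FF>
    using cofinite_filter_base[OF assms(2)] by unfold_locales
  show ?thesis unfolding alpha_filter_def by (rule cofinitary_alpha_condition[OF assms(3)])
qed

lemma finite_dual_bialgebra_simps:
  "carrier (finite_dual_bialgebra R H \<FF>) = finite_dual_carrier R H \<FF>"
  "zero (finite_dual_bialgebra R H \<FF>) = zero (finite_dual_algebra R H \<FF>)"
  "add (finite_dual_bialgebra R H \<FF>) = add (finite_dual_algebra R H \<FF>)"
  "smult (finite_dual_bialgebra R H \<FF>) = smult (finite_dual_algebra R H \<FF>)"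
  "monoid.mult (finite_dual_bialgebra R H \<FF>) = convolution R H"
  "one (finite_dual_bialgebra R H \<FF>) = (\<lambda>x\<in>carrier H. counit H x)"
  "comult (finite_dual_bialgebra R H \<FF>) = (\<lambda>f. THE X. is_dual_comult R H \<FF> f X)"
  "counit (finite_dual_bialgebra R H \<FF>) = (\<lambda>f. f \<one>\<^bsub>H\<^esub>)"
  by (simp_all add: finite_dual_bialgebra_def module.defs coalgebra.defs)

lemma finite_dual_hopf_simps:
  "carrier (finite_dual_hopf R H \<FF>) = finite_dual_carrier R H \<FF>"
  "zero (finite_dual_hopf R H \<FF>) = zero (finite_dual_algebra R H \<FF>)"
  "add (finite_dual_hopf R H \<FF>) = add (finite_dual_algebra R H \<FF>)"
  "smult (finite_dual_hopf R H \<FF>) = smult (finite_dual_algebra R H \<FF>)"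
  "monoid.mult (finite_dual_hopf R H \<FF>) = convolution R H"
  "one (finite_dual_hopf R H \<FF>) = (\<lambda>x\<in>carrier H. counit H x)"
  "comult (finite_dual_hopf R H \<FF>) = (\<lambda>f. THE X. is_dual_comult R H \<FF> f X)"
  "counit (finite_dual_hopf R H \<FF>) = (\<lambda>f. f \<one>\<^bsub>H\<^esub>)"
  "antipode (finite_dual_hopf R H \<FF>) = (\<lambda>f. \<lambda>h\<in>carrier H. f (antipode H h))"
  by (simp_all add: finite_dual_hopf_def coalgebra.defs hopf_algebra.defs finite_dual_bialgebra_simps)

lemma quasi_admissible_hopf_dual:
  fixes R :: "'r ring" and H :: "('r, 'h, 'x) hopf_algebra_scheme"
  assumes H: "hopf_algebra R H" and F: "cofinite_filter R H \<FF>" and qa: "hopf_quasi_admissible R H \<FF>"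
    and \<alpha>: "alpha_filter TYPE((nat \<Rightarrow> 'r) set) R H \<FF>"
  shows "hopf_dual R H \<FF> (finite_dual_hopf R H \<FF>)"
proof -
  interpret hopf_algebra R H by (rule H)
  interpret bialgebra_dual R H \<FF> "finite_dual_hopf R H \<FF>"
    by (rule quasi_admissible_bialgebra_dual[OF bialgebra_axioms F _ \<alpha>])
      (use qa in \<open>simp_all add: hopf_quasi_admissible_def finite_dual_hopf_simps\<close>)
  show ?thesis
  proof unfold_locales
    fix f assume f: "f \<in> finite_dual_carrier R H \<FF>"
    then obtain I where I: "I \<in> \<FF>" "\<And>x. x \<in> I \<Longrightarrow> f x = \<zero>\<^bsub>R\<^esub>" by (auto simp: finite_dual_carrier_def)
    obtain J where "J \<in> \<FF>" "antipode H ` J \<subseteq> I" using qa I(1) by (auto simp: hopf_quasi_admissible_def)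
    then show "(\<lambda>x\<in>carrier H. f (antipode H x)) \<in> finite_dual_carrier R H \<FF>"
      using I by (intro finite_dualI[OF linear_maps_comp[OF functional_linear[OF f] antipode_linear]]) auto
  qed (simp add: finite_dual_hopf_simps)
qed

theorem proposition4p11:
  fixes R :: "'r ring"
    and B :: "('r, 'b) coalgebra" and H :: "('r, 'h) hopf_algebra"
    and \<BB> :: "'b set set" and \<FF> :: "'h set set"
  assumes "cring R"
  shows
    "(bialgebra R B \<and> cofinite_filter R B \<BB> \<and> quasi_admissible R B \<BB> \<longrightarrow>
       (noetherian_ring R \<and> alpha_filter TYPE((nat \<Rightarrow> 'r) set) R B \<BB> \<longrightarrow>
          dual_comult_determined R B \<BB> \<and>
          bialgebra R (finite_dual_bialgebra R B \<BB>) \<and>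
          bialgebra_alpha_pairing TYPE('m) R B (finite_dual_bialgebra R B \<BB>) (\<lambda>h f. f h)) \<and>
       (cofinitary R B \<BB> \<longrightarrow>
          dual_comult_determined R B \<BB> \<and>
          bialgebra R (finite_dual_bialgebra R B \<BB>) \<and>
          infinitesimal_flat R (finite_dual_bialgebra R B \<BB>) \<and>
          bialgebra_alpha_pairing TYPE('m) R B (finite_dual_bialgebra R B \<BB>) (\<lambda>h f. f h))) \<and>
     (hopf_algebra R H \<and> cofinite_filter R H \<FF> \<and> hopf_quasi_admissible R H \<FF> \<longrightarrow>
       (noetherian_ring R \<and> alpha_filter TYPE((nat \<Rightarrow> 'r) set) R H \<FF> \<longrightarrow>
          dual_comult_determined R H \<FF> \<and>
          hopf_algebra R (finite_dual_hopf R H \<FF>) \<and>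
          hopf_alpha_pairing TYPE('m) R H (finite_dual_hopf R H \<FF>) (\<lambda>h f. f h)) \<and>
       (cofinitary R H \<FF> \<longrightarrow>
          dual_comult_determined R H \<FF> \<and>
          hopf_algebra R (finite_dual_hopf R H \<FF>) \<and>
          infinitesimal_flat R (finite_dual_hopf R H \<FF>) \<and>
          hopf_alpha_pairing TYPE('m) R H (finite_dual_hopf R H \<FF>) (\<lambda>h f. f h)))"
proof -
  have bialg: "dual_comult_determined R B \<BB> \<and>
      bialgebra R (finite_dual_bialgebra R B \<BB>) \<and>
      bialgebra_alpha_pairing TYPE('m) R B (finite_dual_bialgebra R B \<BB>) (\<lambda>h f. f h) \<and>
      (cofinitary R B \<BB> \<longrightarrow> infinitesimal_flat R (finite_dual_bialgebra R B \<BB>))"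
    if "bialgebra R B" "cofinite_filter R B \<BB>" "quasi_admissible R B \<BB>"
      "alpha_filter TYPE((nat \<Rightarrow> 'r) set) R B \<BB>"
  proof -
    interpret bialgebra_dual R B \<BB> "finite_dual_bialgebra R B \<BB>"
      by (rule quasi_admissible_bialgebra_dual[OF that]) (simp_all add: finite_dual_bialgebra_simps)
    show ?thesis
      using dual_comult_unique finite_dual_is_bialgebra finite_dual_alpha_pairing
        cofinitary_infinitesimal_flat by (auto simp: dual_comult_determined_def)
  qed
  have hopf: "dual_comult_determined R H \<FF> \<and>
      hopf_algebra R (finite_dual_hopf R H \<FF>) \<and>
      hopf_alpha_pairing TYPE('m) R H (finite_dual_hopf R H \<FF>) (\<lambda>h f. f h) \<and>
      (cofinitary R H \<FF> \<longrightarrow> infinitesimal_flat R (finite_dual_hopf R H \<FF>))"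
    if "hopf_algebra R H" "cofinite_filter R H \<FF>" "hopf_quasi_admissible R H \<FF>"
      "alpha_filter TYPE((nat \<Rightarrow> 'r) set) R H \<FF>"
  proof -
    interpret hopf_dual R H \<FF> "finite_dual_hopf R H \<FF>"
      by (rule quasi_admissible_hopf_dual[OF that])
    show ?thesis
      using dual_comult_unique finite_dual_is_hopf_algebra finite_dual_alpha_pairing
        cofinitary_infinitesimal_flat that(1)
      by (auto simp: dual_comult_determined_def hopf_alpha_pairing_def)
  qed
  have "bialgebra R H" if "hopf_algebra R H"
    using that by (simp add: hopf_algebra_def)
  then show ?thesis
    using bialg hopf cofinitary_alpha_filter[of R B \<BB>] cofinitary_alpha_filter[of R H \<FF>] by blast
qed

end
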